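(* Let $G$ be a connected Lie group and let $k>1$ be an integer. Let $P_k:G\to G$, $P_k(g)=g^k$, and let $\mathrm{Reg}(G)$ be the set of regular elements of $G$. Then $P_k(G)\cap \mathrm{Reg}(G)$ is closed in $\mathrm{Reg}(G)$ (with the subspace topology).
   Context: Lie groups are real and finite-dimensional. For a Lie group $G$ with Lie algebra $\mathfrak g$, an element $g\in G$ is called regular if the nilspace $N(\mathrm{Ad}_g-1)=\bigcup_{n\ge1}\ker(\mathrm{Ad}_g-1)^n\subset\mathfrak g$ has the minimal possible dimension among all elements of $G$; $\mathrm{Reg}(G)$ denotes the set of regular elements. *)

theory Defs
  imports "HOL-Analysis.Analysis" "HOL-Algebra.Group" "HOL-Library.Function_Algebras"
begin

text \<open>
  The libraries provide no smooth manifolds, so they are set up here. The model space of a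
  manifold is a linear subspace \<open>E\<close> of a Euclidean space \<open>'e\<close>; since \<open>E = {0}\<close> is allowed and
  \<open>'e\<close> is arbitrary, this covers all finite dimensions, including dimension \<open>0\<close> (which the class
  \<open>euclidean_space\<close> itself excludes).
\<close>

subsection \<open>Smooth maps between open subsets of the model spaces\<close>

text \<open>
  Used only for \<open>U\<close> relatively open in the subspace \<open>E\<close>. There the restriction of \<open>f' x\<close> to \<open>E\<close> is
  uniquely determined; its values outside \<open>E\<close> are arbitrary and are never used. As \<open>E\<close> is
  finite-dimensional, the condition in the successor case says that \<open>f\<close> is differentiable with a
  derivative of class \<open>C\<^sup>k\<close>.
\<close>

primrec Ck_on :: "nat \<Rightarrow> 'e::euclidean_space set \<Rightarrow> 'e set \<Rightarrow> ('e \<Rightarrow> 'f::euclidean_space) \<Rightarrow> bool"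
where
  "Ck_on 0 E U f \<longleftrightarrow> continuous_on U f"
| "Ck_on (Suc k) E U f \<longleftrightarrow>
     (\<exists>f'. (\<forall>x\<in>U. (f has_derivative f' x) (at x within U)) \<and>
           (\<forall>v\<in>E. Ck_on k E U (\<lambda>x. f' x v)))"

definition smooth_on :: "'e::euclidean_space set \<Rightarrow> 'e set \<Rightarrow> ('e \<Rightarrow> 'f::euclidean_space) \<Rightarrow> bool"
  where "smooth_on E U f \<longleftrightarrow> (\<forall>k. Ck_on k E U f)"

subsection \<open>Smooth manifolds\<close>

type_synonym ('a, 'e) chart = "'a set \<times> ('a \<Rightarrow> 'e)"

record ('a, 'e) manifold =
  mtop :: "'a topology"
  model :: "'e set"
  atlas :: "('a, 'e) chart set"

locale smooth_manifold =
  fixes M :: "('a, 'e::euclidean_space) manifold"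
  assumes Hausdorff: "Hausdorff_space (mtop M)"
    and second_countable: "second_countable (mtop M)"
    and subspace_model: "subspace (model M)"
    and chart_domain: "(U, \<phi>) \<in> atlas M \<Longrightarrow> openin (mtop M) U"
    and chart_image: "(U, \<phi>) \<in> atlas M \<Longrightarrow> openin (top_of_set (model M)) (\<phi> ` U)"
    and chart_homeo: "(U, \<phi>) \<in> atlas M \<Longrightarrow>
      homeomorphic_map (subtopology (mtop M) U) (top_of_set (\<phi> ` U)) \<phi>"
    and chart_compatible: "(U, \<phi>) \<in> atlas M \<Longrightarrow> (V, \<psi>) \<in> atlas M \<Longrightarrow>
      smooth_on (model M) (\<phi> ` (U \<inter> V)) (\<psi> \<circ> inv_into U \<phi>)"
    and atlas_covers: "(\<Union>(U, \<phi>)\<in>atlas M. U) = topspace (mtop M)"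

definition smooth_map ::
  "('a, 'e::euclidean_space) manifold \<Rightarrow> ('b, 'f::euclidean_space) manifold \<Rightarrow> ('a \<Rightarrow> 'b) \<Rightarrow> bool"
  where "smooth_map M N f \<longleftrightarrow> continuous_map (mtop M) (mtop N) f \<and>
    (\<forall>(U, \<phi>)\<in>atlas M. \<forall>(V, \<psi>)\<in>atlas N.
       smooth_on (model M) (\<phi> ` (U \<inter> f -` V)) (\<psi> \<circ> f \<circ> inv_into U \<phi>))"

definition prod_manifold ::
  "('a, 'e::euclidean_space) manifold \<Rightarrow> ('b, 'f::euclidean_space) manifold \<Rightarrow>
   ('a \<times> 'b, 'e \<times> 'f) manifold"
  where "prod_manifold M N =
    \<lparr> mtop = prod_topology (mtop M) (mtop N),
      model = model M \<times> model N,
      atlas = {(U \<times> V, map_prod \<phi> \<psi>) |U \<phi> V \<psi>. (U, \<phi>) \<in> atlas M \<and> (V, \<psi>) \<in> atlas N} \<rparr>"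

subsection \<open>Tangent spaces and differentials\<close>

definition charts_at :: "('a, 'e) manifold \<Rightarrow> 'a \<Rightarrow> ('a, 'e) chart set"
  where "charts_at M p = {c \<in> atlas M. p \<in> fst c}"

definition chart_derivative ::
  "'a \<Rightarrow> ('a \<Rightarrow> 'b) \<Rightarrow> ('a, 'e::euclidean_space) chart \<Rightarrow> ('b, 'f::euclidean_space) chart \<Rightarrow> 'e \<Rightarrow> 'f"
  where "chart_derivative p f c d =
    frechet_derivative (snd d \<circ> f \<circ> inv_into (fst c) (snd c))
      (at (snd c p) within snd c ` fst c)"

text \<open>
  A tangent vector at \<open>p\<close> is the family of its coordinate vectors in all charts around \<open>p\<close>, which
  transform by the derivatives of the coordinate changes. At all other indices the family is set
  to \<open>0\<close>, so that distinct families are distinct tangent vectors.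
\<close>

definition tangent_space ::
  "('a, 'e::euclidean_space) manifold \<Rightarrow> 'a \<Rightarrow> (('a, 'e) chart \<Rightarrow> 'e) set"
  where "tangent_space M p =
    {X. (\<forall>c. c \<notin> charts_at M p \<longrightarrow> X c = 0) \<and>
        (\<forall>c\<in>charts_at M p. X c \<in> model M) \<and>
        (\<forall>c\<in>charts_at M p. \<forall>d\<in>charts_at M p. X d = chart_derivative p id c d (X c))}"

text \<open>
  Tangent vectors are added and scaled pointwise; there is no \<open>real_vector\<close> instance for function
  types, hence the dimension is taken with respect to this explicit scaling.
\<close>

definition tangent_dim :: "(('a, 'e::euclidean_space) chart \<Rightarrow> 'e) set \<Rightarrow> nat"
  where "tangent_dim = vector_space.dim (\<lambda>r X c. r *\<^sub>R X c)"

text \<open>For \<open>f\<close> smooth, the value below does not depend on the chart \<open>c\<close> (chain rule).\<close>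

definition differential ::
  "('a, 'e::euclidean_space) manifold \<Rightarrow> ('b, 'f::euclidean_space) manifold \<Rightarrow> 'a \<Rightarrow> ('a \<Rightarrow> 'b) \<Rightarrow>
   (('a, 'e) chart \<Rightarrow> 'e) \<Rightarrow> (('b, 'f) chart \<Rightarrow> 'f)"
  where "differential M N p f X =
    (\<lambda>d. if d \<in> charts_at N (f p)
         then THE w. \<forall>c\<in>charts_at M p. w = chart_derivative p f c d (X c)
         else 0)"

subsection \<open>Lie groups and regular elements\<close>

locale lie_group = group G + smooth_manifold M
  for G :: "('a, 'm) monoid_scheme" (structure) and M :: "('a, 'e::euclidean_space) manifold" +
  assumes topspace_carrier: "topspace (mtop M) = carrier G"
    and smooth_mult: "smooth_map (prod_manifold M M) M (\<lambda>(x, y). x \<otimes> y)"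
    and smooth_inv: "smooth_map M M (\<lambda>x. inv x)"

text \<open>The Lie bracket plays no role here: only the vector space underlying the Lie algebra is used.\<close>

definition lie_algebra ::
  "('a, 'm) monoid_scheme \<Rightarrow> ('a, 'e::euclidean_space) manifold \<Rightarrow> (('a, 'e) chart \<Rightarrow> 'e) set"
  where "lie_algebra G M = tangent_space M \<one>\<^bsub>G\<^esub>"

definition Ad ::
  "('a, 'm) monoid_scheme \<Rightarrow> ('a, 'e::euclidean_space) manifold \<Rightarrow> 'a \<Rightarrow>
   (('a, 'e) chart \<Rightarrow> 'e) \<Rightarrow> (('a, 'e) chart \<Rightarrow> 'e)"
  where "Ad G M g = differential M M \<one>\<^bsub>G\<^esub> (\<lambda>x. g \<otimes>\<^bsub>G\<^esub> x \<otimes>\<^bsub>G\<^esub> inv\<^bsub>G\<^esub> g)"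

definition nilspace :: "'v::zero set \<Rightarrow> ('v \<Rightarrow> 'v) \<Rightarrow> 'v set"
  where "nilspace V L = (\<Union>n\<in>{1::nat..}. {X \<in> V. (L ^^ n) X = 0})"

definition regular_elements ::
  "('a, 'm) monoid_scheme \<Rightarrow> ('a, 'e::euclidean_space) manifold \<Rightarrow> 'a set"
  where "regular_elements G M =
    {g \<in> carrier G. \<forall>h \<in> carrier G.
       tangent_dim (nilspace (lie_algebra G M) (\<lambda>X. Ad G M g X - X)) \<le>
       tangent_dim (nilspace (lie_algebra G M) (\<lambda>X. Ad G M h X - X))}"

definition power_map :: "('a, 'm) monoid_scheme \<Rightarrow> nat \<Rightarrow> 'a \<Rightarrow> 'a"
  where "power_map G k g = g [^]\<^bsub>G\<^esub> k"

end

theory Submission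
  imports Defs "HOL-Computational_Algebra.Polynomial"
begin

text \<open>
  Let \<open>g\<close> be regular. It suffices that \<open>g\<close> is a \<open>k\<close>-th power whenever some regular \<open>w g\<close> with \<open>w\<close>
  close to \<open>1\<close> is one, say \<open>w g = h\<^sup>k\<close>. By minimality of the dimension, \<open>Ad h\<close> and \<open>Ad (w g) = (Ad h)\<^sup>k\<close>
  have the same nilspace \<open>N\<close>, so \<open>Ad h\<close> is unipotent on \<open>N\<close>. A unipotent operator is a polynomial in
  its \<open>k\<close>-th power; hence \<open>Ad h\<close> is bounded on \<open>N\<close> independently of \<open>h\<close>, although \<open>h\<close> itself may be
  far away. For \<open>X \<in> N\<close> we have \<open>(exp X h)\<^sup>k = exp X exp (Ad h X) \<dots> exp ((Ad h)\<^sup>k\<^sup>-\<^sup>1 X) w g\<close>, and we look for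
  \<open>y\<close> and \<open>X\<close> with \<open>y (exp X h)\<^sup>k y\<inverse> = g\<close>. The linearization \<open>(Ad (w g) - 1) Y - \<Sum>\<^sub>j (Ad h)\<^sup>j X\<close> of
  this equation in \<open>Y = log y\<close> and \<open>X\<close> is onto with a uniformly bounded right inverse, because the first summand
  covers the Fitting complement of \<open>N\<close> and the second covers \<open>N\<close>. Brouwer's theorem then solves the
  equation as soon as \<open>w\<close> is small, uniformly in \<open>h\<close>.
\<close>

section \<open>Operators and their nilspaces\<close>

text \<open>Uniform in \<open>h\<close> are only the second-order estimate of the multiplication
  near \<open>\<one>\<close> and the action of \<open>Ad h\<close> on the nilspace. The exponential
  map links the two: exp (Ad h X) = h exp X h^-1 as soon as \<open>X\<close> and
  \<open>Ad h X\<close> are both small. This is why the root is corrected by a factor exp X with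
  \<open>X\<close> in the nilspace. The element \<open>y\<close> is placed so that the fixed
  \<open>g\<close> alone conjugates it: the equation solved is g y g^-1 = y exp X exp (Ad h X) ...
  w. For the resulting map, continuity and a closeness to the identity that is uniform in
  \<open>h\<close> are at hand, which is what Brouwer's theorem asks for.\<close>

definition poly_op :: "real poly \<Rightarrow> ('v::real_vector \<Rightarrow> 'v) \<Rightarrow> 'v \<Rightarrow> 'v"
  where "poly_op p A x = (\<Sum>i\<le>degree p. coeff p i *\<^sub>R (A ^^ i) x)"

lemma linear_funpow:
  fixes A :: "'v::real_vector \<Rightarrow> 'v"
  assumes "linear A" shows "linear (A ^^ n)"
proof (induction n)
  case 0
  then show ?case by (simp add: linear_id[unfolded id_def] id_def)
next
  case (Suc n)
  then show ?case using linear_compose[OF Suc assms] by (simp add: o_def)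
qed

lemma funpow_closed: "(\<And>x. x \<in> E \<Longrightarrow> A x \<in> E) \<Longrightarrow> x \<in> E \<Longrightarrow> (A ^^ n) x \<in> E"
  by (induction n) auto

lemma poly_op_upto:
  assumes "degree p \<le> n"
  shows "poly_op p A x = (\<Sum>i\<le>n. coeff p i *\<^sub>R (A ^^ i) x)"
  unfolding poly_op_def using assms
  by (intro sum.mono_neutral_left) (auto simp: coeff_eq_0 not_le)

lemma poly_op_0 [simp]: "poly_op 0 A x = 0"
  by (simp add: poly_op_def)

lemma poly_op_pCons: "poly_op (pCons a p) A x = a *\<^sub>R x + poly_op p A (A x)"
proof -
  have "poly_op (pCons a p) A x = (\<Sum>i\<le>Suc (degree p). coeff (pCons a p) i *\<^sub>R (A ^^ i) x)"
    by (rule poly_op_upto) (rule degree_pCons_le)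
  then show ?thesis
    by (simp add: sum.atMost_Suc_shift poly_op_def funpow_swap1 del: sum.atMost_Suc)
qed

lemma poly_op_add: "poly_op (p + q) A x = poly_op p A x + poly_op q A x"
proof -
  let ?n = "max (degree p) (degree q)"
  have "degree (p + q) \<le> ?n" by (rule degree_add_le_max)
  then show ?thesis
    by (simp add: poly_op_upto[of _ ?n] scaleR_add_left sum.distrib)
qed

lemma poly_op_smult: "poly_op (smult c p) A x = c *\<^sub>R poly_op p A x"
  by (cases "c = 0") (simp_all add: poly_op_def scaleR_sum_right)

lemma poly_op_diff: "poly_op (p - q) A x = poly_op p A x - poly_op q A x"
proof -
  have "p - q = p + smult (-1) q" by simp
  then show ?thesis by (simp only: poly_op_add poly_op_smult) simp
qed

lemma poly_op_1 [simp]: "poly_op 1 A x = x"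
  by (simp add: poly_op_def)

lemma poly_op_monom: "poly_op (monom c n) A x = c *\<^sub>R (A ^^ n) x"
proof -
  have "poly_op (monom c n) A x = (\<Sum>i\<le>n. if i = n then c *\<^sub>R (A ^^ n) x else 0)"
    unfolding poly_op_upto[OF degree_monom_le] by (rule sum.cong) auto
  then show ?thesis by simp
qed

lemma poly_op_sum: "poly_op (\<Sum>i\<in>I. f i) A x = (\<Sum>i\<in>I. poly_op (f i) A x)"
  by (induction I rule: infinite_finite_induct) (simp_all add: poly_op_add)

lemma linear_poly_op:
  assumes "linear A" shows "linear (poly_op p A)"
  unfolding poly_op_def using linear_funpow[OF assms]
  by (intro linear_compose_sum ballI linear_compose_scale_right) auto

lemma poly_op_commute:
  assumes "linear A" shows "A (poly_op p A x) = poly_op p A (A x)"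
  by (simp add: poly_op_def linear_sum[OF assms] linear_scale[OF assms] funpow_swap1)

lemma poly_op_mult:
  assumes "linear A"
  shows "poly_op (p * q) A x = poly_op p A (poly_op q A x)"
proof (induction p arbitrary: x)
  case (pCons a p)
  then show ?case
    by (simp add: poly_op_pCons poly_op_add poly_op_smult poly_op_commute[OF assms])
qed simp

text \<open>\<open>[:-1, 1:]\<close> is the polynomial x - 1, so its powers evaluate to powers of A
  - 1. This is the bridge between nilspaces and divisibility by powers of x - 1.\<close>

lemma poly_op_power_1:
  assumes "linear A"
  shows "poly_op ([:-1, 1:] ^ n) A x = ((\<lambda>x. A x - x) ^^ n) x"
proof (induction n arbitrary: x)
  case (Suc n)
  then show ?case
    by (simp only: power_Suc poly_op_mult[OF assms])
      (simp add: poly_op_pCons)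
qed simp

lemma poly_op_pcompose_monom:
  assumes "linear A"
  shows "poly_op (pcompose p (monom 1 k)) A x = poly_op p (A ^^ k) x"
proof (induction p arbitrary: x)
  case (pCons a p)
  show ?case
    by (simp only: pcompose_pCons poly_op_add mult.commute[of "monom 1 k"] poly_op_mult[OF assms])
      (simp add: poly_op_pCons poly_op_monom pCons.IH)
qed simp

lemma norm_poly_op_le:
  fixes B :: "'v::real_normed_vector \<Rightarrow> 'v"
  assumes E: "\<And>x. x \<in> E \<Longrightarrow> B x \<in> E" and K: "\<And>x. x \<in> E \<Longrightarrow> norm (B x) \<le> K * norm x"
    and "K \<ge> 0" "x \<in> E"
  shows "norm (poly_op p B x) \<le> (\<Sum>i\<le>degree p. \<bar>coeff p i\<bar> * K ^ i) * norm x"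
proof -
  have pow: "norm ((B ^^ i) x) \<le> K ^ i * norm x" for i
  proof (induction i)
    case (Suc i)
    have "norm ((B ^^ Suc i) x) \<le> K * norm ((B ^^ i) x)"
      using K[OF funpow_closed[OF E \<open>x \<in> E\<close>]] by simp
    also have "\<dots> \<le> K * (K ^ i * norm x)" using Suc \<open>K \<ge> 0\<close> by (rule mult_left_mono)
    finally show ?case by (simp add: mult.assoc)
  qed simp
  have "norm (poly_op p B x) \<le> (\<Sum>i\<le>degree p. \<bar>coeff p i\<bar> * (K ^ i * norm x))"
    unfolding poly_op_def by (rule sum_norm_le) (simp add: mult_left_mono pow)
  then show ?thesis by (simp add: sum_distrib_right mult.assoc)
qed

text \<open>On a vector killed by (A - 1)^n, polynomials congruent modulo (x - 1)^n act equally.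
  Identities for unipotent operators are read off from congruences in this way.\<close>

lemma poly_op_eq_0_of_dvd:
  assumes "linear A" "[:-1, 1:] ^ n dvd p" "((\<lambda>x. A x - x) ^^ n) x = 0"
  shows "poly_op p A x = 0"
proof -
  obtain q where "p = q * [:-1, 1:] ^ n" using assms(2) by (metis dvd_def mult.commute)
  then show ?thesis
    using assms(3) linear_0[OF linear_poly_op[OF assms(1)]]
    by (simp add: poly_op_mult[OF assms(1)] poly_op_power_1[OF assms(1)])
qed

section \<open>Congruences modulo powers of x - 1\<close>

lemma linear_factor_dvd: "poly p 1 = 0 \<longleftrightarrow> [:-1, 1:] dvd p" for p :: "real poly"
  by (rule poly_eq_0_iff_dvd)

text \<open>Modulo a power of \<open>x - 1\<close>, the \<open>k\<close>-th power of \<open>x\<close> generates all polynomials, because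
  \<open>x\<^sup>k - 1\<close> is \<open>x - 1\<close> times a unit.\<close>

lemma poly_in_power_mod:
  fixes f :: "real poly"
  assumes "k > 0"
  shows "\<exists>q. [:-1, 1:] ^ n dvd f - pcompose q (monom 1 k)"
proof (induction n)
  case (Suc n)
  define y :: "real poly" where "y = monom 1 k"
  obtain q t where t: "f - pcompose q y = [:-1, 1:] ^ n * t"
    using Suc unfolding y_def by (auto elim: dvdE)
  define s :: "real poly" where "s = (\<Sum>i<k. [:0, 1:] ^ i)"
  have y: "y - 1 = [:-1, 1:] * s"
    unfolding s_def y_def using power_diff_1_eq[of "[:0, 1::real:]" k]
    by (simp add: monom_altdef one_pCons)
  have s1: "poly s 1 = real k" by (simp add: s_def poly_sum)
  \<comment> \<open>Adding c (x - 1)^n, evaluated at x^k, to the approximation subtracts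
    \<open>smult c (s ^ n)\<close> from the remainder \<open>t\<close>. As \<open>s\<close> takes
    the value \<open>k\<close> at 1, this \<open>c\<close> makes the new remainder vanish at 1,
    which gains one factor x - 1.\<close>
  define c where "c = poly t 1 / real k ^ n"
  define q' where "q' = q + smult c ([:-1, 1:] ^ n)"
  have "pcompose [:-1, 1:] y = y - 1" by (simp add: pcompose_pCons one_pCons)
  moreover have "pcompose (p ^ n) y = pcompose p y ^ n" for p
    by (induction n) (simp_all add: pcompose_mult pcompose_1)
  ultimately have "pcompose q' y = pcompose q y + smult c ((y - 1) ^ n)"
    by (simp add: q'_def pcompose_add pcompose_smult)
  then have "f - pcompose q' y = [:-1, 1:] ^ n * t - smult c (([:-1, 1:] * s) ^ n)"
    using t y by (metis diff_diff_eq)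
  also have "\<dots> = [:-1, 1:] ^ n * (t - smult c (s ^ n))"
    unfolding power_mult_distrib by (simp add: right_diff_distrib)
  finally have eq: "f - pcompose q' y = [:-1, 1:] ^ n * (t - smult c (s ^ n))" .
  have "poly (t - smult c (s ^ n)) 1 = 0" using assms by (simp add: c_def s1)
  then have "[:-1, 1:] dvd t - smult c (s ^ n)" by (simp only: linear_factor_dvd)
  then have "[:-1, 1:] ^ Suc n dvd f - pcompose q' y"
    unfolding eq power_Suc2 by (intro mult_dvd_mono) auto
  then show ?case unfolding y_def by blast
qed simp

text \<open>Hensel lifting: if \<open>v\<close> inverts \<open>s\<close> modulo (x - 1)^n with
  remainder \<open>t\<close>, adding c (x - 1)^n to \<open>v\<close> turns the remainder into t - c
  s, and \<open>c\<close> is chosen so that this vanishes at 1.\<close>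

lemma poly_inverse_mod:
  fixes s :: "real poly"
  assumes "poly s 1 \<noteq> 0"
  shows "\<exists>v. [:-1, 1:] ^ n dvd 1 - v * s"
proof (induction n)
  case (Suc n)
  then obtain v t where t: "1 - v * s = [:-1, 1:] ^ n * t" by (auto elim: dvdE)
  define c where "c = poly t 1 / poly s 1"
  have "1 - (v + smult c ([:-1, 1:] ^ n)) * s = (1 - v * s) - [:-1, 1:] ^ n * smult c s"
    by (simp add: algebra_simps)
  also have "\<dots> = [:-1, 1:] ^ n * (t - smult c s)" by (simp only: t right_diff_distrib)
  finally have eq: "1 - (v + smult c ([:-1, 1:] ^ n)) * s = [:-1, 1:] ^ n * (t - smult c s)" .
  have "poly (t - smult c s) 1 = 0" using assms by (simp add: c_def)
  then have "[:-1, 1:] dvd t - smult c s" by (simp only: linear_factor_dvd)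
  then have "[:-1, 1:] ^ Suc n dvd 1 - (v + smult c ([:-1, 1:] ^ n)) * s"
    unfolding eq power_Suc2 by (intro mult_dvd_mono) auto
  then show ?case by blast
qed simp

text \<open>The point is that \<open>C\<close> does not depend on \<open>A\<close>: a unipotent operator is a polynomial in its
  \<open>k\<close>-th power, so it is bounded in terms of the latter.\<close>

lemma unipotent_root_bound:
  fixes K :: real
  assumes "k > 0" "K \<ge> 0"
  obtains v C where "C > 0"
    "\<forall>(A::'v::real_normed_vector \<Rightarrow> 'v) E x j. linear A \<longrightarrow> (\<forall>x\<in>E. A x \<in> E) \<longrightarrow>
       (\<forall>x\<in>E. norm ((A ^^ k) x) \<le> K * norm x) \<longrightarrow> x \<in> E \<longrightarrow>
       ((\<lambda>x. A x - x) ^^ n) x = 0 \<longrightarrow> j < k \<longrightarrow>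
       norm ((A ^^ j) (poly_op v A x)) \<le> C * norm x"
    "\<forall>(A::'v \<Rightarrow> 'v) x. linear A \<longrightarrow> ((\<lambda>x. A x - x) ^^ n) x = 0 \<longrightarrow>
       (\<Sum>j<k. (A ^^ j) (poly_op v A x)) = x"
proof -
  \<comment> \<open>\<open>s\<close> is 1 + x + ... + x^(k-1), the polynomial behind the sum in the
    last conclusion. Its value \<open>k\<close> at 1 is nonzero, so it has an inverse
    \<open>v\<close> modulo (x - 1)^n.\<close>
  define s :: "real poly" where "s = (\<Sum>j<k. monom 1 j)"
  have "poly s 1 = real k" by (simp add: s_def poly_sum poly_monom)
  then obtain v where v: "[:-1, 1:] ^ n dvd 1 - v * s"
    using poly_inverse_mod[of s n] assms by auto
  \<comment> \<open>Each x^j v is rewritten as a polynomial in x^k whose coefficients do not depend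
    on \<open>A\<close>. The bound \<open>K\<close> on \<open>A ^^ k\<close> then controls it
    without any bound on \<open>A\<close> itself.\<close>
  have "\<forall>j. \<exists>q. [:-1, 1:] ^ n dvd monom 1 j * v - pcompose q (monom 1 k)"
    using poly_in_power_mod[OF assms(1)] by blast
  then obtain q where q: "\<And>j. [:-1, 1:] ^ n dvd monom 1 j * v - pcompose (q j) (monom 1 k)"
    by metis
  define c where "c j = (\<Sum>i\<le>degree (q j). \<bar>coeff (q j) i\<bar> * K ^ i)" for j
  have c0: "c j \<ge> 0" for j using assms by (auto simp: c_def intro!: sum_nonneg)
  define C where "C = (\<Sum>j<k. c j) + 1"
  show thesis
  proof (rule that; (intro allI impI)?)
    show "C > 0" using c0 by (simp add: C_def sum_nonneg add_nonneg_pos)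
  next
    fix A :: "'v \<Rightarrow> 'v" and E x j
    assume A: "linear A" "\<forall>x\<in>E. A x \<in> E"
      "\<forall>x\<in>E. norm ((A ^^ k) x) \<le> K * norm x" "x \<in> E"
      "((\<lambda>x. A x - x) ^^ n) x = 0" "j < k"
    have "(A ^^ j) (poly_op v A x) = poly_op (monom 1 j * v) A x"
      by (simp add: poly_op_mult[OF A(1)] poly_op_monom)
    also have "\<dots> = poly_op (pcompose (q j) (monom 1 k)) A x"
      using poly_op_eq_0_of_dvd[OF A(1) q A(5), of j] by (simp add: poly_op_diff)
    also have "\<dots> = poly_op (q j) (A ^^ k) x" by (rule poly_op_pcompose_monom[OF A(1)])
    finally have "norm ((A ^^ j) (poly_op v A x)) \<le> c j * norm x"
      unfolding c_def
      using norm_poly_op_le[of E "A ^^ k" K x "q j"] funpow_closed[of E A] A(2-4) assms(2)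
      by simp
    also have "c j \<le> C"
      unfolding C_def using member_le_sum[of j "{..<k}" c] c0 A(6) by auto
    finally show "norm ((A ^^ j) (poly_op v A x)) \<le> C * norm x"
      by (simp add: mult_right_mono)
  next
    fix A :: "'v \<Rightarrow> 'v" and x
    assume A: "linear A" "((\<lambda>x. A x - x) ^^ n) x = 0"
    have "x = poly_op (s * v) A x"
      using poly_op_eq_0_of_dvd[OF A(1) v A(2)] by (simp add: poly_op_diff mult.commute)
    then show "(\<Sum>j<k. (A ^^ j) (poly_op v A x)) = x"
      by (simp add: poly_op_mult[OF A(1)] s_def poly_op_sum poly_op_monom)
  qed
qed

section \<open>Nilspaces and their behaviour under perturbation\<close>

lemma subspace_kernel_on:
  assumes "subspace E" "linear L"
  shows "subspace {x \<in> E. L x = 0}"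
  using assms by (auto simp: subspace_def linear_0 linear_add linear_scale)

text \<open>The kernels of the powers of \<open>L\<close> increase, and the chain is constant once a
  single step is not strict. If a vector entered after step \<open>DIM('e)\<close>, all earlier
  steps would be strict and produce a subspace of dimension above \<open>DIM('e)\<close>. A fixed
  exponent is what makes the polynomial constants uniform.\<close>

lemma nilspace_eq_kernel:
  fixes L :: "'e::euclidean_space \<Rightarrow> 'e"
  assumes E: "subspace E" and L: "linear L" and cl: "\<And>x. x \<in> E \<Longrightarrow> L x \<in> E"
  shows "nilspace E L = {x \<in> E. (L ^^ DIM('e)) x = 0}"
proof -
  define Ker where "Ker i = {x \<in> E. (L ^^ i) x = 0}" for i
  have subK: "subspace (Ker i)" for i
    unfolding Ker_def by (rule subspace_kernel_on[OF E linear_funpow[OF L]])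
  have mono1: "Ker i \<subseteq> Ker (Suc i)" for i by (auto simp: Ker_def linear_0[OF L])
  have mono: "Ker i \<subseteq> Ker j" if "i \<le> j" for i j
    by (rule lift_Suc_mono_le[of Ker, OF mono1 that])
  have "x \<in> Ker DIM('e)" if x: "x \<in> Ker n" for x n
  proof (rule ccontr)
    assume no: "x \<notin> Ker DIM('e)"
    have step: "Ker i \<noteq> Ker (Suc i)" if i: "i \<le> DIM('e)" for i
    proof
      assume eq: "Ker i = Ker (Suc i)"
      have "Ker (i + j) \<subseteq> Ker i" for j
      proof (induction j)
        case (Suc j)
        have "z \<in> Ker i" if z: "z \<in> Ker (i + Suc j)" for z
        proof -
          have "(L ^^ j) z \<in> Ker (Suc i)"
            using z funpow_closed[of E L, OF cl, of z j] by (auto simp: Ker_def funpow_add)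
          then have "(L ^^ j) z \<in> Ker i" using eq by simp
          then have "z \<in> Ker (i + j)" using z by (simp add: Ker_def funpow_add)
          then show ?thesis using Suc by blast
        qed
        then show ?case by blast
      qed simp
      moreover have "x \<in> Ker (i + n)" using x mono[of n "i + n"] by auto
      ultimately show False using no mono[OF i] by blast
    qed
    have "i \<le> Suc DIM('e) \<Longrightarrow> i \<le> dim (Ker i)" for i
    proof (induction i)
      case (Suc i)
      then have "Ker i \<subset> Ker (Suc i)" using step[of i] mono1[of i] by auto
      then have "dim (Ker i) < dim (Ker (Suc i))"
        using dim_psubset[of "Ker i" "Ker (Suc i)"] subK by (simp add: span_eq_iff[THEN iffD2])
      then show ?case using Suc by simp
    qed simp
    from this[of "Suc DIM('e)"] show False using dim_subset_UNIV[of "Ker (Suc DIM('e))"] by simp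
  qed
  moreover have "DIM('e) \<ge> 1" using DIM_positive[where 'a='e] by linarith
  ultimately show ?thesis unfolding nilspace_def Ker_def by fastforce
qed

text \<open>Induction with L'^(n+1) - L^(n+1) = (L' - L) L'^n + L (L'^n - L^n). Since
  \<open>e \<le> 1\<close>, the number \<open>K + 1\<close> bounds \<open>L'\<close> on
  \<open>E\<close>.\<close>

lemma funpow_diff_bound:
  fixes L L' :: "'v::real_normed_vector \<Rightarrow> 'v"
  assumes L: "linear L" "\<And>x. x \<in> E \<Longrightarrow> L x \<in> E" "\<And>x. x \<in> E \<Longrightarrow> norm (L x) \<le> K * norm x"
    and L': "\<And>x. x \<in> E \<Longrightarrow> L' x \<in> E" "\<And>x. x \<in> E \<Longrightarrow> norm (L' x - L x) \<le> e * norm x"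
    and E: "subspace E" and K: "0 \<le> K" and e: "0 \<le> e" "e \<le> 1" and x: "x \<in> E"
  shows "norm ((L' ^^ n) x) \<le> (K + 1) ^ n * norm x"
    "norm ((L' ^^ n) x - (L ^^ n) x) \<le> e * (n * (K + 1) ^ n) * norm x"
proof -
  have L'b: "norm (L' y) \<le> (K + 1) * norm y" if "y \<in> E" for y
  proof -
    have "norm (L' y) \<le> norm (L y) + norm (L' y - L y)" by norm
    also have "\<dots> \<le> K * norm y + 1 * norm y"
      using L(3)[OF that] L'(2)[OF that] mult_right_mono[OF e(2) norm_ge_zero[of y]] by linarith
    finally show ?thesis by (simp add: algebra_simps)
  qed
  have in': "(L' ^^ n) x \<in> E" "(L ^^ n) x \<in> E" for n using funpow_closed L'(1) L(2) x by metis+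
  have pow: "norm ((L' ^^ n) x) \<le> (K + 1) ^ n * norm x" for n
  proof (induction n)
    case (Suc n)
    have "norm ((L' ^^ Suc n) x) \<le> (K + 1) * norm ((L' ^^ n) x)"
      using L'b in' by simp
    also have "\<dots> \<le> (K + 1) * ((K + 1) ^ n * norm x)" using Suc K by (intro mult_left_mono) auto
    finally show ?case by (simp add: mult.assoc)
  qed simp
  show "norm ((L' ^^ n) x) \<le> (K + 1) ^ n * norm x" by (rule pow)
  show "norm ((L' ^^ n) x - (L ^^ n) x) \<le> e * (n * (K + 1) ^ n) * norm x"
  proof (induction n)
    case (Suc n)
    let ?q = "(K + 1) ^ n * norm x"
    have q: "?q \<ge> 0" using K by simp
    have "(L' ^^ Suc n) x - (L ^^ Suc n) x =
      (L' ((L' ^^ n) x) - L ((L' ^^ n) x)) + L ((L' ^^ n) x - (L ^^ n) x)"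
      by (simp add: linear_diff[OF L(1)])
    also have "norm \<dots> \<le> e * norm ((L' ^^ n) x) + K * norm ((L' ^^ n) x - (L ^^ n) x)"
      by (intro norm_triangle_mono L' L in' subspace_diff[OF E])
    also have "\<dots> \<le> e * ?q + K * (e * (n * (K + 1) ^ n) * norm x)"
      by (intro add_mono mult_left_mono pow Suc e K)
    also have "\<dots> = e * ?q + e * n * K * ?q" by (simp add: algebra_simps)
    also have "\<dots> \<le> (e * ?q + e * n * K * ?q) + e * K * ?q + e * n * ?q" using q K e by simp
    also have "\<dots> = e * (Suc n * (K + 1) ^ Suc n) * norm x" by (simp add: algebra_simps)
    finally show ?case .
  qed simp
qed

lemma linear_bound_pos:
  fixes L :: "'e::euclidean_space \<Rightarrow> 'f::real_normed_vector"
  assumes "linear L"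
  obtains K where "K > 0" "\<And>x. norm (L x) \<le> K * norm x"
  using linear_conv_bounded_linear assms bounded_linear.pos_bounded
  by (metis mult.commute)

text \<open>\<open>T\<close> is injective on the orthogonal complement \<open>C\<close> of its
  kernel inside \<open>E\<close>, and \<open>C\<close> already has the same image as
  \<open>E\<close>.\<close>

lemma dim_kernel_image_on:
  fixes T :: "'e::euclidean_space \<Rightarrow> 'e"
  assumes E: "subspace E" and T: "linear T"
  shows "dim {x \<in> E. T x = 0} + dim (T ` E) = dim E"
proof -
  define Z where "Z = {x \<in> E. T x = 0}"
  have Z: "subspace Z" unfolding Z_def by (rule subspace_kernel_on[OF E T])
  have ZE: "Z \<subseteq> E" by (auto simp: Z_def)
  define C where "C = {y \<in> E. \<forall>x\<in>Z. orthogonal x y}"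
  have C: "subspace C" using E unfolding C_def subspace_def orthogonal_def
    by (auto simp: inner_add_right)
  have dimC: "dim C + dim Z = dim E" unfolding C_def
    by (rule dim_subspace_orthogonal_to_vectors[OF Z E ZE])
  have inj: "inj_on T C"
  proof (rule inj_onI)
    fix x y assume xy: "x \<in> C" "y \<in> C" "T x = T y"
    have "x - y \<in> C" using xy subspace_diff[OF C] by blast
    moreover have "T (x - y) = 0" using xy by (simp add: linear_diff[OF T])
    ultimately have "x - y \<in> Z" "\<forall>z\<in>Z. orthogonal z (x - y)" by (auto simp: C_def Z_def)
    then show "x = y" by (auto simp: orthogonal_def)
  qed
  have "T ` E = T ` C"
  proof -
    have "T x \<in> T ` C" if x: "x \<in> E" for x
    proof -
      obtain y z where yz: "y \<in> span Z" "\<And>w. w \<in> span Z \<Longrightarrow> orthogonal z w" "x = y + z"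
        using orthogonal_subspace_decomp_exists[of Z x] by blast
      have y: "y \<in> Z" using yz(1) Z by (simp add: span_eq_iff[THEN iffD2])
      then have "z \<in> E" using x yz(3) ZE subspace_diff[OF E, of x y] by auto
      then have "z \<in> C" using yz(2) span_base by (auto simp: C_def orthogonal_commute)
      moreover have "T x = T z" using y yz(3) by (simp add: linear_add[OF T] Z_def)
      ultimately show ?thesis by blast
    qed
    moreover have "C \<subseteq> E" by (auto simp: C_def)
    ultimately show ?thesis by blast
  qed
  moreover have "dim (T ` C) = dim C"
    using inj C by (intro dim_image_eq T) (simp add: span_eq_iff[THEN iffD2])
  ultimately show ?thesis using dimC by (simp add: Z_def)
qed

text \<open>The right inverse comes from \<open>L ^^ N = L \<circ> L ^^ (N - 1)\<close> on the image \<open>m\<close> of \<open>L ^^ N\<close> for the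
  unperturbed operator: \<open>L' ^^ (2 * N)\<close> is injective on \<open>m\<close>, and since the nilspaces of \<open>L\<close> and
  \<open>L'\<close> have equal dimension, it maps \<open>m\<close> onto the image of \<open>L' ^^ N\<close>.\<close>

lemma perturbed_fitting_decomposition:
  fixes L :: "'e::euclidean_space \<Rightarrow> 'e"
  assumes E: "subspace E" and L: "linear L" "\<And>x. x \<in> E \<Longrightarrow> L x \<in> E"
  obtains e C where "e > 0" "C > 0"
    "\<And>L'. linear L' \<Longrightarrow> (\<And>x. x \<in> E \<Longrightarrow> L' x \<in> E) \<Longrightarrow>
       (\<And>x. x \<in> E \<Longrightarrow> norm (L' x - L x) \<le> e * norm x) \<Longrightarrow>
       dim (nilspace E L') = dim (nilspace E L) \<Longrightarrow>
       \<exists>Y. linear Y \<and> (\<forall>z\<in>E. Y z \<in> E \<and> norm (Y z) \<le> C * norm z \<and> z - L' (Y z) \<in> nilspace E L')"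
proof -
  define N where "N = DIM('e)"
  have N: "N > 0" using DIM_positive by (simp add: N_def)
  obtain K where K: "K > 0" "\<And>x. norm (L x) \<le> K * norm x"
    using linear_bound_pos[OF L(1)] by blast
  define m where "m = (L ^^ N) ` E"
  have m: "subspace m" unfolding m_def by (rule linear_subspace_image[OF linear_funpow[OF L(1)] E])
  have mE: "m \<subseteq> E" unfolding m_def using funpow_closed[of E L, OF L(2)] by blast
  have nilL: "nilspace E L = {x \<in> E. (L ^^ N) x = 0}"
    unfolding N_def by (rule nilspace_eq_kernel[OF E L])
  have "\<forall>x\<in>m. (L ^^ (2 * N)) x = 0 \<longrightarrow> x = 0"
  proof safe
    fix x assume x: "x \<in> m" "(L ^^ (2 * N)) x = 0"
    then obtain y where y: "y \<in> E" "x = (L ^^ N) y" by (auto simp: m_def)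
    \<comment> \<open>\<open>x\<close> lies in the image of \<open>L ^^ N\<close>, and the kernel
      chain is stationary from \<open>N\<close> on, so the exponent \<open>3 * N\<close> can be
      lowered to \<open>N\<close>.\<close>
    have "(L ^^ (3 * N)) y = 0"
      using x(2) by (simp add: y(2) flip: funpow_add comp_apply[of "L ^^ (2 * N)"])
    then have "y \<in> nilspace E L" using y N unfolding nilspace_def by fastforce
    then show "x = 0" using y nilL by blast
  qed
  then obtain c where c: "c > 0" "\<And>x. x \<in> m \<Longrightarrow> c * norm x \<le> norm ((L ^^ (2 * N)) x)"
    using injective_imp_isometric[OF closed_subspace[OF m] m, of "L ^^ (2 * N)"]
      linear_funpow[OF L(1)] linear_conv_bounded_linear by metis
  \<comment> \<open>\<open>e * a\<close> bounds the change of the \<open>2 * N\<close>-th power on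
    \<open>E\<close>; \<open>e\<close> is then taken so small that this costs at most half of the
    lower bound \<open>c\<close>.\<close>
  define a where "a = 2 * N * (K + 1) ^ (2 * N)"
  have a: "a > 0" using K N by (simp add: a_def)
  define e where "e = min 1 (c / (2 * a))"
  have e: "0 < e" "e \<le> 1" using c a by (auto simp: e_def)
  define C where "C = (K + 1) ^ (N - 1) * (2 / c) * (K + 1) ^ N"
  show thesis
  proof (rule that[OF e(1)])
    show "C > 0" using K c by (simp add: C_def)
  next
    fix L' :: "'e \<Rightarrow> 'e"
    assume L': "linear L'" "\<And>x. x \<in> E \<Longrightarrow> L' x \<in> E"
       "\<And>x. x \<in> E \<Longrightarrow> norm (L' x - L x) \<le> e * norm x"
      and dims: "dim (nilspace E L') = dim (nilspace E L)"
    have K0: "0 \<le> K" "0 \<le> e" using K e by auto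
    have pow: "norm ((L' ^^ n) x) \<le> (K + 1) ^ n * norm x"
      "norm ((L' ^^ n) x - (L ^^ n) x) \<le> e * (n * (K + 1) ^ n) * norm x" if "x \<in> E" for x n
      using funpow_diff_bound[of L E K L' e x n] L L' K E K0 e that by auto
    have cl: "(L' ^^ n) x \<in> E" if "x \<in> E" for x n using funpow_closed[of E L'] L'(2) that by blast
    have nilL': "nilspace E L' = {x \<in> E. (L' ^^ N) x = 0}"
      unfolding N_def by (rule nilspace_eq_kernel[OF E L'(1,2)])
    have low: "c / 2 * norm x \<le> norm ((L' ^^ (2 * N)) x)" if x: "x \<in> m" for x
    proof -
      have "norm ((L' ^^ (2 * N)) x - (L ^^ (2 * N)) x) \<le> e * a * norm x"
        using pow(2)[of x "2 * N"] x mE by (auto simp: a_def)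
      also have "\<dots> \<le> (c / (2 * a)) * a * norm x"
        using a by (intro mult_right_mono) (auto simp: e_def)
      also have "\<dots> = c / 2 * norm x" using a by simp
      finally have "norm ((L' ^^ (2 * N)) x - (L ^^ (2 * N)) x) \<le> c / 2 * norm x" .
      moreover have "norm ((L ^^ (2 * N)) x) \<le> norm ((L' ^^ (2 * N)) x) + norm ((L' ^^ (2 * N)) x - (L ^^ (2 * N)) x)"
        by norm
      ultimately show ?thesis using c(2)[OF x] by (simp add: field_simps)
    qed
    have inj: "inj_on (L' ^^ (2 * N)) m"
    proof (rule inj_onI)
      fix x y assume xy: "x \<in> m" "y \<in> m" "(L' ^^ (2 * N)) x = (L' ^^ (2 * N)) y"
      then have "(L' ^^ (2 * N)) (x - y) = 0" by (simp add: linear_diff[OF linear_funpow[OF L'(1)]])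
      then show "x = y" using low[of "x - y"] subspace_diff[OF m xy(1,2)] c(1)
        by (simp add: mult_le_0_iff)
    qed
    have "dim ((L' ^^ (2 * N)) ` m) = dim m"
      using inj m by (intro dim_image_eq linear_funpow L') (simp add: span_eq_iff[THEN iffD2])
    \<comment> \<open>Nilspaces of equal dimension mean equal nullities of the two
      \<open>N\<close>-th powers, hence equal ranks.\<close>
    also have "dim m = dim ((L' ^^ N) ` E)"
      using dim_kernel_image_on[OF E linear_funpow[OF L(1)], of N]
        dim_kernel_image_on[OF E linear_funpow[OF L'(1)], of N] dims
      unfolding nilL nilL' m_def by linarith
    finally have dimeq: "dim ((L' ^^ (2 * N)) ` m) = dim ((L' ^^ N) ` E)" .
    have "(L' ^^ (2 * N)) ` m \<subseteq> (L' ^^ N) ` E"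
      using cl mE by (auto simp: mult_2 funpow_add)
    then have onto: "(L' ^^ (2 * N)) ` m = (L' ^^ N) ` E"
      using dimeq m E L' by (intro subspace_dim_equal linear_subspace_image linear_funpow) auto
    obtain G where G: "range G \<subseteq> m" "linear G" "\<And>v. v \<in> m \<Longrightarrow> G ((L' ^^ (2 * N)) v) = v"
      using linear_exists_left_inverse_on[OF linear_funpow[OF L'(1)] m inj] by auto
    \<comment> \<open>Write \<open>(L' ^^ N) z = (L' ^^ (2 * N)) w\<close> with \<open>w\<close> in
      \<open>m\<close>. Then \<open>L' (Y z) = (L' ^^ N) w\<close>, so \<open>L' ^^ N\<close> kills
      \<open>z - L' (Y z)\<close>.\<close>
    define Y where "Y = (\<lambda>z. (L' ^^ (N - 1)) (G ((L' ^^ N) z)))"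
    have "linear Y" unfolding Y_def
      using linear_compose[OF linear_compose[OF linear_funpow[OF L'(1), of N] G(2)] linear_funpow[OF L'(1), of "N - 1"]]
      by (simp add: o_def)
    moreover have "Y z \<in> E \<and> norm (Y z) \<le> C * norm z \<and> z - L' (Y z) \<in> nilspace E L'" if z: "z \<in> E" for z
    proof -
      obtain w where w: "w \<in> m" "(L' ^^ N) z = (L' ^^ (2 * N)) w" using onto z by blast
      then have Gw: "G ((L' ^^ N) z) = w" using G(3) by simp
      have wE: "w \<in> E" using w mE by blast
      have "c / 2 * norm w \<le> (K + 1) ^ N * norm z"
        using low[OF w(1)] pow(1)[OF z, of N] w(2) by simp
      then have "norm w \<le> (2 / c) * ((K + 1) ^ N * norm z)" using c(1) by (simp add: field_simps)
      then have "norm (Y z) \<le> (K + 1) ^ (N - 1) * ((2 / c) * ((K + 1) ^ N * norm z))"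
        unfolding Y_def Gw using pow(1)[OF wE, of "N - 1"] K
        by (meson add_nonneg_nonneg less_imp_le mult_left_mono order_trans zero_le_one zero_le_power)
      moreover have "L' (Y z) = (L' ^^ N) w"
        unfolding Y_def Gw using N by (metis comp_apply funpow_Suc_right funpow_swap1 Suc_diff_1 funpow.simps(2))
      moreover have "(L' ^^ N) (z - (L' ^^ N) w) = 0"
        using w(2) by (simp add: linear_diff[OF linear_funpow[OF L'(1)]] mult_2 funpow_add)
      ultimately show ?thesis
        using cl[OF wE] subspace_diff[OF E z] by (auto simp: nilL' C_def Y_def Gw mult.assoc)
    qed
    ultimately show "\<exists>Y. linear Y \<and> (\<forall>z\<in>E. Y z \<in> E \<and> norm (Y z) \<le> C * norm z \<and> z - L' (Y z) \<in> nilspace E L')"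
      by blast
  qed
qed

section \<open>Lie groups in local coordinates\<close>

text \<open>Both sides are homogeneous, so \<open>x\<close> may be scaled into the ball of radius
  \<open>d\<close>. First-order estimates near 0 thus become global bounds for linear parts.\<close>

lemma linear_bound_of_small:
  fixes L :: "'v::real_normed_vector \<Rightarrow> 'w::real_normed_vector"
  assumes "subspace E" "linear L" "d > 0"
    and small: "\<And>x. x \<in> E \<Longrightarrow> norm x < d \<Longrightarrow> norm (L x) \<le> e * norm x"
    and x: "x \<in> E"
  shows "norm (L x) \<le> e * norm x"
proof (cases "x = 0")
  case False
  define t where "t = d / (2 * norm x)"
  have t: "t > 0" using False assms(3) by (simp add: t_def)
  have "norm (t *\<^sub>R x) < d" using False assms(3) by (simp add: t_def)
  then have "norm (L (t *\<^sub>R x)) \<le> e * norm (t *\<^sub>R x)"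
    by (intro small subspace_scale[OF assms(1)] x)
  then show ?thesis using t by (simp add: linear_scale[OF assms(2)] field_simps)
qed (simp add: linear_0[OF assms(2)])

text \<open>Lets the error \<open>e\<close> of a derivative tend to 0 in bounds that depend
  continuously on \<open>e\<close>.\<close>

lemma le_limit_at_right_0:
  fixes f :: "real \<Rightarrow> real"
  assumes "\<And>e. 0 < e \<Longrightarrow> e < 1 \<Longrightarrow> a \<le> f e" "isCont f 0"
  shows "a \<le> f 0"
proof (rule tendsto_lowerbound)
  show "(f \<longlongrightarrow> f 0) (at_right 0)"
    using assms(2) unfolding isCont_def by (rule tendsto_within_subset) simp
  show "eventually (\<lambda>e. a \<le> f e) (at_right 0)"
    using assms(1) by (intro eventually_at_rightI[of 0 1]) auto
qed simp

text \<open>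
  Here \<open>\<psi>\<close> is the inverse of a chart sending \<open>\<one>\<close> to \<open>0\<close>, \<open>m\<close> and \<open>cj h\<close> are the multiplication and the
  conjugation by \<open>h\<close> in this chart, and \<open>A h\<close> is the coordinate form of \<open>Ad h\<close>. Only \<open>m\<close> satisfies
  a second-order estimate; the estimates on \<open>cj h\<close> are not uniform in \<open>h\<close>.
\<close>

locale local_lie_coords = group G for G :: "('a, 'm) monoid_scheme" (structure) +
  fixes E :: "'e::euclidean_space set" and \<psi> :: "'e \<Rightarrow> 'a" and R r C :: real
    and m :: "'e \<Rightarrow> 'e \<Rightarrow> 'e" and cj :: "'a \<Rightarrow> 'e \<Rightarrow> 'e" and A :: "'a \<Rightarrow> 'e \<Rightarrow> 'e"
  assumes E: "subspace E" and r: "0 < r" "r < R" and C: "0 < C"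
    and psi_closed: "x \<in> E \<Longrightarrow> norm x < R \<Longrightarrow> \<psi> x \<in> carrier G"
    and psi_inj: "x \<in> E \<Longrightarrow> y \<in> E \<Longrightarrow> norm x < R \<Longrightarrow> norm y < R \<Longrightarrow> \<psi> x = \<psi> y \<Longrightarrow> x = y"
    and psi_0: "\<psi> 0 = \<one>"
    and m: "x \<in> E \<Longrightarrow> y \<in> E \<Longrightarrow> norm x \<le> r \<Longrightarrow> norm y \<le> r \<Longrightarrow>
      m x y \<in> E \<and> norm (m x y) < R \<and> \<psi> (m x y) = \<psi> x \<otimes> \<psi> y"
    and m_approx: "x \<in> E \<Longrightarrow> y \<in> E \<Longrightarrow> x' \<in> E \<Longrightarrow> y' \<in> E \<Longrightarrow> norm x \<le> \<rho> \<Longrightarrow> norm y \<le> \<rho> \<Longrightarrow>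
      norm x' \<le> \<rho> \<Longrightarrow> norm y' \<le> \<rho> \<Longrightarrow> \<rho> \<le> r \<Longrightarrow>
      norm (m x' y' - m x y - ((x' - x) + (y' - y))) \<le> C * \<rho> * (norm (x' - x) + norm (y' - y))"
    and cj: "h \<in> carrier G \<Longrightarrow> \<exists>d>0. d \<le> r \<and> continuous_on {x \<in> E. norm x < d} (cj h) \<and>
      (\<forall>x\<in>E. norm x < d \<longrightarrow> cj h x \<in> E \<and> norm (cj h x) < R \<and> \<psi> (cj h x) = h \<otimes> \<psi> x \<otimes> inv h)"
    and cj_deriv: "h \<in> carrier G \<Longrightarrow> e > 0 \<Longrightarrow>
      \<exists>d>0. \<forall>x\<in>E. norm x < d \<longrightarrow> norm (cj h x - A h x) \<le> e * norm x"
    and A_linear: "h \<in> carrier G \<Longrightarrow> linear (A h)"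
    and A_closed: "h \<in> carrier G \<Longrightarrow> x \<in> E \<Longrightarrow> A h x \<in> E"
begin

lemma cj_nbhd:
  assumes h: "h \<in> carrier G" and "e > 0" "e' > 0"
  obtains d where "d > 0" "d \<le> r" "d \<le> e'" "continuous_on {x \<in> E. norm x < d} (cj h)"
    "\<And>x. x \<in> E \<Longrightarrow> norm x < d \<Longrightarrow> cj h x \<in> E"
    "\<And>x. x \<in> E \<Longrightarrow> norm x < d \<Longrightarrow> norm (cj h x) < R"
    "\<And>x. x \<in> E \<Longrightarrow> norm x < d \<Longrightarrow> \<psi> (cj h x) = h \<otimes> \<psi> x \<otimes> inv h"
    "\<And>x. x \<in> E \<Longrightarrow> norm x < d \<Longrightarrow> norm (cj h x - A h x) \<le> e * norm x"
proof -
  obtain d1 where d1: "d1 > 0" "d1 \<le> r" "continuous_on {x \<in> E. norm x < d1} (cj h)"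
    "\<And>x. x \<in> E \<Longrightarrow> norm x < d1 \<Longrightarrow> cj h x \<in> E \<and> norm (cj h x) < R \<and> \<psi> (cj h x) = h \<otimes> \<psi> x \<otimes> inv h"
    using cj[OF h] by blast
  obtain d2 where d2: "d2 > 0" "\<And>x. x \<in> E \<Longrightarrow> norm x < d2 \<Longrightarrow> norm (cj h x - A h x) \<le> e * norm x"
    using cj_deriv[OF h \<open>e > 0\<close>] by blast
  have "continuous_on {x \<in> E. norm x < Min {d1, d2, e'}} (cj h)"
    by (rule continuous_on_subset[OF d1(3)]) auto
  then show thesis
    using d1 d2 assms by (intro that[of "Min {d1, d2, e'}"]) auto
qed

lemma m_0_right: "x \<in> E \<Longrightarrow> norm x \<le> r \<Longrightarrow> m x 0 = x"
  using m[of x 0] psi_closed[of x] r psi_0 subspace_0[OF E] by (intro psi_inj) auto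

lemma m_0_left: "x \<in> E \<Longrightarrow> norm x \<le> r \<Longrightarrow> m 0 x = x"
  using m[of 0 x] psi_closed[of x] r psi_0 subspace_0[OF E] by (intro psi_inj) auto

lemma m_approx_0:
  assumes "x \<in> E" "y \<in> E" "norm x \<le> \<rho>" "norm y \<le> \<rho>" "\<rho> \<le> r"
  shows "norm (m x y - (x + y)) \<le> C * \<rho> * (norm x + norm y)"
proof -
  have "\<rho> \<ge> 0" using assms(3) norm_ge_zero[of x] by linarith
  then show ?thesis
    using m_approx[of 0 0 x y \<rho>] assms subspace_0[OF E] m_0_left[of 0] r by simp
qed

lemma A_bound:
  assumes "h \<in> carrier G"
  obtains K where "K > 0" "\<And>x. norm (A h x) \<le> K * norm x"
  using linear_bound_pos[OF A_linear[OF assms]] by blast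

lemma linear_A_minus_id:
  assumes "h \<in> carrier G" shows "linear (\<lambda>x. A h x - x)"
  by (rule linear_compose_sub[OF A_linear[OF assms] linear_ident])

lemma A_one:
  assumes x: "x \<in> E" shows "A \<one> x = x"
proof -
  have "norm (A \<one> x - x) \<le> e * norm x" if e: "e > 0" for e
  proof -
    obtain d where d: "d > 0" "d \<le> r" "d \<le> 1" "continuous_on {x \<in> E. norm x < d} (cj \<one>)"
      "\<And>x. x \<in> E \<Longrightarrow> norm x < d \<Longrightarrow> cj \<one> x \<in> E"
      "\<And>x. x \<in> E \<Longrightarrow> norm x < d \<Longrightarrow> norm (cj \<one> x) < R"
      "\<And>x. x \<in> E \<Longrightarrow> norm x < d \<Longrightarrow> \<psi> (cj \<one> x) = \<one> \<otimes> \<psi> x \<otimes> inv \<one>"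
      "\<And>x. x \<in> E \<Longrightarrow> norm x < d \<Longrightarrow> norm (cj \<one> x - A \<one> x) \<le> e * norm x"
      using cj_nbhd[OF one_closed e zero_less_one] by blast
    have "norm (A \<one> y - y) \<le> e * norm y" if y: "y \<in> E" "norm y < d" for y
    proof -
      have "cj \<one> y = y" using d(2) d(5-7)[OF y] y r psi_closed[of y] by (intro psi_inj) auto
      then show ?thesis using d(8)[OF y] by (simp add: norm_minus_commute)
    qed
    then show ?thesis
      using linear_bound_of_small[OF E linear_A_minus_id[OF one_closed] d(1) _ x] by blast
  qed
  then have "norm (A \<one> x - x) \<le> 0 * norm x"
    by (intro le_limit_at_right_0[where f = "\<lambda>e. e * norm x"]) auto
  then show ?thesis by simp
qed

text \<open>Chain rule at 0: by injectivity of \<open>\<psi>\<close>,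
  \<open>cj (g \<otimes> h)\<close> is \<open>cj h\<close> followed by \<open>cj g\<close> near 0,
  and each of the three maps equals its linear part up to \<open>e\<close>.\<close>

lemma A_mult:
  assumes g: "g \<in> carrier G" and h: "h \<in> carrier G" and x: "x \<in> E"
  shows "A (g \<otimes> h) x = A g (A h x)"
proof -
  obtain Kg where Kg: "Kg > 0" "\<And>x. norm (A g x) \<le> Kg * norm x" using A_bound[OF g] by blast
  obtain Kh where Kh: "Kh > 0" "\<And>x. norm (A h x) \<le> Kh * norm x" using A_bound[OF h] by blast
  have gh: "g \<otimes> h \<in> carrier G" using g h by blast
  have lin: "linear (\<lambda>x. A (g \<otimes> h) x - A g (A h x))"
    using linear_compose_sub[OF A_linear[OF gh] linear_compose[OF A_linear[OF h] A_linear[OF g]]]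
    by (simp add: o_def)
  have "norm (A (g \<otimes> h) x - A g (A h x)) \<le> (e * (1 + (Kh + e) + Kg)) * norm x" if e: "e > 0" for e
  proof -
    obtain d1 where d1: "d1 > 0" "d1 \<le> r" "d1 \<le> 1" "continuous_on {x \<in> E. norm x < d1} (cj g)"
      "\<And>x. x \<in> E \<Longrightarrow> norm x < d1 \<Longrightarrow> cj g x \<in> E"
      "\<And>x. x \<in> E \<Longrightarrow> norm x < d1 \<Longrightarrow> norm (cj g x) < R"
      "\<And>x. x \<in> E \<Longrightarrow> norm x < d1 \<Longrightarrow> \<psi> (cj g x) = g \<otimes> \<psi> x \<otimes> inv g"
      "\<And>x. x \<in> E \<Longrightarrow> norm x < d1 \<Longrightarrow> norm (cj g x - A g x) \<le> e * norm x"
      using cj_nbhd[OF g e zero_less_one] by blast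
    obtain d2 where d2: "d2 > 0" "d2 \<le> r" "d2 \<le> 1" "continuous_on {x \<in> E. norm x < d2} (cj h)"
      "\<And>x. x \<in> E \<Longrightarrow> norm x < d2 \<Longrightarrow> cj h x \<in> E"
      "\<And>x. x \<in> E \<Longrightarrow> norm x < d2 \<Longrightarrow> norm (cj h x) < R"
      "\<And>x. x \<in> E \<Longrightarrow> norm x < d2 \<Longrightarrow> \<psi> (cj h x) = h \<otimes> \<psi> x \<otimes> inv h"
      "\<And>x. x \<in> E \<Longrightarrow> norm x < d2 \<Longrightarrow> norm (cj h x - A h x) \<le> e * norm x"
      using cj_nbhd[OF h e zero_less_one] by blast
    obtain d3 where d3: "d3 > 0" "d3 \<le> r" "d3 \<le> 1" "continuous_on {x \<in> E. norm x < d3} (cj (g \<otimes> h))"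
      "\<And>x. x \<in> E \<Longrightarrow> norm x < d3 \<Longrightarrow> cj (g \<otimes> h) x \<in> E"
      "\<And>x. x \<in> E \<Longrightarrow> norm x < d3 \<Longrightarrow> norm (cj (g \<otimes> h) x) < R"
      "\<And>x. x \<in> E \<Longrightarrow> norm x < d3 \<Longrightarrow> \<psi> (cj (g \<otimes> h) x) = (g \<otimes> h) \<otimes> \<psi> x \<otimes> inv (g \<otimes> h)"
      "\<And>x. x \<in> E \<Longrightarrow> norm x < d3 \<Longrightarrow> norm (cj (g \<otimes> h) x - A (g \<otimes> h) x) \<le> e * norm x"
      using cj_nbhd[OF gh e zero_less_one] by blast
    \<comment> \<open>The last entry puts \<open>cj h y\<close>, whose norm is at most
      \<open>(Kh + e) * norm y\<close>, into the domain of \<open>cj g\<close>.\<close>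
    define d where "d = Min {d1, d2, d3, d1 / (Kh + e)}"
    have d: "d > 0" "d \<le> d2" "d \<le> d3" "d \<le> d1 / (Kh + e)"
      using d1(1) d2(1) d3(1) Kh(1) e by (auto simp: d_def)
    have "norm (A (g \<otimes> h) y - A g (A h y)) \<le> (e * (1 + (Kh + e) + Kg)) * norm y"
      if y: "y \<in> E" "norm y < d" for y
    proof -
      let ?z = "cj h y"
      have y2: "norm y < d2" "norm y < d3" "norm y < R" using y d d2(2) r by linarith+
      have z: "?z \<in> E" "norm ?z < R" "\<psi> ?z = h \<otimes> \<psi> y \<otimes> inv h" "norm (?z - A h y) \<le> e * norm y"
        using d2(5-8)[OF y(1) y2(1)] by auto
      have "norm ?z \<le> norm (A h y) + norm (?z - A h y)" by norm
      then have zb: "norm ?z \<le> (Kh + e) * norm y" using z(4) Kh(2)[of y] by (simp add: algebra_simps)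
      also have "\<dots> < (Kh + e) * (d1 / (Kh + e))" using y d Kh(1) e by (intro mult_strict_left_mono) auto
      finally have zd: "norm ?z < d1" using Kh(1) e by simp
      have eq: "cj (g \<otimes> h) y = cj g ?z"
        using d3(5-7)[OF y(1) y2(2)] d1(5-7)[OF z(1) zd] z(3) g h psi_closed[OF y(1) y2(3)]
        by (intro psi_inj) (auto simp: m_assoc inv_mult_group)
      have "A (g \<otimes> h) y - A g (A h y) = (A (g \<otimes> h) y - cj (g \<otimes> h) y) + ((cj g ?z - A g ?z)
         + A g (?z - A h y))"
        by (simp add: eq linear_diff[OF A_linear[OF g]])
      also have "norm \<dots> \<le> e * norm y + (e * ((Kh + e) * norm y) + Kg * (e * norm y))"
      proof (intro norm_triangle_mono)
        show "norm (A (g \<otimes> h) y - cj (g \<otimes> h) y) \<le> e * norm y"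
          using d3(8)[OF y(1) y2(2)] by (simp add: norm_minus_commute)
        show "norm (cj g ?z - A g ?z) \<le> e * ((Kh + e) * norm y)"
          using d1(8)[OF z(1) zd] zb e by (meson mult_left_mono less_imp_le order_trans)
        show "norm (A g (?z - A h y)) \<le> Kg * (e * norm y)"
          using Kg z(4) by (meson mult_left_mono less_imp_le order_trans)
      qed
      finally show ?thesis by (simp add: algebra_simps)
    qed
    then show ?thesis
      using linear_bound_of_small[OF E lin d(1) _ x] by blast
  qed
  then have "norm (A (g \<otimes> h) x - A g (A h x)) \<le> (0 * (1 + (Kh + 0) + Kg)) * norm x"
    by (intro le_limit_at_right_0[where f = "\<lambda>e. (e * (1 + (Kh + e) + Kg)) * norm x"]) auto
  then show ?thesis by simp
qed

lemma A_pow: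
  assumes h: "h \<in> carrier G" and x: "x \<in> E"
  shows "A (h [^] (n::nat)) x = (A h ^^ n) x"
  using x
proof (induction n arbitrary: x)
  case (Suc n)
  then show ?case using h A_closed[OF h]
    by (simp add: A_mult funpow_swap1)
qed (simp add: A_one)

text \<open>The domain of \<open>cj (\<psi> w)\<close> depends on \<open>w\<close>, so the bound is
  drawn from the multiplication. If \<open>c\<close> is the conjugate of \<open>y\<close> by
  \<open>w\<close>, then \<open>m w y = m c w\<close>; the two sides are \<open>w + y\<close> and
  \<open>w + c\<close> up to a relative error \<open>q = C * \<rho>\<close>, so \<open>c\<close> is
  close to \<open>y\<close>. The estimate passes to the linear part.\<close>

lemma A_near_one:
  assumes w: "w \<in> E" "norm w < \<rho>" and \<rho>: "\<rho> \<le> r" "C * \<rho> \<le> 1 / 2" and x: "x \<in> E"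
  shows "norm (A (\<psi> w) x - x) \<le> 4 * C * \<rho> * norm x"
proof -
  have \<rho>0: "\<rho> > 0" using w by (meson norm_ge_zero le_less_trans)
  have wG: "\<psi> w \<in> carrier G" using w \<rho> r by (intro psi_closed) auto
  obtain K where K: "K > 0" "\<And>x. norm (A (\<psi> w) x) \<le> K * norm x" using A_bound[OF wG] by blast
  define q where "q = C * \<rho>"
  have q: "q > 0" "q \<le> 1 / 2" using C \<rho> \<rho>0 by (auto simp: q_def)
  have "norm (A (\<psi> w) x - x) \<le> (4 * q + 4 * e) * norm x" if e: "0 < e" "e < 1" for e
  proof -
    have Kpos: "\<rho> / (K + 1) > 0" using \<rho>0 K(1) by simp
    obtain d where d: "d > 0" "d \<le> r" "d \<le> \<rho> / (K + 1)" "continuous_on {x \<in> E. norm x < d} (cj (\<psi> w))"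
      "\<And>x. x \<in> E \<Longrightarrow> norm x < d \<Longrightarrow> cj (\<psi> w) x \<in> E"
      "\<And>x. x \<in> E \<Longrightarrow> norm x < d \<Longrightarrow> norm (cj (\<psi> w) x) < R"
      "\<And>x. x \<in> E \<Longrightarrow> norm x < d \<Longrightarrow> \<psi> (cj (\<psi> w) x) = (\<psi> w) \<otimes> \<psi> x \<otimes> inv (\<psi> w)"
      "\<And>x. x \<in> E \<Longrightarrow> norm x < d \<Longrightarrow> norm (cj (\<psi> w) x - A (\<psi> w) x) \<le> e * norm x"
      using cj_nbhd[OF wG e(1) Kpos] by blast
    have "norm (A (\<psi> w) y - y) \<le> (4 * q + 4 * e) * norm y" if y: "y \<in> E" "norm y < d" for y
    proof -
      let ?c = "cj (\<psi> w) y"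
      let ?a = "A (\<psi> w) y"
      have c: "?c \<in> E" "norm ?c < R" "\<psi> ?c = \<psi> w \<otimes> \<psi> y \<otimes> inv (\<psi> w)" "norm (?c - ?a) \<le> e * norm y"
        using d(5-8)[OF y] by auto
      have "norm ?c \<le> norm ?a + norm (?c - ?a)" by norm
      also have "\<dots> \<le> K * norm y + 1 * norm y"
        using K(2)[of y] c(4) mult_right_mono[of e 1 "norm y"] e by simp
      also have "\<dots> = (K + 1) * norm y" by (simp add: algebra_simps)
      also have "\<dots> \<le> (K + 1) * (\<rho> / (K + 1))" using y d K by (intro mult_left_mono) auto
      finally have cr: "norm ?c \<le> \<rho>" using K by simp
      have "\<rho> / (K + 1) \<le> \<rho> / 1" using K \<rho>0 by (intro divide_left_mono) auto
      then have yr: "norm y \<le> \<rho>" using y d by simp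
      have yG: "\<psi> y \<in> carrier G" using y yr \<rho> r by (intro psi_closed) auto
      note mm = m[of w y] m[of ?c w]
      have "m w y = m ?c w"
        using mm w y c cr yr \<rho> wG yG by (intro psi_inj) (auto simp: m_assoc)
      moreover have "norm (m w y - w - y) \<le> q * norm y"
        using m_approx[of w 0 w y \<rho>] m_0_right[of w] w y yr \<rho> \<rho>0 subspace_0[OF E]
        by (simp add: q_def)
      moreover have "norm (m ?c w - w - ?c) \<le> q * norm ?c"
        using m_approx[of 0 w ?c w \<rho>] m_0_left[of w] w c cr \<rho> \<rho>0 subspace_0[OF E]
        by (simp add: q_def)
      moreover have "norm (?c - y) \<le> norm (m w y - w - y) + norm (m ?c w - w - ?c)"
        if "m w y = m ?c w" unfolding that by norm
      ultimately have *: "norm (?c - y) \<le> q * norm y + q * norm ?c" by linarith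
      have "norm ?c \<le> norm y + norm (?c - y)" by norm
      then have "q * norm ?c \<le> q * (norm y + norm (?c - y))" using q by (intro mult_left_mono) auto
      then have "norm (?c - y) \<le> 2 * q * norm y + q * norm (?c - y)"
        using * by (simp add: algebra_simps)
      moreover have "q * norm (?c - y) \<le> 1 / 2 * norm (?c - y)" using q by (intro mult_right_mono) auto
      ultimately have "norm (?c - y) \<le> 4 * q * norm y" by linarith
      moreover have "norm (?a - y) \<le> norm (?c - ?a) + norm (?c - y)" by norm
      moreover have "e * norm y \<le> 4 * e * norm y" using e by (intro mult_right_mono) auto
      ultimately show ?thesis using c(4) by (simp add: algebra_simps)
    qed
    then show ?thesis
      using linear_bound_of_small[OF E linear_A_minus_id[OF wG] d(1) _ x] by blast
  qed
  then have "norm (A (\<psi> w) x - x) \<le> (4 * q + 4 * 0) * norm x"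
    by (intro le_limit_at_right_0[where f = "\<lambda>e. (4 * q + 4 * e) * norm x"]) auto
  then show ?thesis by (simp add: q_def)
qed

end

section \<open>The exponential map\<close>

context local_lie_coords begin

definition dbl :: "'e \<Rightarrow> 'e" where "dbl x = m x x"

text \<open>\<open>r / 2\<close> leaves room for the factor 2 by which iterated doubling may exceed
  its linear size; \<open>1 / (4 * C)\<close> keeps the exponent in \<open>dbl_iterate_aux\<close>
  at most 1/2, where exp is at most 2.\<close>

definition lexp_radius :: real where "lexp_radius = min (r / 2) (1 / (4 * C))"

text \<open>
  The exponential map is obtained without differential equations, as the linearization of the
  doubling map: \<open>dbl (lexp X) = lexp (2 X)\<close>. Repeated halving turns naturality of \<open>lexp\<close> under a
  conjugation near \<open>0\<close> into naturality on a ball that does not depend on the conjugating element.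
\<close>

definition lexp :: "'e \<Rightarrow> 'e" where "lexp X = lim (\<lambda>n. (dbl ^^ n) (X /\<^sub>R 2 ^ n))"

lemma lexp_radius: "0 < lexp_radius" "2 * lexp_radius \<le> r" "2 * C * lexp_radius \<le> 1 / 2"
proof -
  show "0 < lexp_radius" "2 * lexp_radius \<le> r" using r C by (auto simp: lexp_radius_def)
  have "lexp_radius \<le> 1 / (4 * C)" by (simp add: lexp_radius_def)
  then show "2 * C * lexp_radius \<le> 1 / 2" using C by (simp add: field_simps)
qed

lemma dbl_0: "(dbl ^^ i) 0 = 0"
  using m_0_left[of 0] subspace_0[OF E] r by (induction i) (auto simp: dbl_def)

lemma dbl_closed: "x \<in> E \<Longrightarrow> norm x \<le> r \<Longrightarrow> dbl x \<in> E \<and> norm (dbl x) < R \<and> \<psi> (dbl x) = \<psi> x [^] (2::nat)"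
  using m[of x x] psi_closed[of x] r by (simp add: dbl_def numeral_2_eq_2)

lemma dbl_lipschitz:
  assumes "x \<in> E" "y \<in> E" "norm x \<le> \<rho>" "norm y \<le> \<rho>" "\<rho> \<le> r"
  shows "norm (dbl x - dbl y) \<le> 2 * (1 + C * \<rho>) * norm (x - y)"
proof -
  have "norm (dbl x - dbl y - ((x - y) + (x - y))) \<le> C * \<rho> * (norm (x - y) + norm (x - y))"
    using m_approx[of y y x x \<rho>] assms by (simp add: dbl_def)
  moreover have "norm (dbl x - dbl y) \<le> norm (dbl x - dbl y - ((x - y) + (x - y))) + norm ((x - y) + (x - y))"
    by norm
  moreover have "norm ((x - y) + (x - y)) = 2 * norm (x - y)" by (simp flip: scaleR_2)
  ultimately show ?thesis by (simp add: algebra_simps)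
qed

text \<open>The next doubling has Lipschitz constant \<open>2 * (1 + t)\<close>, where
  \<open>t\<close> is the exponent reached so far and doubles with each step. Since 1 + t is at most
  exp t, the new exponent is t + t, which is again of the claimed form; so the distortion stays
  bounded uniformly in \<open>n\<close>.\<close>

lemma dbl_iterate_aux:
  assumes "i \<le> n" "x \<in> E" "y \<in> E" "norm x \<le> lexp_radius / 2 ^ n" "norm y \<le> lexp_radius / 2 ^ n"
  shows "(dbl ^^ i) x \<in> E \<and>
    norm ((dbl ^^ i) x - (dbl ^^ i) y) \<le> 2 ^ i * exp (2 * C * lexp_radius * 2 ^ i / 2 ^ n) * norm (x - y)"
  using assms
proof (induction i arbitrary: x y)
  case (Suc i)
  define t where "t = 2 * C * lexp_radius * 2 ^ i / 2 ^ n"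
  define \<rho> where "\<rho> = 2 * lexp_radius * (2 ^ i / 2 ^ n)"
  have Ct: "C * \<rho> = t" by (simp add: \<rho>_def t_def)
  have i2: "(2::real) ^ i / 2 ^ n \<le> 1" using Suc.prems(1) by simp
  have "t = 2 * C * lexp_radius * (2 ^ i / 2 ^ n)" by (simp add: t_def)
  also have "\<dots> \<le> 2 * C * lexp_radius * 1" using i2 C lexp_radius(1) by (intro mult_left_mono) auto
  finally have "t \<le> 1 / 2" using lexp_radius(3) by linarith
  then have "exp t \<le> exp (1 / 2)" by (simp only: exp_le_cancel_iff)
  then have t2: "exp t \<le> 2" using exp_half_le2 by linarith
  have t0: "t \<ge> 0" using C lexp_radius by (simp add: t_def)
  have "\<rho> \<le> 2 * lexp_radius * 1" unfolding \<rho>_def using i2 lexp_radius(1) by (intro mult_left_mono) auto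
  then have \<rho>r: "\<rho> \<le> r" using lexp_radius(2) by simp
  have IH: "(dbl ^^ i) x \<in> E \<and> norm ((dbl ^^ i) x - (dbl ^^ i) y) \<le> 2 ^ i * exp t * norm (x - y)"
    if "x \<in> E" "y \<in> E" "norm x \<le> lexp_radius / 2 ^ n" "norm y \<le> lexp_radius / 2 ^ n" for x y
    using Suc.IH[of x y] that Suc.prems(1) by (simp add: t_def)
  have bd: "(dbl ^^ i) x \<in> E \<and> norm ((dbl ^^ i) x) \<le> \<rho>" if x: "x \<in> E" "norm x \<le> lexp_radius / 2 ^ n" for x
  proof -
    have "norm ((dbl ^^ i) x) \<le> 2 ^ i * exp t * norm x"
      using IH[of x 0] x subspace_0[OF E] lexp_radius(1) by (simp add: dbl_0)
    also have "\<dots> \<le> 2 ^ i * 2 * (lexp_radius / 2 ^ n)" using t2 x by (intro mult_mono) auto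
    finally show ?thesis using IH[of x 0] x subspace_0[OF E] lexp_radius(1) by (simp add: \<rho>_def mult_ac)
  qed
  have "norm ((dbl ^^ Suc i) x - (dbl ^^ Suc i) y) \<le> 2 * (1 + C * \<rho>) * norm ((dbl ^^ i) x - (dbl ^^ i) y)"
    using dbl_lipschitz[of "(dbl ^^ i) x" "(dbl ^^ i) y" \<rho>] bd Suc.prems \<rho>r by simp
  also have "\<dots> \<le> 2 * (1 + t) * (2 ^ i * exp t * norm (x - y))"
    unfolding Ct using IH Suc.prems t0 by (intro mult_left_mono) auto
  also have "\<dots> \<le> 2 * exp t * (2 ^ i * exp t * norm (x - y))"
    using exp_ge_add_one_self[of t] by (intro mult_right_mono mult_left_mono) auto
  also have "\<dots> = 2 ^ Suc i * exp (t + t) * norm (x - y)" by (simp only: exp_add power_Suc mult_ac)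
  also have "t + t = 2 * C * lexp_radius * 2 ^ Suc i / 2 ^ n" by (simp add: t_def)
  finally show ?case
    using dbl_closed[of "(dbl ^^ i) x"] bd[of x] Suc.prems \<rho>r by simp
next
  case 0
  have "1 * norm (x - y) \<le> exp (2 * C * lexp_radius * 2 ^ 0 / 2 ^ n) * norm (x - y)"
    using C lexp_radius(1) by (intro mult_right_mono) auto
  then show ?case using 0 by simp
qed

lemma dbl_iterate:
  assumes "i \<le> n" "x \<in> E" "norm x \<le> lexp_radius / 2 ^ n"
  shows "(dbl ^^ i) x \<in> E" "norm ((dbl ^^ i) x) \<le> 2 * 2 ^ i * norm x"
    "norm ((dbl ^^ i) x) \<le> r" "\<psi> ((dbl ^^ i) x) = \<psi> x [^] (2 ^ i :: nat)"
    "\<And>y. y \<in> E \<Longrightarrow> norm y \<le> lexp_radius / 2 ^ n \<Longrightarrow>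
      norm ((dbl ^^ i) x - (dbl ^^ i) y) \<le> 2 * 2 ^ i * norm (x - y)"
proof -
  have ex2: "exp (2 * C * lexp_radius * 2 ^ i / 2 ^ n) \<le> 2" if "i \<le> n" for i
  proof -
    have i2: "(2::real) ^ i / 2 ^ n \<le> 1" using that by simp
    have "2 * C * lexp_radius * 2 ^ i / 2 ^ n = 2 * C * lexp_radius * (2 ^ i / 2 ^ n)" by simp
    also have "\<dots> \<le> 2 * C * lexp_radius * 1" using i2 C lexp_radius(1) by (intro mult_left_mono) auto
    finally have "2 * C * lexp_radius * 2 ^ i / 2 ^ n \<le> 1 / 2" using lexp_radius(3) by linarith
    then have "exp (2 * C * lexp_radius * 2 ^ i / 2 ^ n) \<le> exp (1 / 2)" by (simp only: exp_le_cancel_iff)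
    then show ?thesis using exp_half_le2 by linarith
  qed
  have lip: "norm ((dbl ^^ i) x - (dbl ^^ i) y) \<le> 2 * 2 ^ i * norm (x - y)"
    if "i \<le> n" "y \<in> E" "norm y \<le> lexp_radius / 2 ^ n" for y i
  proof -
    have "norm ((dbl ^^ i) x - (dbl ^^ i) y) \<le> 2 ^ i * exp (2 * C * lexp_radius * 2 ^ i / 2 ^ n) * norm (x - y)"
      using dbl_iterate_aux[of i n x y] assms that by simp
    also have "\<dots> \<le> 2 ^ i * 2 * norm (x - y)"
      using ex2 that by (intro mult_right_mono mult_left_mono) auto
    finally show ?thesis by (simp add: mult_ac)
  qed
  show "norm ((dbl ^^ i) x - (dbl ^^ i) y) \<le> 2 * 2 ^ i * norm (x - y)"
    if "y \<in> E" "norm y \<le> lexp_radius / 2 ^ n" for y using lip assms that by blast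
  have inE: "(dbl ^^ i) x \<in> E" if "i \<le> n" for i
    using dbl_iterate_aux[of i n x x] assms that by simp
  then show "(dbl ^^ i) x \<in> E" using assms by simp
  have bd: "norm ((dbl ^^ i) x) \<le> 2 * 2 ^ i * norm x" if "i \<le> n" for i
    using lip[of i 0] that subspace_0[OF E] lexp_radius(1) by (simp add: dbl_0)
  then show "norm ((dbl ^^ i) x) \<le> 2 * 2 ^ i * norm x" using assms by simp
  have rb: "norm ((dbl ^^ i) x) \<le> r" if i: "i \<le> n" for i
  proof -
    have "norm ((dbl ^^ i) x) \<le> 2 * 2 ^ i * (lexp_radius / 2 ^ n)"
      using bd[OF i] mult_left_mono[OF assms(3), of "2 * 2 ^ i"] by simp
    also have "\<dots> = (2 * lexp_radius) * (2 ^ i / 2 ^ n)" by simp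
    also have "\<dots> \<le> (2 * lexp_radius) * 1" using i lexp_radius(1) by (intro mult_left_mono) auto
    finally show ?thesis using lexp_radius(2) by simp
  qed
  then show "norm ((dbl ^^ i) x) \<le> r" using assms by simp
  have "lexp_radius / 2 ^ n \<le> lexp_radius / 1" using lexp_radius(1) by (intro divide_left_mono) auto
  then have xG: "\<psi> x \<in> carrier G" using assms lexp_radius r by (intro psi_closed) auto
  have "i \<le> n \<Longrightarrow> \<psi> ((dbl ^^ i) x) = \<psi> x [^] (2 ^ i :: nat)" for i
  proof (induction i)
    case (Suc i)
    then show ?case
      using dbl_closed[OF inE[of i] rb[of i]] xG by (simp add: nat_pow_pow mult.commute)
  qed (use xG in simp)
  then show "\<psi> ((dbl ^^ i) x) = \<psi> x [^] (2 ^ i :: nat)" using assms by blast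
qed

lemma norm_scaled_le: "norm X \<le> a \<Longrightarrow> norm (X /\<^sub>R 2 ^ n) \<le> a / 2 ^ n"
  by (simp add: divide_inverse mult_right_mono mult.commute)

text \<open>For x = X / 2^(n+1), \<open>dbl x\<close> differs from 2 x by at most 2 C |x|^2, which
  is of order 4^-n. The remaining \<open>n\<close> doublings magnify this by at most 2 2^n, which
  leaves a summable increment.\<close>

lemma lexp_increment:
  assumes X: "X \<in> E" "norm X \<le> lexp_radius / 2"
  shows "norm ((dbl ^^ Suc n) (X /\<^sub>R 2 ^ Suc n) - (dbl ^^ n) (X /\<^sub>R 2 ^ n)) \<le> C * (norm X)\<^sup>2 / 2 ^ n"
proof -
  let ?x = "X /\<^sub>R 2 ^ Suc n"
  have sc: "norm (X /\<^sub>R 2 ^ k) = norm X / 2 ^ k" for k by (simp add: divide_inverse mult.commute)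
  have x: "?x \<in> E" "norm ?x \<le> (lexp_radius / 2) / 2 ^ Suc n" by (intro subspace_scale[OF E] X norm_scaled_le)+
  have "(lexp_radius / 2) / 2 ^ Suc n \<le> lexp_radius / 2 ^ Suc n" by (rule divide_right_mono) (use lexp_radius(1) in auto)
  then have xs: "norm ?x \<le> lexp_radius / 2 ^ Suc n" using x(2) by linarith
  have d: "dbl ?x \<in> E" "norm (dbl ?x) \<le> 2 * 2 * norm ?x"
    using dbl_iterate(1,2)[of 1 "Suc n" ?x] x xs by simp_all
  have d2: "norm (dbl ?x) \<le> lexp_radius / 2 ^ n" using d(2) X(2) unfolding sc by (simp add: field_simps)
  have y: "X /\<^sub>R 2 ^ n \<in> E" "norm (X /\<^sub>R 2 ^ n) \<le> lexp_radius / 2 ^ n"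
    using X lexp_radius(1) unfolding sc by (auto intro!: subspace_scale[OF E] divide_right_mono)
  have "lexp_radius / 2 ^ Suc n \<le> lexp_radius / 1"
    by (rule divide_left_mono) (use lexp_radius(1) one_le_power[of "2::real" "Suc n"] in \<open>simp_all del: power_Suc\<close>)
  then have "norm (dbl ?x - (?x + ?x)) \<le> C * norm ?x * (norm ?x + norm ?x)"
    unfolding dbl_def using x(1) xs lexp_radius by (intro m_approx_0) auto
  also have "?x + ?x = X /\<^sub>R 2 ^ n" by (simp flip: scaleR_2)
  finally have "norm (dbl ?x - X /\<^sub>R 2 ^ n) \<le> 2 * C * (norm ?x)\<^sup>2"
    by (simp only: power2_eq_square mult_2 distrib_left distrib_right mult.assoc)
  then have "2 * 2 ^ n * norm (dbl ?x - X /\<^sub>R 2 ^ n) \<le> 2 * 2 ^ n * (2 * C * (norm ?x)\<^sup>2)"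
    by (intro mult_left_mono) auto
  also have "\<dots> = C * (norm X)\<^sup>2 / 2 ^ n"
    unfolding sc by (simp add: power2_eq_square field_simps)
  finally have "2 * 2 ^ n * norm (dbl ?x - X /\<^sub>R 2 ^ n) \<le> C * (norm X)\<^sup>2 / 2 ^ n" .
  moreover have "norm ((dbl ^^ n) (dbl ?x) - (dbl ^^ n) (X /\<^sub>R 2 ^ n)) \<le> 2 * 2 ^ n * norm (dbl ?x - X /\<^sub>R 2 ^ n)"
    by (rule dbl_iterate(5)[OF order_refl d(1) d2 y])
  ultimately show ?thesis by (simp add: funpow_swap1)
qed

text \<open>The increments are dominated by a geometric series; its sum is the quadratic distance of
  \<open>lexp\<close> from the identity.\<close>

lemma lexp_limit:
  assumes X: "X \<in> E" "norm X \<le> lexp_radius / 2"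
  shows "(\<lambda>n. (dbl ^^ n) (X /\<^sub>R 2 ^ n)) \<longlonglongrightarrow> lexp X"
    and "norm (lexp X - X) \<le> 2 * C * (norm X)\<^sup>2"
    and "lexp X \<in> E"
proof -
  let ?a = "\<lambda>n. (dbl ^^ n) (X /\<^sub>R 2 ^ n)"
  let ?M = "C * (norm X)\<^sup>2"
  have geo: "(\<lambda>n. ?M / 2 ^ n) sums (?M * 2)"
  proof -
    have "(\<lambda>n. ?M * (1 / 2) ^ n) sums (?M * 2)"
      using sums_mult[OF geometric_sums[of "1/2::real"], of ?M] by simp
    then show ?thesis by (simp add: power_one_over)
  qed
  have summ: "summable (\<lambda>n. ?a (Suc n) - ?a n)"
    by (rule summable_comparison_test'[OF sums_summable[OF geo]]) (rule lexp_increment[OF X])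
  have tel: "(\<Sum>i<n. ?a (Suc i) - ?a i) = ?a n - X" for n
    by (subst sum_lessThan_telescope) simp
  have lim: "(\<lambda>n. ?a n - X) \<longlonglongrightarrow> (\<Sum>n. ?a (Suc n) - ?a n)"
    using summable_LIMSEQ[OF summ] unfolding tel .
  then have "convergent ?a"
    using tendsto_add[OF lim tendsto_const[of X]] by (auto simp: convergent_def)
  then show L: "?a \<longlonglongrightarrow> lexp X" by (simp add: lexp_def convergent_LIMSEQ_iff)
  have "norm (?a n - X) \<le> ?M * 2" for n
  proof -
    have "norm (?a n - X) \<le> (\<Sum>i<n. ?M / 2 ^ i)"
      unfolding tel[symmetric] by (rule sum_norm_le) (rule lexp_increment[OF X])
    also have "\<dots> \<le> ?M * 2"
      unfolding sums_unique[OF geo] using C by (intro sum_le_suminf sums_summable[OF geo]) auto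
    finally show ?thesis .
  qed
  then show "norm (lexp X - X) \<le> 2 * C * (norm X)\<^sup>2"
    by (intro LIMSEQ_le_const2[OF tendsto_norm[OF tendsto_diff[OF L tendsto_const]]]) (auto simp: mult_ac)
  have "?a n \<in> E" for n
  proof (rule dbl_iterate(1)[OF order_refl])
    show "X /\<^sub>R 2 ^ n \<in> E" using X by (intro subspace_scale[OF E])
    show "norm (X /\<^sub>R 2 ^ n) \<le> lexp_radius / 2 ^ n" using X lexp_radius(1) by (intro norm_scaled_le) auto
  qed
  then show "lexp X \<in> E"
    using closed_sequentially[OF closed_subspace[OF E] _ L] by blast
qed

lemma lexp_lipschitz:
  assumes X: "X \<in> E" "norm X \<le> lexp_radius / 2" and Y: "Y \<in> E" "norm Y \<le> lexp_radius / 2"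
  shows "norm (lexp X - lexp Y) \<le> 2 * norm (X - Y)"
proof (rule LIMSEQ_le_const2[OF tendsto_norm[OF tendsto_diff[OF lexp_limit(1)[OF X] lexp_limit(1)[OF Y]]]])
  have "norm ((dbl ^^ n) (X /\<^sub>R 2 ^ n) - (dbl ^^ n) (Y /\<^sub>R 2 ^ n)) \<le> 2 * norm (X - Y)" for n
  proof -
    have "norm ((dbl ^^ n) (X /\<^sub>R 2 ^ n) - (dbl ^^ n) (Y /\<^sub>R 2 ^ n))
      \<le> 2 * 2 ^ n * norm (X /\<^sub>R 2 ^ n - Y /\<^sub>R 2 ^ n)"
      using X Y lexp_radius(1) by (intro dbl_iterate(5)[OF order_refl] subspace_scale[OF E] norm_scaled_le) auto
    also have "X /\<^sub>R 2 ^ n - Y /\<^sub>R 2 ^ n = (X - Y) /\<^sub>R 2 ^ n" by (simp add: scaleR_diff_right)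
    also have "2 * 2 ^ n * norm ((X - Y) /\<^sub>R 2 ^ n) = 2 * norm (X - Y)" by simp
    finally show ?thesis .
  qed
  then show "\<exists>N. \<forall>n\<ge>N. norm ((dbl ^^ n) (X /\<^sub>R 2 ^ n) - (dbl ^^ n) (Y /\<^sub>R 2 ^ n)) \<le> 2 * norm (X - Y)"
    by blast
qed

lemma continuous_on_lexp: "continuous_on {X \<in> E. norm X \<le> lexp_radius / 2} lexp"
proof (rule continuous_onI)
  fix X and e :: real assume "X \<in> {X \<in> E. norm X \<le> lexp_radius / 2}" "0 < e"
  then show "\<exists>d>0. \<forall>x'\<in>{X \<in> E. norm X \<le> lexp_radius / 2}. dist x' X < d \<longrightarrow> dist (lexp x') (lexp X) \<le> e"
    by (intro exI[of _ "e / 2"]) (auto simp: dist_norm intro: order_trans[OF lexp_lipschitz])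
qed

lemma lexp_0: "lexp 0 = 0"
  using lexp_limit(2)[of 0] subspace_0[OF E] lexp_radius(1) by simp

lemma norm_lexp:
  assumes X: "X \<in> E" "norm X \<le> lexp_radius / 2"
  shows "norm (lexp X) \<le> 2 * norm X"
  using lexp_lipschitz[OF X subspace_0[OF E]] lexp_radius(1) by (simp add: lexp_0)

lemma lexp_double:
  assumes X: "X \<in> E" "norm X \<le> lexp_radius / 4"
  shows "lexp (2 *\<^sub>R X) = dbl (lexp X)"
proof -
  have X2: "norm X \<le> lexp_radius / 2" using X lexp_radius(1) by simp
  let ?a = "\<lambda>n. (dbl ^^ n) (X /\<^sub>R 2 ^ n)"
  have "(\<lambda>n. (dbl ^^ Suc n) ((2 *\<^sub>R X) /\<^sub>R 2 ^ Suc n)) \<longlonglongrightarrow> lexp (2 *\<^sub>R X)"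
    using X by (intro LIMSEQ_Suc lexp_limit subspace_scale[OF E]) auto
  then have L: "(\<lambda>n. dbl (?a n)) \<longlonglongrightarrow> lexp (2 *\<^sub>R X)"
  proof -
    have "(2 *\<^sub>R X) /\<^sub>R 2 ^ Suc n = X /\<^sub>R 2 ^ n" for n by simp
    with \<open>_ \<longlonglongrightarrow> lexp (2 *\<^sub>R X)\<close> show ?thesis by (simp only: funpow.simps comp_apply)
  qed
  have aE: "?a n \<in> E" "norm (?a n) \<le> r" for n
    using X X2 lexp_radius(1) dbl_iterate(1,3)[OF order_refl, of "X /\<^sub>R 2 ^ n" n]
      subspace_scale[OF E X(1)] norm_scaled_le[of X lexp_radius n] by auto
  have lE: "lexp X \<in> E" "norm (lexp X) \<le> r" using lexp_limit(3)[OF X(1) X2] norm_lexp[OF X(1) X2] X2 lexp_radius by auto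
  have "(\<lambda>n. dbl (?a n) - dbl (lexp X)) \<longlonglongrightarrow> 0"
  proof (rule Lim_null_comparison)
    show "eventually (\<lambda>n. norm (dbl (?a n) - dbl (lexp X)) \<le> 2 * (1 + C * r) * norm (?a n - lexp X)) sequentially"
      using aE lE by (intro always_eventually allI dbl_lipschitz) auto
    show "(\<lambda>n. 2 * (1 + C * r) * norm (?a n - lexp X)) \<longlonglongrightarrow> 0"
      using tendsto_mult_right_zero[OF tendsto_norm_zero[OF LIM_zero[OF lexp_limit(1)[OF X(1) X2]]]] by simp
  qed
  then have "(\<lambda>n. dbl (?a n)) \<longlonglongrightarrow> dbl (lexp X)" by (rule LIM_zero_cancel)
  then show ?thesis using L LIMSEQ_unique by blast
qed

lemma psi_lexp_closed: "X \<in> E \<Longrightarrow> norm X \<le> lexp_radius / 2 \<Longrightarrow> \<psi> (lexp X) \<in> carrier G"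
  using norm_lexp lexp_limit(3) lexp_radius r by (intro psi_closed) force+

text \<open>Iterates \<open>lexp_double\<close>. It transports identities from arbitrarily small
  neighbourhoods of 0 to the whole ball, by taking 2^n-th powers in the group.\<close>

lemma psi_lexp_halve:
  assumes X: "X \<in> E" "norm X \<le> lexp_radius / 2"
  shows "\<psi> (lexp X) = \<psi> (lexp (X /\<^sub>R 2 ^ n)) [^] (2 ^ n :: nat)"
proof (induction n)
  case 0
  then show ?case using psi_lexp_closed[OF X] by simp
next
  case (Suc n)
  let ?x = "X /\<^sub>R 2 ^ Suc n"
  have sc: "norm (X /\<^sub>R 2 ^ k) = norm X / 2 ^ k" for k by (simp add: divide_inverse mult.commute)
  have "norm X / 2 ^ Suc n \<le> (lexp_radius / 2) / 2" using X lexp_radius(1) by (intro frac_le) auto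
  then have "norm ?x \<le> lexp_radius / 4" by (simp only: sc)
  moreover have "?x \<in> E" using X by (intro subspace_scale[OF E])
  ultimately have x: "?x \<in> E" "norm ?x \<le> lexp_radius / 4" by blast+
  have x2: "norm ?x \<le> lexp_radius / 2" using x(2) lexp_radius(1) by linarith
  have "X /\<^sub>R 2 ^ n = 2 *\<^sub>R ?x" by simp
  then have "lexp (X /\<^sub>R 2 ^ n) = dbl (lexp ?x)" using lexp_double[OF x] by simp
  then have "\<psi> (lexp (X /\<^sub>R 2 ^ n)) = \<psi> (lexp ?x) [^] (2::nat)"
    using dbl_closed[of "lexp ?x"] lexp_limit(3)[OF x(1) x2] order_trans[OF norm_lexp[OF x(1) x2], of r] x2 lexp_radius by force
  then show ?case using Suc psi_lexp_closed[OF x(1) x2] by (simp add: nat_pow_pow)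
qed

lemma conj_pow:
  assumes "h \<in> carrier G" "x \<in> carrier G"
  shows "h \<otimes> x [^] (n::nat) \<otimes> inv h = (h \<otimes> x \<otimes> inv h) [^] n"
proof (induction n)
  case (Suc n)
  have "(h \<otimes> x \<otimes> inv h) [^] Suc n = (h \<otimes> x [^] n \<otimes> inv h) \<otimes> (h \<otimes> x \<otimes> inv h)" by (simp add: Suc)
  also have "\<dots> = h \<otimes> x [^] n \<otimes> (inv h \<otimes> h) \<otimes> x \<otimes> inv h" using assms by (simp only: m_assoc inv_closed m_closed nat_pow_closed)
  finally show ?case using assms by (simp add: m_assoc)
qed (use assms in simp)

text \<open>Conjugation commutes with squaring, so \<open>cj h\<close> of the n-th approximant of
  \<open>lexp X\<close> is the n-fold doubling of \<open>cj h (X / 2^n)\<close>. Replacing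
  \<open>cj h (X / 2^n)\<close> by its linear part \<open>A h X / 2^n\<close> costs o(2^-n), and the
  doublings multiply this by at most 2 2^n. In the limit
  \<open>cj h (lexp X) = lexp (A h X)\<close>.\<close>

lemma lexp_natural_local:
  assumes h: "h \<in> carrier G"
  obtains d where "d > 0"
    "\<And>X. X \<in> E \<Longrightarrow> norm X < d \<Longrightarrow> \<psi> (lexp (A h X)) = h \<otimes> \<psi> (lexp X) \<otimes> inv h"
proof -
  obtain K where K: "K > 0" "\<And>x. norm (A h x) \<le> K * norm x" using A_bound[OF h] by blast
  obtain d0 where d0: "d0 > 0" "d0 \<le> r" "d0 \<le> 1" "continuous_on {x \<in> E. norm x < d0} (cj h)"
    "\<And>x. x \<in> E \<Longrightarrow> norm x < d0 \<Longrightarrow> cj h x \<in> E"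
    "\<And>x. x \<in> E \<Longrightarrow> norm x < d0 \<Longrightarrow> norm (cj h x) < R"
    "\<And>x. x \<in> E \<Longrightarrow> norm x < d0 \<Longrightarrow> \<psi> (cj h x) = h \<otimes> \<psi> x \<otimes> inv h"
    "\<And>x. x \<in> E \<Longrightarrow> norm x < d0 \<Longrightarrow> norm (cj h x - A h x) \<le> 1 * norm x"
    using cj_nbhd[OF h zero_less_one zero_less_one] by blast
  \<comment> \<open>\<open>d0 / 2\<close> keeps the approximants, of norm up to
    \<open>2 * norm X\<close>, in the domain of \<open>cj h\<close>; the other entry keeps
    \<open>A h X\<close> and all \<open>cj h (X / 2^n)\<close> where repeated doubling is
    controlled.\<close>
  define d where "d = min (d0 / 2) (lexp_radius / 2 / (K + 1))"
  have d: "d > 0" "2 * d \<le> d0" "(K + 1) * d \<le> lexp_radius / 2"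
  proof -
    show "d > 0" "2 * d \<le> d0" using d0(1) K(1) lexp_radius(1) by (auto simp: d_def)
    have "(K + 1) * d \<le> (K + 1) * (lexp_radius / 2 / (K + 1))" using K(1) by (intro mult_left_mono) (auto simp: d_def)
    also have "\<dots> = lexp_radius / 2" using K(1) by (simp add: divide_simps)
    finally show "(K + 1) * d \<le> lexp_radius / 2" .
  qed
  have "1 * d \<le> (K + 1) * d" using K d(1) by (intro mult_right_mono) auto
  then have drex: "d \<le> lexp_radius / 2" using d(3) by simp
  show thesis
  proof (rule that[OF d(1)])
    fix X assume X: "X \<in> E" "norm X < d"
    let ?x = "\<lambda>n. X /\<^sub>R 2 ^ n"
    let ?a = "\<lambda>n. (dbl ^^ n) (?x n)"
    have Xr: "norm X \<le> lexp_radius / 2" using X drex by simp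
    have sc: "norm (?x k) = norm X / 2 ^ k" for k by (simp add: divide_inverse mult.commute)
    have xE: "?x n \<in> E" for n using X by (intro subspace_scale[OF E])
    have xs: "norm (?x n) \<le> lexp_radius / 2 ^ n" for n using Xr lexp_radius(1) by (intro norm_scaled_le) simp
    have xd: "norm (?x n) < d0" for n
    proof -
      have "norm (?x n) \<le> norm X / 1" unfolding sc by (intro divide_left_mono) auto
      then show ?thesis using X d by simp
    qed
    have AXE: "A h X \<in> E" using A_closed[OF h X(1)] .
    have "norm (A h X) \<le> (K + 1) * norm X" using K(2)[of X] by (simp add: algebra_simps) (meson add_increasing norm_ge_zero)
    also have "\<dots> \<le> (K + 1) * d" using X K by (intro mult_left_mono) auto
    finally have AXr: "norm (A h X) \<le> lexp_radius / 2" using d(3) by simp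
    have Ax: "A h (?x n) = A h X /\<^sub>R 2 ^ n" for n by (simp add: linear_scale[OF A_linear[OF h]])
    have cs: "norm (cj h (?x n)) \<le> lexp_radius / 2 ^ n" for n
    proof -
      have "norm (cj h (?x n)) \<le> norm (A h (?x n)) + norm (cj h (?x n) - A h (?x n))" by norm
      also have "\<dots> \<le> K * norm (?x n) + 1 * norm (?x n)" using K(2) d0(8)[OF xE xd] by (intro add_mono)
      also have "\<dots> = (K + 1) * norm X / 2 ^ n" by (simp only: sc) (simp add: algebra_simps add_divide_distrib)
      also have "\<dots> \<le> lexp_radius / 2 ^ n"
      proof (rule divide_right_mono)
        have "(K + 1) * norm X \<le> (K + 1) * d" using X K(1) by (intro mult_left_mono) auto
        then show "(K + 1) * norm X \<le> lexp_radius" using d(3) lexp_radius(1) by linarith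
      qed simp
      finally show ?thesis .
    qed
    have cE: "cj h (?x n) \<in> E" for n using d0(5)[OF xE xd] .
    have aE: "?a n \<in> E" for n by (rule dbl_iterate(1)[OF order_refl xE xs])
    have ad: "norm (?a n) < d0" for n
    proof -
      have "norm (?a n) \<le> 2 * 2 ^ n * norm (?x n)" by (rule dbl_iterate(2)[OF order_refl xE xs])
      also have "\<dots> = 2 * norm X" by (simp add: sc)
      finally show ?thesis using X d by simp
    qed
    have xG: "\<psi> (?x n) \<in> carrier G" for n
      by (rule psi_closed[OF xE]) (use xd[of n] d0(2) r in linarith)
    have eq: "cj h (?a n) = (dbl ^^ n) (cj h (?x n))" for n
    proof (rule psi_inj)
      have "\<psi> (cj h (?a n)) = h \<otimes> \<psi> (?x n) [^] (2 ^ n :: nat) \<otimes> inv h"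
        using d0(7)[OF aE ad] dbl_iterate(4)[OF order_refl xE xs] by simp
      also have "\<dots> = \<psi> (cj h (?x n)) [^] (2 ^ n :: nat)"
        using d0(7)[OF xE xd] conj_pow[OF h xG] by simp
      also have "\<dots> = \<psi> ((dbl ^^ n) (cj h (?x n)))"
        using dbl_iterate(4)[OF order_refl cE cs] by simp
      finally show "\<psi> (cj h (?a n)) = \<psi> ((dbl ^^ n) (cj h (?x n)))" .
      show "(dbl ^^ n) (cj h (?x n)) \<in> E" by (rule dbl_iterate(1)[OF order_refl cE cs])
      have "norm ((dbl ^^ n) (cj h (?x n))) \<le> r" by (rule dbl_iterate(3)[OF order_refl cE cs])
      then show "norm ((dbl ^^ n) (cj h (?x n))) < R" using r by simp
    qed (use d0(5,6)[OF aE ad] in auto)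
    have Ls: "lexp X \<in> E" "norm (lexp X) < d0"
      using lexp_limit(3)[OF X(1) Xr] norm_lexp[OF X(1) Xr] X d by auto
    have L1: "(\<lambda>n. cj h (?a n)) \<longlonglongrightarrow> cj h (lexp X)"
      by (rule continuous_on_tendsto_compose[OF d0(4) lexp_limit(1)[OF X(1) Xr]]) (use Ls aE ad in auto)
    have "(\<lambda>n. (dbl ^^ n) (cj h (?x n)) - (dbl ^^ n) (A h X /\<^sub>R 2 ^ n)) \<longlonglongrightarrow> 0"
    proof (rule LIMSEQ_I)
      fix e :: real assume e: "e > 0"
      define e' where "e' = e / (2 * d)"
      have e': "e' > 0" using e d by (simp add: e'_def)
      obtain d1 where d1: "d1 > 0" "\<And>x. x \<in> E \<Longrightarrow> norm x < d1 \<Longrightarrow> norm (cj h x - A h x) \<le> e' * norm x"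
        using cj_deriv[OF h e'] by blast
      have "?x \<longlonglongrightarrow> 0"
        using tendsto_scaleR[OF LIMSEQ_inverse_realpow_zero[of 2] tendsto_const[of X]] by simp
      then obtain N where N: "\<And>n. n \<ge> N \<Longrightarrow> norm (?x n) < d1"
        using LIMSEQ_D[of ?x 0] d1(1) by (metis diff_zero)
      have "norm ((dbl ^^ n) (cj h (?x n)) - (dbl ^^ n) (A h X /\<^sub>R 2 ^ n)) < e" if "n \<ge> N" for n
      proof -
        have "norm ((dbl ^^ n) (cj h (?x n)) - (dbl ^^ n) (A h X /\<^sub>R 2 ^ n))
           \<le> 2 * 2 ^ n * norm (cj h (?x n) - A h X /\<^sub>R 2 ^ n)"
          using AXr AXE lexp_radius(1)
          by (intro dbl_iterate(5)[OF order_refl cE cs] subspace_scale[OF E] norm_scaled_le) auto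
        also have "\<dots> \<le> 2 * 2 ^ n * (e' * norm (?x n))"
          using d1(2)[OF xE N[OF that]] by (intro mult_left_mono) (auto simp: Ax)
        also have "\<dots> = 2 * e' * norm X" by (simp add: sc)
        also have "\<dots> < 2 * e' * d" using X e' by (intro mult_strict_left_mono) auto
        also have "\<dots> = e" using d by (simp add: e'_def)
        finally show ?thesis .
      qed
      then show "\<exists>N. \<forall>n\<ge>N. norm ((dbl ^^ n) (cj h (?x n)) - (dbl ^^ n) (A h X /\<^sub>R 2 ^ n) - 0) < e" by auto
    qed
    from tendsto_add[OF this lexp_limit(1)[OF AXE AXr]]
    have "(\<lambda>n. cj h (?a n)) \<longlonglongrightarrow> lexp (A h X)" by (simp add: eq)
    then have "cj h (lexp X) = lexp (A h X)" using L1 LIMSEQ_unique by blast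
    then show "\<psi> (lexp (A h X)) = h \<otimes> \<psi> (lexp X) \<otimes> inv h" using d0(7)[OF Ls] by simp
  qed
qed

text \<open>The local identity holds at \<open>X / 2^n\<close> for large \<open>n\<close>, and its
  2^n-th power is the identity at \<open>X\<close>. The neighbourhood of
  \<open>lexp_natural_local\<close>, whose size depends on \<open>h\<close>, thereby
  disappears.\<close>

lemma lexp_natural:
  assumes h: "h \<in> carrier G" and X: "X \<in> E" "norm X \<le> lexp_radius / 2" "norm (A h X) \<le> lexp_radius / 2"
  shows "\<psi> (lexp (A h X)) = h \<otimes> \<psi> (lexp X) \<otimes> inv h"
proof -
  obtain d where d: "d > 0" "\<And>X. X \<in> E \<Longrightarrow> norm X < d \<Longrightarrow> \<psi> (lexp (A h X)) = h \<otimes> \<psi> (lexp X) \<otimes> inv h"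
    using lexp_natural_local[OF h] by blast
  have "(\<lambda>n. X /\<^sub>R 2 ^ n) \<longlonglongrightarrow> 0"
    using tendsto_scaleR[OF LIMSEQ_inverse_realpow_zero[of 2] tendsto_const[of X]] by simp
  then obtain n where n: "norm (X /\<^sub>R 2 ^ n) < d"
    using LIMSEQ_D[of "\<lambda>n. X /\<^sub>R 2 ^ n" 0] d(1) by (metis diff_zero order_refl)
  let ?x = "X /\<^sub>R 2 ^ n"
  have x: "?x \<in> E" using X by (intro subspace_scale[OF E])
  have "norm ?x \<le> (lexp_radius / 2) / 2 ^ n" by (rule norm_scaled_le[OF X(2)])
  also have "\<dots> \<le> (lexp_radius / 2) / 1" using lexp_radius(1) by (intro divide_left_mono) auto
  finally have xr: "norm ?x \<le> lexp_radius / 2" by simp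
  have "\<psi> (lexp (A h X)) = \<psi> (lexp (A h ?x)) [^] (2 ^ n :: nat)"
    using psi_lexp_halve[OF A_closed[OF h X(1)] X(3), of n] by (simp add: linear_scale[OF A_linear[OF h]])
  also have "\<dots> = h \<otimes> \<psi> (lexp ?x) [^] (2 ^ n :: nat) \<otimes> inv h"
    using conj_pow[OF h psi_lexp_closed[OF x xr]] d(2)[OF x n] by simp
  also have "\<dots> = h \<otimes> \<psi> (lexp X) \<otimes> inv h" using psi_lexp_halve[OF X(1,2), of n] by simp
  finally show ?thesis .
qed

end

section \<open>Roots of nearby regular elements\<close>

lemma nilspace_cong:
  assumes "\<And>x. x \<in> E \<Longrightarrow> L x = L' x" "\<And>x. x \<in> E \<Longrightarrow> L x \<in> E"
  shows "nilspace E L = nilspace E L'"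
proof -
  have "(L ^^ n) x = (L' ^^ n) x" if "x \<in> E" for n x
  proof (induction n)
    case (Suc n)
    then show ?case using assms(1)[OF funpow_closed[of E L, OF assms(2) that], of n] by simp
  qed simp
  then show ?thesis unfolding nilspace_def by auto
qed

text \<open>x - 1 divides x^k - 1, hence (x - 1)^n divides (x^k - 1)^n.\<close>

lemma nilspace_id_minus_subset_pow:
  fixes B :: "'v::real_vector \<Rightarrow> 'v"
  assumes B: "linear B"
  shows "nilspace E (\<lambda>x. B x - x) \<subseteq> nilspace E (\<lambda>x. (B ^^ k) x - x)"
proof -
  have pw: "pcompose (p ^ n) q = pcompose p q ^ n" for p q :: "real poly" and n
    by (induction n) (simp_all add: pcompose_mult pcompose_1)
  have "poly (monom 1 k - 1) (1::real) = 0" by (simp add: poly_monom)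
  then have dvd: "[:-1, 1:] dvd monom 1 k - (1 :: real poly)" by (simp only: linear_factor_dvd)
  have "((\<lambda>x. (B ^^ k) x - x) ^^ n) x = 0" if "((\<lambda>x. B x - x) ^^ n) x = 0" for n x
  proof -
    have "((\<lambda>x. (B ^^ k) x - x) ^^ n) x = poly_op (pcompose ([:-1, 1:] ^ n) (monom 1 k)) B x"
      by (simp only: poly_op_pcompose_monom[OF B] poly_op_power_1[OF linear_funpow[OF B]])
    also have "pcompose ([:-1, 1:] ^ n) (monom 1 k) = (monom 1 k - (1 :: real poly)) ^ n"
    proof -
      have "pcompose [:-1, 1:] (monom 1 k) = [:-1:] + monom (1::real) k" by (simp add: pcompose_pCons)
      also have "\<dots> = monom 1 k - 1" by (simp add: poly_eq_iff coeff_pCons split: nat.split)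
      finally show ?thesis by (simp only: pw)
    qed
    also have "poly_op ((monom 1 k - 1) ^ n) B x = 0"
      by (rule poly_op_eq_0_of_dvd[OF B dvd_power_same[OF dvd] that])
    finally show ?thesis .
  qed
  then show ?thesis unfolding nilspace_def by auto
qed

lemma poly_op_closed:
  assumes "subspace E" "\<And>x. x \<in> E \<Longrightarrow> B x \<in> E" "x \<in> E"
  shows "poly_op p B x \<in> E"
  unfolding poly_op_def using assms funpow_closed[of E B]
  by (intro subspace_sum subspace_scale) auto

section \<open>Products of several factors in coordinates\<close>

context local_lie_coords begin

primrec lprod :: "(nat \<Rightarrow> 'e) \<Rightarrow> nat \<Rightarrow> 'e" where
  "lprod e 0 = 0"
| "lprod e (Suc n) = m (lprod e n) (e n)"

text \<open>One more factor adds an error \<open>C * \<rho> * \<rho>\<close> with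
  \<open>\<rho> = (K + 1) * t\<close>, quadratic in \<open>t\<close>; \<open>K'\<close> collects it.
  In the new threshold, 1 gives \<open>t\<^sup>2 \<le> t\<close> and \<open>r / K'\<close> keeps the
  partial products in the domain of \<open>m\<close>.\<close>

lemma lprod_bound:
  "\<exists>K>0. \<exists>s>0. \<forall>t e. 0 \<le> t \<longrightarrow> t \<le> s \<longrightarrow> (\<forall>i<n. e i \<in> E \<and> norm (e i) \<le> t) \<longrightarrow>
     (\<forall>j\<le>n. lprod e j \<in> E \<and> norm (lprod e j) \<le> r \<and> norm (lprod e j) \<le> K * t \<and>
       norm (lprod e j - (\<Sum>i<j. e i)) \<le> K * t\<^sup>2)"
proof (induction n)
  case 0
  show ?case using subspace_0[OF E] r by (intro exI[of _ 1]) auto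
next
  case (Suc n)
  then obtain K s where K: "K > 0" and s: "s > 0" and IH0: "\<forall>t e. 0 \<le> t \<longrightarrow> t \<le> s \<longrightarrow>
     (\<forall>i<n. e i \<in> E \<and> norm (e i) \<le> t) \<longrightarrow>
     (\<forall>j\<le>n. lprod e j \<in> E \<and> norm (lprod e j) \<le> r \<and> norm (lprod e j) \<le> K * t \<and>
       norm (lprod e j - (\<Sum>i<j. e i)) \<le> K * t\<^sup>2)"
    by (elim exE conjE) (rule that)
  have IH: "lprod e j \<in> E \<and> norm (lprod e j) \<le> r \<and> norm (lprod e j) \<le> K * t \<and>
       norm (lprod e j - (\<Sum>i<j. e i)) \<le> K * t\<^sup>2"
    if "0 \<le> t" "t \<le> s" "\<And>i. i < n \<Longrightarrow> e i \<in> E \<and> norm (e i) \<le> t" "j \<le> n" for t e j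
    using IH0[rule_format, OF that(1,2), of e j] that(3,4) by blast
  define K' where "K' = K + 1 + C * (K + 1)\<^sup>2"
  have K': "K' > 0" "K \<le> K'" "K + 1 \<le> K'" using K C by (auto simp: K'_def intro!: add_pos_pos)
  define s' where "s' = Min {s, 1, r / K'}"
  have s': "s' > 0" "s' \<le> s" "s' \<le> 1" "K' * s' \<le> r"
  proof -
    show "s' > 0" "s' \<le> s" "s' \<le> 1" using s K' r by (auto simp: s'_def)
    have "K' * s' \<le> K' * (r / K')" using K' by (intro mult_left_mono) (auto simp: s'_def)
    then show "K' * s' \<le> r" using K' by simp
  qed
  show ?case
  proof (rule exI[of _ K'], intro conjI exI[of _ s'] allI impI K'(1) s'(1))
    fix t :: real and e j
    assume t: "0 \<le> t" "t \<le> s'" and e: "\<forall>i<Suc n. e i \<in> E \<and> norm (e i) \<le> t" and j: "j \<le> Suc n"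
    have old: "lprod e i \<in> E \<and> norm (lprod e i) \<le> r \<and> norm (lprod e i) \<le> K * t \<and>
       norm (lprod e i - (\<Sum>i<i. e i)) \<le> K * t\<^sup>2" if "i \<le> n" for i
      using IH[of t e i] t e s' that by auto
    let ?P = "\<lambda>j. lprod e j \<in> E \<and> norm (lprod e j) \<le> r \<and> norm (lprod e j) \<le> K' * t \<and>
      norm (lprod e j - (\<Sum>i<j. e i)) \<le> K' * t\<^sup>2"
    have "?P j"
    proof (cases "j \<le> n")
      case True
      have "K * t \<le> K' * t" "K * t\<^sup>2 \<le> K' * t\<^sup>2" using K' t by (auto intro!: mult_right_mono)
      then show ?thesis using old[OF True] by fastforce
    next
      case False
      then have jn: "j = Suc n" using j by simp
      let ?x = "lprod e n" and ?y = "e n"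
      have x: "?x \<in> E" "norm ?x \<le> r" "norm ?x \<le> K * t" "norm (?x - (\<Sum>i<n. e i)) \<le> K * t\<^sup>2"
        using old by auto
      have y: "?y \<in> E" "norm ?y \<le> t" using e by auto
      define \<rho> where "\<rho> = (K + 1) * t"
      have \<rho>: "0 \<le> \<rho>" "K * t \<le> \<rho>" "t \<le> \<rho>" using K t by (auto simp: \<rho>_def algebra_simps)
      have "\<rho> \<le> K' * s'" unfolding \<rho>_def using K' K t by (intro mult_mono) auto
      then have \<rho>r: "\<rho> \<le> r" using s' by simp
      have "norm (m ?x ?y - (?x + ?y)) \<le> C * \<rho> * (norm ?x + norm ?y)"
        using x y \<rho> \<rho>r by (intro m_approx_0) auto
      also have "\<dots> \<le> C * \<rho> * \<rho>"
      proof (rule mult_left_mono)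
        show "norm ?x + norm ?y \<le> \<rho>" using x y by (simp add: \<rho>_def algebra_simps)
        show "0 \<le> C * \<rho>" using C \<rho>(1) by simp
      qed
      also have "\<dots> = C * (K + 1)\<^sup>2 * t\<^sup>2" by (simp add: \<rho>_def power2_eq_square)
      finally have mxy: "norm (m ?x ?y - (?x + ?y)) \<le> C * (K + 1)\<^sup>2 * t\<^sup>2" .
      have "m ?x ?y - ((\<Sum>i<n. e i) + ?y) = (m ?x ?y - (?x + ?y)) + (?x - (\<Sum>i<n. e i))" by simp
      also have "norm \<dots> \<le> C * (K + 1)\<^sup>2 * t\<^sup>2 + K * t\<^sup>2" by (intro norm_triangle_mono mxy x)
      also have "\<dots> \<le> K' * t\<^sup>2" by (simp add: K'_def algebra_simps)
      finally have err: "norm (m ?x ?y - ((\<Sum>i<n. e i) + ?y)) \<le> K' * t\<^sup>2" .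
      have "t * t \<le> 1 * t" using t s' by (intro mult_right_mono) auto
      then have t2: "C * (K + 1)\<^sup>2 * t\<^sup>2 \<le> C * (K + 1)\<^sup>2 * t"
        using C by (intro mult_left_mono) (auto simp: power2_eq_square)
      have "norm (m ?x ?y) \<le> norm (m ?x ?y - (?x + ?y)) + (norm ?x + norm ?y)" by norm
      also have "\<dots> \<le> C * (K + 1)\<^sup>2 * t + (K * t + t)" using mxy t2 x y by linarith
      also have "\<dots> = K' * t" by (simp add: K'_def algebra_simps)
      finally have nb: "norm (m ?x ?y) \<le> K' * t" .
      also have "\<dots> \<le> K' * s'" using t K' by (intro mult_left_mono) auto
      finally have "norm (m ?x ?y) \<le> r" using s' by simp
      moreover have "m ?x ?y \<in> E" using m[of ?x ?y] x y \<rho> \<rho>r by simp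
      ultimately show ?thesis unfolding jn using nb err by simp
    qed
    then show "lprod e j \<in> E" "norm (lprod e j) \<le> r" "norm (lprod e j) \<le> K' * t"
      "norm (lprod e j - (\<Sum>i<j. e i)) \<le> K' * t\<^sup>2" by auto
  qed
qed

lemma continuous_on_m:
  "continuous_on ({x \<in> E. norm x \<le> r} \<times> {x \<in> E. norm x \<le> r}) (\<lambda>p. m (fst p) (snd p))"
proof (rule continuous_onI)
  fix p and e :: real
  assume p: "p \<in> {x \<in> E. norm x \<le> r} \<times> {x \<in> E. norm x \<le> r}" and e: "e > 0"
  define d where "d = e / (2 * (1 + C * r))"
  have Cr: "1 + C * r > 0" using C r by (simp add: add_pos_pos)
  have d: "d > 0" using e Cr by (simp add: d_def)
  have "dist (m (fst q) (snd q)) (m (fst p) (snd p)) \<le> e"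
    if q: "q \<in> {x \<in> E. norm x \<le> r} \<times> {x \<in> E. norm x \<le> r}" "dist q p < d" for q
  proof -
    let ?a = "fst q - fst p" and ?b = "snd q - snd p"
    have ab: "norm ?a \<le> d" "norm ?b \<le> d"
      using dist_fst_le[of q p] dist_snd_le[of q p] q(2) by (auto simp: dist_norm)
    have "norm (m (fst q) (snd q) - m (fst p) (snd p) - (?a + ?b)) \<le> C * r * (norm ?a + norm ?b)"
      using p q by (intro m_approx) auto
    moreover have "norm (m (fst q) (snd q) - m (fst p) (snd p)) \<le>
      norm (m (fst q) (snd q) - m (fst p) (snd p) - (?a + ?b)) + (norm ?a + norm ?b)" by norm
    ultimately have "norm (m (fst q) (snd q) - m (fst p) (snd p)) \<le> (1 + C * r) * (norm ?a + norm ?b)"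
      by (simp add: algebra_simps)
    also have "\<dots> \<le> (1 + C * r) * (d + d)" using ab Cr by (intro mult_left_mono) auto
    also have "\<dots> = (1 + C * r) * (2 * d)" by simp
    also have "\<dots> = e" using Cr by (simp add: d_def divide_simps)
    finally show ?thesis by (simp add: dist_norm)
  qed
  then show "\<exists>d>0. \<forall>q\<in>{x \<in> E. norm x \<le> r} \<times> {x \<in> E. norm x \<le> r}. dist q p < d \<longrightarrow>
    dist (m (fst q) (snd q)) (m (fst p) (snd p)) \<le> e" using d by blast
qed

lemma continuous_on_lprod:
  assumes "\<And>i. i < n \<Longrightarrow> continuous_on S (\<lambda>z. e z i)"
    and "\<And>i z. i < n \<Longrightarrow> z \<in> S \<Longrightarrow> e z i \<in> E \<and> norm (e z i) \<le> r"
    and "\<And>j z. j \<le> n \<Longrightarrow> z \<in> S \<Longrightarrow> lprod (e z) j \<in> E \<and> norm (lprod (e z) j) \<le> r"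
    and "j \<le> n"
  shows "continuous_on S (\<lambda>z. lprod (e z) j)"
  using assms(4)
proof (induction j)
  case (Suc j)
  have "continuous_on S (\<lambda>z. (lprod (e z) j, e z j))"
    using Suc assms(1) by (intro continuous_on_Pair) auto
  from continuous_on_compose2[OF continuous_on_m this]
  show ?case using Suc.prems assms(2,3) by (auto simp: image_subset_iff)
qed simp

text \<open>The conjugates telescope: u (h u h^-1) ... (h^(j-1) u h^-(j-1)) h^j = (u h)^j. Index 0
  is taken by \<open>y\<close>, so the conjugate by \<open>h [^] j\<close> sits at
  \<open>Suc j\<close>.\<close>

lemma psi_lprod:
  assumes "\<And>i. i < n \<Longrightarrow> e i \<in> E \<and> norm (e i) \<le> r" "\<And>j. j \<le> n \<Longrightarrow> lprod e j \<in> E \<and> norm (lprod e j) \<le> r"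
    and y: "y \<in> carrier G" and u: "u \<in> carrier G" and h: "h \<in> carrier G"
    and e0: "\<psi> (e 0) = y" and eS: "\<And>j. Suc j < n \<Longrightarrow> \<psi> (e (Suc j)) = h [^] j \<otimes> u \<otimes> inv (h [^] j)"
    and "Suc j \<le> n"
  shows "\<psi> (lprod e (Suc j)) \<otimes> h [^] j = y \<otimes> (u \<otimes> h) [^] j"
  using assms(8)
proof (induction j)
  case 0
  then have "lprod e (Suc 0) = e 0" using assms(1)[of 0] m_0_left[of "e 0"] by simp
  then show ?case using e0 y by simp
next
  case (Suc j)
  have cl: "\<psi> (lprod e (Suc j)) \<in> carrier G" using assms(2)[of "Suc j"] Suc.prems r by (intro psi_closed) auto
  have "\<psi> (lprod e (Suc (Suc j))) = \<psi> (lprod e (Suc j)) \<otimes> \<psi> (e (Suc j))"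
    unfolding lprod.simps(2)[of e "Suc j"] using m[of "lprod e (Suc j)" "e (Suc j)"] assms(1)[of "Suc j"] assms(2)[of "Suc j"] Suc.prems
    by simp
  also have "\<dots> = \<psi> (lprod e (Suc j)) \<otimes> (h [^] j \<otimes> u \<otimes> inv (h [^] j))" using eS Suc.prems by simp
  finally have "\<psi> (lprod e (Suc (Suc j))) \<otimes> h [^] Suc j =
    \<psi> (lprod e (Suc j)) \<otimes> h [^] j \<otimes> u \<otimes> (inv (h [^] j) \<otimes> h [^] j) \<otimes> h"
    using cl u h by (simp only: m_assoc m_closed inv_closed nat_pow_closed nat_pow_Suc)
  also have "\<dots> = (y \<otimes> (u \<otimes> h) [^] j) \<otimes> u \<otimes> h"
    using Suc cl y u h by simp
  also have "\<dots> = y \<otimes> (u \<otimes> h) [^] Suc j" using y u h by (simp add: m_assoc)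
  finally show ?case .
qed

section \<open>Regularity in coordinates and the persistence of roots\<close>

definition ad_nil :: "'a \<Rightarrow> 'e set" where "ad_nil g = nilspace E (\<lambda>x. A g x - x)"

definition regular :: "'a \<Rightarrow> bool" where
  "regular g \<longleftrightarrow> (\<forall>h\<in>carrier G. dim (ad_nil g) \<le> dim (ad_nil h))"

lemma ad_nil_eq:
  assumes g: "g \<in> carrier G"
  shows "ad_nil g = {x \<in> E. ((\<lambda>x. A g x - x) ^^ DIM('e)) x = 0}"
  unfolding ad_nil_def
  by (rule nilspace_eq_kernel[OF E linear_A_minus_id[OF g]]) (intro subspace_diff[OF E] A_closed[OF g])

lemma ad_nil_root:
  assumes h: "h \<in> carrier G" and reg: "regular (h [^] (k::nat))"
  shows "ad_nil h = ad_nil (h [^] k)"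
proof -
  have hk: "h [^] k \<in> carrier G" using h by blast
  have sub: "subspace (ad_nil g)" if "g \<in> carrier G" for g
    unfolding ad_nil_eq[OF that] by (rule subspace_kernel_on[OF E linear_funpow[OF linear_A_minus_id[OF that]]])
  have "ad_nil (h [^] k) = nilspace E (\<lambda>x. (A h ^^ k) x - x)"
    unfolding ad_nil_def
    using A_pow[OF h] subspace_diff[OF E] A_closed[OF hk] by (intro nilspace_cong) auto
  then have "ad_nil h \<subseteq> ad_nil (h [^] k)"
    using nilspace_id_minus_subset_pow[OF A_linear[OF h], of E k] by (simp add: ad_nil_def)
  then show ?thesis
    using reg h sub hk unfolding regular_def by (intro subspace_dim_equal) auto
qed

text \<open>All constants up to \<open>d\<close> are fixed before \<open>w\<close> and
  \<open>h\<close> appear, so one neighbourhood of \<open>g\<close> serves every root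
  \<open>h\<close>. The unknown is a single vector \<open>z\<close> of \<open>E\<close>, from which
  \<open>Y z\<close> and \<open>X z\<close> are formed linearly; this puts the problem on a ball of
  \<open>E\<close>.\<close>

lemma root_persists:
  fixes k :: nat
  assumes g: "g \<in> carrier G" and regg: "regular g" and k: "k > 0"
  shows "\<exists>d>0. \<forall>w\<in>E. norm w < d \<longrightarrow> (\<forall>h\<in>carrier G. h [^] k = \<psi> w \<otimes> g \<longrightarrow> regular (\<psi> w \<otimes> g) \<longrightarrow>
    (\<exists>x\<in>carrier G. x [^] k = g))"
proof -
  obtain K where K: "K > 0" "\<And>x. norm (A g x) \<le> K * norm x" using A_bound[OF g] by blast
  obtain e1 C1 where e1: "e1 > 0" and C1: "C1 > 0" and fit:
    "\<And>L'. linear L' \<Longrightarrow> (\<And>x. x \<in> E \<Longrightarrow> L' x \<in> E) \<Longrightarrow>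
       (\<And>x. x \<in> E \<Longrightarrow> norm (L' x - (A g x - x)) \<le> e1 * norm x) \<Longrightarrow>
       dim (nilspace E L') = dim (nilspace E (\<lambda>x. A g x - x)) \<Longrightarrow>
       \<exists>Y. linear Y \<and> (\<forall>z\<in>E. Y z \<in> E \<and> norm (Y z) \<le> C1 * norm z \<and> z - L' (Y z) \<in> nilspace E L')"
    using perturbed_fitting_decomposition[OF E linear_A_minus_id[OF g] subspace_diff[OF E A_closed[OF g]]]
    by blast
  have K1: "K + 1 \<ge> 0" using K by simp
  obtain v C2 where C2: "C2 > 0" and root:
    "\<forall>(B::'e \<Rightarrow> 'e) F x j. linear B \<longrightarrow> (\<forall>x\<in>F. B x \<in> F) \<longrightarrow>
       (\<forall>x\<in>F. norm ((B ^^ k) x) \<le> (K + 1) * norm x) \<longrightarrow> x \<in> F \<longrightarrow>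
       ((\<lambda>x. B x - x) ^^ DIM('e)) x = 0 \<longrightarrow> j < k \<longrightarrow>
       norm ((B ^^ j) (poly_op v B x)) \<le> C2 * norm x"
    "\<forall>(B::'e \<Rightarrow> 'e) x. linear B \<longrightarrow> ((\<lambda>x. B x - x) ^^ DIM('e)) x = 0 \<longrightarrow>
       (\<Sum>j<k. (B ^^ j) (poly_op v B x)) = x"
    by (rule unipotent_root_bound[OF k K1])
  \<comment> \<open>\<open>C1\<close> bounds \<open>Y z\<close>, and the last summand bounds all
    \<open>(A h ^^ j) (X z)\<close>, with \<open>K + 2\<close> a bound of \<open>L'\<close>; the 1
    gives \<open>\<rho> \<le> C3 * \<rho>\<close>. As \<open>lexp\<close> at most doubles norms,
    \<open>2 * C3 * \<rho>\<close> bounds all \<open>k + 2\<close> factors.\<close>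
  define C3 where "C3 = 1 + C1 + C2 * (1 + (K + 2) * C1)"
  have C3: "C3 > 1" "C1 \<le> C3" "C2 * (1 + (K + 2) * C1) \<le> C3" using K C1 C2 by (auto simp: C3_def add_pos_pos)
  obtain P s where P: "P > 0" and s: "s > 0" and lpb0: "\<forall>t e. 0 \<le> t \<longrightarrow> t \<le> s \<longrightarrow>
     (\<forall>i<k+2. e i \<in> E \<and> norm (e i) \<le> t) \<longrightarrow>
     (\<forall>j\<le>k+2. lprod e j \<in> E \<and> norm (lprod e j) \<le> r \<and> norm (lprod e j) \<le> P * t \<and>
       norm (lprod e j - (\<Sum>i<j. e i)) \<le> P * t\<^sup>2)"
    using lprod_bound[of "k + 2"] by (elim exE conjE) (rule that)
  have lpb: "lprod e j \<in> E \<and> norm (lprod e j) \<le> r \<and> norm (lprod e j) \<le> P * t \<and>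
       norm (lprod e j - (\<Sum>i<j. e i)) \<le> P * t\<^sup>2"
    if "0 \<le> t" "t \<le> s" "\<And>i. i < k + 2 \<Longrightarrow> e i \<in> E \<and> norm (e i) \<le> t" "j \<le> k + 2" for t e j
    using lpb0[rule_format, OF that(1,2), of e j] that(3,4) by blast
  define e2 where "e2 = 1 / (8 * C3)"
  have e2: "e2 > 0" "e2 * C3 = 1 / 8" using C3 by (auto simp: e2_def)
  obtain d0 where d0: "d0 > 0" "d0 \<le> r" "d0 \<le> 1" "continuous_on {x \<in> E. norm x < d0} (cj g)"
    "\<And>x. x \<in> E \<Longrightarrow> norm x < d0 \<Longrightarrow> cj g x \<in> E"
    "\<And>x. x \<in> E \<Longrightarrow> norm x < d0 \<Longrightarrow> norm (cj g x) < R"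
    "\<And>x. x \<in> E \<Longrightarrow> norm x < d0 \<Longrightarrow> \<psi> (cj g x) = g \<otimes> \<psi> x \<otimes> inv g"
    "\<And>x. x \<in> E \<Longrightarrow> norm x < d0 \<Longrightarrow> norm (cj g x - A g x) \<le> e2 * norm x"
    using cj_nbhd[OF g e2(1) zero_less_one] by blast
  \<comment> \<open>\<open>Q * \<rho> * \<rho>\<close> collects the quadratic errors:
    \<open>P * (2 * C3 * \<rho>)\<^sup>2\<close> for replacing the product by a sum, and one error
    of \<open>lexp\<close> for each of the \<open>k\<close> exponentials.\<close>
  define Q where "Q = P * 4 * C3\<^sup>2 + k * (2 * C * C3\<^sup>2)"
  have Q: "Q > 0" using P C3 C by (auto simp: Q_def intro!: add_pos_nonneg)
  define \<rho> where "\<rho> = Min {d0 / (2 * C3), lexp_radius / (2 * C3), r / (2 * C3), s / (2 * C3), 1 / (4 * Q)}"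
  have \<rho>: "\<rho> > 0" "2 * C3 * \<rho> \<le> d0" "2 * C3 * \<rho> \<le> lexp_radius" "2 * C3 * \<rho> \<le> r" "2 * C3 * \<rho> \<le> s" "4 * Q * \<rho> \<le> 1"
  proof -
    show "\<rho> > 0" using d0(1) C3 r(1) s Q lexp_radius(1) by (auto simp: \<rho>_def)
    have "2 * C3 * \<rho> \<le> a" if "\<rho> \<le> a / (2 * C3)" for a using that C3 by (simp add: field_simps)
    then show "2 * C3 * \<rho> \<le> d0" "2 * C3 * \<rho> \<le> lexp_radius" "2 * C3 * \<rho> \<le> r" "2 * C3 * \<rho> \<le> s"
      by (auto simp: \<rho>_def)
    have "\<rho> \<le> 1 / (4 * Q)" by (auto simp: \<rho>_def)
    then show "4 * Q * \<rho> \<le> 1" using Q by (simp add: field_simps)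
  qed
  define e3 where "e3 = Min {1, e1, e2}"
  have e3: "e3 > 0" "e3 \<le> 1" "e3 \<le> e1" "e3 \<le> e2" using e1 e2 by (auto simp: e3_def)
  \<comment> \<open>Besides \<open>norm w \<le> \<rho> / 8\<close>, \<open>d\<close> ensures through
    \<open>A_near_one\<close> that \<open>A g'\<close> is within \<open>e3\<close> of
    \<open>A g\<close>: within \<open>e1\<close> for the Fitting decomposition, within
    \<open>e2\<close> for the estimate of \<open>z - H z\<close>.\<close>
  define d where "d = Min {\<rho> / 8, r, 1 / (2 * C), e3 / (4 * C * K)}"
  have d: "d > 0" "d \<le> \<rho> / 8" "d \<le> r" "C * d \<le> 1 / 2" "4 * C * d * K \<le> e3"
  proof -
    show "d > 0" "d \<le> \<rho> / 8" "d \<le> r" using \<rho>(1) r C e3(1) K(1) by (auto simp: d_def)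
    have "d \<le> 1 / (2 * C)" "d \<le> e3 / (4 * C * K)" by (auto simp: d_def)
    then show "C * d \<le> 1 / 2" "4 * C * d * K \<le> e3" using C K(1) by (simp_all add: field_simps)
  qed
  show ?thesis
  proof (intro exI[of _ d] conjI d(1) ballI impI)
    fix w h assume w: "w \<in> E" "norm w < d" and h: "h \<in> carrier G" and hk: "h [^] k = \<psi> w \<otimes> g"
      and reg': "regular (\<psi> w \<otimes> g)"
    define g' where "g' = \<psi> w \<otimes> g"
    have wG: "\<psi> w \<in> carrier G" using w d r by (intro psi_closed) auto
    have g': "g' \<in> carrier G" using wG g by (simp add: g'_def)
    have near: "norm (A g' x - A g x) \<le> e3 * norm x" if x: "x \<in> E" for x
    proof -
      have "norm (A g' x - A g x) \<le> 4 * C * d * norm (A g x)"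
        unfolding g'_def A_mult[OF wG g x] using w d A_closed[OF g x] by (intro A_near_one) auto
      also have "\<dots> \<le> 4 * C * d * (K * norm x)" using C d K by (intro mult_left_mono) auto
      also have "\<dots> \<le> e3 * norm x" using mult_right_mono[OF d(5) norm_ge_zero[of x]] by (simp add: mult_ac)
      finally show ?thesis .
    qed
    define L' where "L' = (\<lambda>x. A g' x - x)"
    have L': "linear L'" unfolding L'_def by (rule linear_A_minus_id[OF g'])
    have L'E: "L' x \<in> E" if "x \<in> E" for x unfolding L'_def using that by (intro subspace_diff[OF E] A_closed[OF g'])
    have L'near: "norm (L' x - (A g x - x)) \<le> e1 * norm x" if "x \<in> E" for x
      using near[OF that] mult_right_mono[OF e3(3) norm_ge_zero[of x]] by (simp add: L'_def)
    have "dim (nilspace E L') = dim (nilspace E (\<lambda>x. A g x - x))"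
      using reg' regg g g' unfolding regular_def ad_nil_def L'_def g'_def by (intro antisym) auto
    then obtain Y where Y: "linear Y" "\<And>z. z \<in> E \<Longrightarrow> Y z \<in> E" "\<And>z. z \<in> E \<Longrightarrow> norm (Y z) \<le> C1 * norm z"
      "\<And>z. z \<in> E \<Longrightarrow> z - L' (Y z) \<in> nilspace E L'"
      using fit[OF L' L'E L'near] by blast
    have nil: "nilspace E L' = {x \<in> E. ((\<lambda>x. A h x - x) ^^ DIM('e)) x = 0}"
      using ad_nil_root[OF h, of k] ad_nil_eq[OF h] reg' by (simp add: hk ad_nil_def L'_def g'_def)
    have Apow: "(A h ^^ k) x = A g' x" if "x \<in> E" for x
      using A_pow[OF h that, of k] by (simp add: hk g'_def)
    have g'K: "norm (A g' x) \<le> (K + 1) * norm x" if x: "x \<in> E" for x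
    proof -
      have "norm (A g' x) \<le> norm (A g x) + norm (A g' x - A g x)" by norm
      also have "\<dots> \<le> K * norm x + 1 * norm x"
        using K(2)[of x] near[OF x] mult_right_mono[OF e3(2) norm_ge_zero[of x]] by linarith
      finally show ?thesis by (simp add: algebra_simps)
    qed
    \<comment> \<open>The sign gives \<open>L' (Y z) - (\<Sum>j<k. (A h ^^ j) (X z)) = z\<close>:
      \<open>Y\<close> solves modulo the nilspace, and on the nilspace \<open>poly_op v\<close>
      inverts the sum.\<close>
    define X where "X z = - poly_op v (A h) (z - L' (Y z))" for z
    note Ah = A_linear[OF h]
    have linX: "linear X" unfolding X_def
      using linear_compose_neg[OF linear_compose[OF linear_compose_sub[OF linear_ident linear_compose[OF Y(1) L']] linear_poly_op[OF Ah]]]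
      by (simp add: o_def)
    have z_nil: "z - L' (Y z) \<in> E" "((\<lambda>x. A h x - x) ^^ DIM('e)) (z - L' (Y z)) = 0" if "z \<in> E" for z
      using Y(4)[OF that] unfolding nil by auto
    have XE: "X z \<in> E" if "z \<in> E" for z
      unfolding X_def by (intro subspace_neg[OF E] poly_op_closed[OF E] z_nil A_closed[OF h] that)
    have AXE: "(A h ^^ j) (X z) \<in> E" if "z \<in> E" for z j
      using funpow_closed[of E "A h", OF A_closed[OF h] XE[OF that]] .
    have linAX: "linear (\<lambda>z. (A h ^^ j) (X z))" for j
      using linear_compose[OF linX linear_funpow[OF Ah]] by (simp add: o_def)
    have Xsum: "(\<Sum>j<k. (A h ^^ j) (X z)) = - (z - L' (Y z))" if "z \<in> E" for z
      using root(2)[rule_format, OF Ah z_nil(2)[OF that]]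
      by (simp add: X_def linear_neg[OF linear_funpow[OF Ah]] sum_negf)
    have AXb: "norm ((A h ^^ j) (X z)) \<le> C3 * norm z" if z: "z \<in> E" and j: "j < k" for z j
    proof -
      have "norm (L' (Y z)) \<le> norm (A g' (Y z)) + norm (Y z)" unfolding L'_def by norm
      also have "\<dots> \<le> (K + 2) * norm (Y z)" using g'K[OF Y(2)[OF z]] by (simp add: algebra_simps)
      also have "\<dots> \<le> (K + 2) * (C1 * norm z)" using Y(3)[OF z] K by (intro mult_left_mono) auto
      finally have "norm (z - L' (Y z)) \<le> norm z + (K + 2) * (C1 * norm z)"
        using norm_triangle_ineq4[of z "L' (Y z)"] by linarith
      also have "\<dots> = (1 + (K + 2) * C1) * norm z" by (simp add: algebra_simps)
      finally have zb: "norm (z - L' (Y z)) \<le> (1 + (K + 2) * C1) * norm z" .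
      have "norm ((A h ^^ j) (X z)) \<le> C2 * norm (z - L' (Y z))"
        using root(1)[rule_format, of "A h" E, OF Ah A_closed[OF h] _ z_nil[OF z] j] Apow g'K
        by (simp add: X_def linear_neg[OF linear_funpow[OF Ah]])
      also have "\<dots> \<le> C2 * ((1 + (K + 2) * C1) * norm z)" using zb C2 by (intro mult_left_mono) auto
      also have "\<dots> \<le> C3 * norm z" using mult_right_mono[OF C3(3) norm_ge_zero[of z]] by (simp add: mult_ac)
      finally show ?thesis .
    qed
    \<comment> \<open>The factors are \<open>y\<close> at 0, the conjugated exponentials at 1 to
      \<open>k\<close>, and \<open>w\<close> at \<open>k + 1\<close>.\<close>
    define e where "e z i = (if i = 0 then Y z else if i \<le> k then lexp ((A h ^^ (i - 1)) (X z)) else w)" for z i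
    define S where "S = cball 0 \<rho> \<inter> E"
    have SD: "z \<in> E" "norm z \<le> \<rho>" if "z \<in> S" for z using that by (auto simp: S_def)
    have Yb: "norm (Y z) \<le> C3 * \<rho>" if z: "z \<in> S" for z
    proof -
      have "norm (Y z) \<le> C1 * norm z" using Y(3) SD[OF z] by blast
      also have "\<dots> \<le> C3 * \<rho>" using SD(2)[OF z] C1 C3 by (intro mult_mono) auto
      finally show ?thesis .
    qed
    have AXb': "norm ((A h ^^ j) (X z)) \<le> C3 * \<rho>" if z: "z \<in> S" and j: "j < k" for z j
    proof -
      have "norm ((A h ^^ j) (X z)) \<le> C3 * norm z" using AXb SD[OF z] j by blast
      also have "\<dots> \<le> C3 * \<rho>" using SD(2)[OF z] C3 by (intro mult_left_mono) auto
      finally show ?thesis .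
    qed
    have AXr: "norm ((A h ^^ j) (X z)) \<le> lexp_radius / 2" if "z \<in> S" "j < k" for z j
      using AXb'[OF that] \<rho>(3) by linarith
    have \<rho>C: "1 * \<rho> \<le> C3 * \<rho>" using C3 \<rho>(1) by (intro mult_right_mono) auto
    have \<rho>C2: "C3 * \<rho> \<le> 2 * C3 * \<rho>" using C3 \<rho>(1) by simp
    have wb: "norm w \<le> \<rho> / 8" using w d by simp
    have eE: "e z i \<in> E \<and> norm (e z i) \<le> 2 * C3 * \<rho>" if z: "z \<in> S" "i < k + 2" for z i
    proof (cases "i = 0 \<or> i = k + 1")
      case True
      then show ?thesis using Y(2)[OF SD(1)[OF z(1)]] order_trans[OF Yb[OF z(1)] \<rho>C2] w(1)
          order_trans[OF wb, of "2 * C3 * \<rho>"] \<rho>C \<rho>C2 \<rho>(1) by (auto simp: e_def)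
    next
      case False
      then have i: "i - 1 < k" "i \<noteq> 0" "i \<le> k" using z by auto
      note a = AXE[OF SD(1)[OF z(1)], of "i - 1"] AXr[OF z(1) i(1)]
      have "norm (lexp ((A h ^^ (i - 1)) (X z))) \<le> 2 * norm ((A h ^^ (i - 1)) (X z))" by (rule norm_lexp[OF a])
      then show ?thesis using lexp_limit(3)[OF a] AXb'[OF z(1) i(1)] i by (simp add: e_def mult.assoc)
    qed
    have er: "e z i \<in> E \<and> norm (e z i) \<le> r" if "i < k + 2" "z \<in> S" for z i
      using eE[OF that(2,1)] \<rho>(4) by auto
    have t0: "0 \<le> 2 * C3 * \<rho>" using C3 \<rho>(1) by simp
    have lp: "lprod (e z) j \<in> E \<and> norm (lprod (e z) j) \<le> r"
      "norm (lprod (e z) j - (\<Sum>i<j. e z i)) \<le> P * (2 * C3 * \<rho>)\<^sup>2" if "j \<le> k + 2" "z \<in> S" for z j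
      using lpb[OF t0 \<rho>(5), of "e z" j] eE[OF that(2)] that(1) by blast+
    have esum: "(\<Sum>i<k+2. e z i) = Y z + (\<Sum>j<k. lexp ((A h ^^ j) (X z))) + w" for z
    proof -
      have "(\<Sum>i<k+2. e z i) = (\<Sum>i<Suc k. e z i) + e z (Suc k)" by simp
      also have "(\<Sum>i<Suc k. e z i) = e z 0 + (\<Sum>i<k. e z (Suc i))" by (rule sum.lessThan_Suc_shift)
      also have "(\<Sum>i<k. e z (Suc i)) = (\<Sum>j<k. lexp ((A h ^^ j) (X z)))" by (rule sum.cong) (auto simp: e_def)
      finally show ?thesis by (simp add: e_def)
    qed
    \<comment> \<open>In coordinates, a zero of \<open>H\<close> says g y g^-1 = y exp X ... w,
      which is equivalent to y (exp X h)^k y^-1 = g.\<close>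
    define H where "H z = cj g (Y z) - lprod (e z) (k + 2)" for z
    have Yd: "norm (Y z) < d0" if z: "z \<in> S" for z
    proof -
      have "C3 * \<rho> < 2 * C3 * \<rho>" using C3 \<rho>(1) by simp
      then show ?thesis using Yb[OF z] \<rho>(2) by linarith
    qed
    have YE: "Y z \<in> E" if "z \<in> S" for z using Y(2) SD that by blast
    have Hb: "norm (z - H z) \<le> \<rho>" if z: "z \<in> S" for z
    proof -
      let ?l = "\<Sum>j<k. lexp ((A h ^^ j) (X z))" and ?a = "\<Sum>j<k. (A h ^^ j) (X z)"
      \<comment> \<open>Five errors: linearizing the conjugation by \<open>g\<close>, replacing the
        product by a sum, replacing \<open>lexp\<close> by the identity, \<open>w\<close> itself,
        and \<open>A g'\<close> against \<open>A g\<close>. The second and third are quadratic and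
        amount to at most \<open>\<rho> / 4\<close> together; each of the others is at most
        \<open>\<rho> / 8\<close>.\<close>
      have "z - H z = (A g (Y z) - cj g (Y z)) + ((lprod (e z) (k + 2) - (\<Sum>i<k+2. e z i)) +
         ((?l - ?a) + (w + (A g' (Y z) - A g (Y z)))))"
        unfolding esum Xsum[OF SD(1)[OF z]] by (simp add: H_def L'_def)
      also have "norm \<dots> \<le> \<rho> / 8 + (P * (2 * C3 * \<rho>)\<^sup>2 + (k * (2 * C * (C3 * \<rho>)\<^sup>2) + (\<rho> / 8 + \<rho> / 8)))"
      proof (intro norm_triangle_mono wb lp(2) order_refl z)
        have eY: "e2 * norm (Y z) \<le> \<rho> / 8"
          using mult_left_mono[OF Yb[OF z], of e2] e2 by (simp add: mult.assoc[symmetric])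
        have "norm (cj g (Y z) - A g (Y z)) \<le> e2 * norm (Y z)" by (rule d0(8)[OF YE[OF z] Yd[OF z]])
        then show "norm (A g (Y z) - cj g (Y z)) \<le> \<rho> / 8" using eY by (simp add: norm_minus_commute)
        have "norm (A g' (Y z) - A g (Y z)) \<le> e2 * norm (Y z)"
          using near[OF YE[OF z]] mult_right_mono[OF e3(4) norm_ge_zero[of "Y z"]] by linarith
        then show "norm (A g' (Y z) - A g (Y z)) \<le> \<rho> / 8" using eY by linarith
        have "norm (?l - ?a) \<le> (\<Sum>j<k. 2 * C * (C3 * \<rho>)\<^sup>2)"
          unfolding sum_subtractf[symmetric]
        proof (rule sum_norm_le)
          fix j assume "j \<in> {..<k}"
          then have j: "j < k" by simp
          have "norm (lexp ((A h ^^ j) (X z)) - (A h ^^ j) (X z)) \<le> 2 * C * (norm ((A h ^^ j) (X z)))\<^sup>2"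
            by (rule lexp_limit(2)[OF AXE[OF SD(1)[OF z]] AXr[OF z j]])
          also have "\<dots> \<le> 2 * C * (C3 * \<rho>)\<^sup>2"
            using AXb'[OF z j] C by (intro mult_left_mono power_mono) auto
          finally show "norm (lexp ((A h ^^ j) (X z)) - (A h ^^ j) (X z)) \<le> 2 * C * (C3 * \<rho>)\<^sup>2" .
        qed
        then show "norm (?l - ?a) \<le> k * (2 * C * (C3 * \<rho>)\<^sup>2)" by simp
      qed
      also have "\<dots> = 3 / 8 * \<rho> + Q * \<rho> * \<rho>" by (simp add: Q_def power2_eq_square algebra_simps)
      also have "\<dots> \<le> 3 / 8 * \<rho> + 1 / 4 * \<rho>"
        using \<rho>(1,6) by (intro add_left_mono mult_right_mono) auto
      also have "\<dots> \<le> \<rho>" using \<rho>(1) by simp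
      finally show ?thesis .
    qed
    have cH: "continuous_on S (\<lambda>z. z - H z)" unfolding H_def
    proof (intro continuous_intros)
      have cY: "continuous_on S Y" using Y(1) by (rule linear_continuous_on_compose[OF continuous_on_id, simplified])
      show "continuous_on S (\<lambda>z. cj g (Y z))"
        by (rule continuous_on_compose2[OF d0(4) cY]) (use YE Yd in auto)
      show "continuous_on S (\<lambda>z. lprod (e z) (k + 2))"
      proof (rule continuous_on_lprod[OF _ er lp(1) order_refl])
        fix i assume i: "i < k + 2"
        consider "i = 0" | "i = k + 1" | "i \<noteq> 0" "i \<le> k" using i by linarith
        then show "continuous_on S (\<lambda>z. e z i)"
        proof cases
          case 3
          have "continuous_on S (\<lambda>z. (A h ^^ (i - 1)) (X z))"
            by (rule linear_continuous_on_compose[OF continuous_on_id linAX, simplified])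
          then have "continuous_on S (\<lambda>z. lexp ((A h ^^ (i - 1)) (X z)))"
            by (rule continuous_on_compose2[OF continuous_on_lexp]) (use AXE SD AXr 3 in auto)
          then show ?thesis using 3 by (simp add: e_def)
        qed (use cY in \<open>auto simp: e_def\<close>)
      qed
    qed
    have HE: "z - H z \<in> E" if z: "z \<in> S" for z
      unfolding H_def using d0(5)[OF YE[OF z] Yd[OF z]] lp(1)[OF order_refl z] SD[OF z]
      by (intro subspace_diff[OF E]) auto
    have "compact S" unfolding S_def by (intro compact_Int_closed compact_cball closed_subspace E)
    moreover have "convex S" unfolding S_def by (intro convex_Int convex_cball subspace_imp_convex E)
    moreover have "0 \<in> S" using subspace_0[OF E] \<rho>(1) by (simp add: S_def)
    then have "S \<noteq> {}" by blast
    moreover have "(\<lambda>z. z - H z) \<in> S \<rightarrow> S" using HE Hb by (auto simp: S_def)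
    ultimately obtain z where z: "z \<in> S" "z - H z = z" using brouwer[OF _ _ _ cH] by blast
    then have eq: "cj g (Y z) = lprod (e z) (k + 2)" by (simp add: H_def)
    define y where "y = \<psi> (Y z)"
    define u where "u = \<psi> (lexp (X z))"
    have y: "y \<in> carrier G" unfolding y_def using YE[OF z(1)] Yd[OF z(1)] d0(2) r by (intro psi_closed) auto
    have u: "u \<in> carrier G" unfolding u_def
      using AXE[OF SD(1)[OF z(1)], of 0] AXr[OF z(1) k] by (intro psi_lexp_closed) auto
    have eS: "\<psi> (e z (Suc j)) = h [^] j \<otimes> u \<otimes> inv (h [^] j)" if j: "Suc j < k + 1" for j
    proof -
      have jk: "j < k" using j by simp
      have "A (h [^] j) (X z) = (A h ^^ j) (X z)" by (rule A_pow[OF h XE[OF SD(1)[OF z(1)]]])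
      then show ?thesis
        using lexp_natural[OF nat_pow_closed[OF h] XE[OF SD(1)[OF z(1)]], of j] AXr[OF z(1) jk] AXr[OF z(1) k] jk
        by (simp add: e_def u_def)
    qed
    let ?p = "\<psi> (lprod (e z) (Suc k))"
    have prod: "?p \<otimes> h [^] k = y \<otimes> (u \<otimes> h) [^] k"
      by (rule psi_lprod[where n = "k + 1"]) (use er[OF _ z(1)] lp(1)[OF _ z(1)] y u h eS in \<open>auto simp: e_def y_def\<close>)
    have lSS: "lprod (e z) (k + 2) = m (lprod (e z) (Suc k)) w" by (simp add: e_def)
    have pw: "\<psi> (lprod (e z) (k + 2)) = ?p \<otimes> \<psi> w"
      unfolding lSS using m[of "lprod (e z) (Suc k)" w] lp(1)[OF _ z(1), of "Suc k"] w d(3) by simp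
    have cg: "\<psi> (cj g (Y z)) = g \<otimes> y \<otimes> inv g" unfolding y_def by (rule d0(7)[OF YE[OF z(1)] Yd[OF z(1)]])
    have pG: "?p \<in> carrier G"
      using lp(1)[OF _ z(1), of "Suc k"] r by (intro psi_closed) auto
    \<comment> \<open>Multiplying by \<open>g\<close> on the right completes \<open>\<psi> w\<close>
      to \<open>\<psi> w \<otimes> g = h [^] k\<close>, the factor with which the product
      telescopes.\<close>
    have "g \<otimes> y = (g \<otimes> y \<otimes> inv g) \<otimes> g" using g y by (simp add: m_assoc)
    also have "g \<otimes> y \<otimes> inv g = ?p \<otimes> \<psi> w" using eq pw cg by metis
    also have "?p \<otimes> \<psi> w \<otimes> g = ?p \<otimes> h [^] k" unfolding hk by (rule m_assoc[OF pG wG g])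
    also note prod
    finally have "g \<otimes> y = y \<otimes> (u \<otimes> h) [^] k" .
    then have "g = y \<otimes> (u \<otimes> h) [^] k \<otimes> inv y"
      using g y u h by (metis inv_solve_right m_closed nat_pow_closed)
    also have "\<dots> = (y \<otimes> (u \<otimes> h) \<otimes> inv y) [^] k" using conj_pow y u h by simp
    finally show "\<exists>x\<in>carrier G. x [^] k = g"
      using y u h by (intro bexI[of _ "y \<otimes> (u \<otimes> h) \<otimes> inv y"]) auto
  qed
qed

end

section \<open>Differentiability on subspaces\<close>

text \<open>Derivatives within subsets of \<open>E\<close> are determined on \<open>E\<close> only.
  Composing with the orthogonal projection \<open>P\<close> controls them on the whole space, and
  the orthonormal basis \<open>B\<close> reduces bounds to finitely many directions.\<close>

lemma subspace_projection_ex: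
  fixes E :: "'e::euclidean_space set"
  assumes "subspace E"
  obtains P :: "'e \<Rightarrow> 'e" and B where "linear P" "\<And>x. P x \<in> E" "\<And>x. x \<in> E \<Longrightarrow> P x = x"
    "finite B" "B \<subseteq> E" "\<And>b. b \<in> B \<Longrightarrow> norm b = 1" "\<And>x. P x = (\<Sum>b\<in>B. (x \<bullet> b) *\<^sub>R b)"
proof -
  obtain B where B: "B \<subseteq> E" "pairwise orthogonal B" "\<And>x. x \<in> B \<Longrightarrow> norm x = 1"
    "independent B" "card B = dim E" "span B = E"
    using orthonormal_basis_subspace[OF assms] by blast
  have fin: "finite B" using B(4) by (rule independent_imp_finite)
  define P where "P = (\<lambda>x. \<Sum>b\<in>B. (x \<bullet> b) *\<^sub>R b)"
  have lin: "linear P" unfolding P_def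
    by (intro linear_compose_sum ballI linearI) (simp_all add: inner_add_left scaleR_add_left)
  have PE: "P x \<in> E" for x unfolding P_def
    using B(1) by (intro subspace_sum[OF assms] subspace_scale[OF assms]) auto
  have "P b = b" if b: "b \<in> B" for b
  proof -
    have "P b = (\<Sum>c\<in>B. if c = b then b else 0)" unfolding P_def
    proof (rule sum.cong[OF refl])
      fix c assume c: "c \<in> B"
      show "(b \<bullet> c) *\<^sub>R c = (if c = b then b else 0)"
        using B(2) B(3)[OF b] b c by (auto simp: pairwise_def orthogonal_def norm_eq_1)
    qed
    then show ?thesis using fin b by simp
  qed
  then have "P x = x" if "x \<in> E" for x
    using linear_eq_on_span[OF lin linear_ident, of B x] that B(6) by simp
  then show thesis using that lin PE fin B(1,3) by (auto simp: P_def)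
qed

lemma has_derivative_openin_cong:
  assumes "openin (top_of_set S) T" "x \<in> T"
  shows "at x within T = at x within S"
proof -
  obtain W where W: "open W" "T = S \<inter> W" using assms(1) by (auto simp: openin_open)
  show ?thesis by (rule at_within_nhd[of x W]) (use W assms(2) in auto)
qed

text \<open>The condition within a subset of \<open>E\<close> tests the derivative at differences in
  \<open>E\<close> only, so any bounded linear map with the same values on \<open>E\<close> will
  do.\<close>

lemma has_derivative_on_subspace:
  assumes E: "subspace E" and S: "S \<subseteq> E" "x \<in> S"
    and f: "(f has_derivative f') (at x within S)"
    and P: "bounded_linear P" "\<And>v. v \<in> E \<Longrightarrow> g' v = f' (P v)" "bounded_linear g'" "\<And>v. v \<in> E \<Longrightarrow> P v = v"
  shows "(f has_derivative g') (at x within S)"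
  unfolding has_derivative_within_alt
proof (intro conjI allI impI)
  fix e :: real assume "e > 0"
  then obtain d where "d > 0" "\<And>y. y \<in> S \<Longrightarrow> norm (y - x) < d \<Longrightarrow>
      norm (f y - f x - f' (y - x)) \<le> e * norm (y - x)"
    using f unfolding has_derivative_within_alt by blast
  moreover have "g' (y - x) = f' (y - x)" if "y \<in> S" for y
    using P subspace_diff[OF E, of y x] S that by auto
  ultimately show "\<exists>d>0. \<forall>y\<in>S. norm (y - x) < d \<longrightarrow> norm (f y - f x - g' (y - x)) \<le> e * norm (y - x)"
    by metis
qed (rule P)

text \<open>For small \<open>v\<close> in \<open>E\<close> the point \<open>x + v\<close> stays in
  the relatively open \<open>S\<close>, so the difference of the two derivatives is o(v) on
  \<open>E\<close>; being linear, it vanishes there.\<close>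

lemma has_derivative_unique_on_subspace:
  fixes f :: "'e::real_normed_vector \<Rightarrow> 'f::real_normed_vector"
  assumes E: "subspace E" and S: "openin (top_of_set E) S" "x \<in> S"
    and f: "(f has_derivative f') (at x within S)" "(f has_derivative f'') (at x within S)" and v: "v \<in> E"
  shows "f' v = f'' v"
proof -
  have D: "((\<lambda>_. 0) has_derivative (\<lambda>v. f' v - f'' v)) (at x within S)"
    using has_derivative_diff[OF f] by simp
  have SE: "S \<subseteq> E" using S(1) openin_imp_subset by blast
  obtain b where b: "b > 0" "ball x b \<inter> E \<subseteq> S" using S unfolding openin_contains_ball by blast
  have lin: "linear (\<lambda>v. f' v - f'' v)" using D has_derivative_linear by blast
  have "norm (f' v - f'' v) \<le> e * norm v" if e: "e > 0" for e
  proof -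
    obtain d where d: "d > 0" "\<And>y. y \<in> S \<Longrightarrow> norm (y - x) < d \<Longrightarrow>
       norm (0 - 0 - (f' (y - x) - f'' (y - x))) \<le> e * norm (y - x)"
      using D e unfolding has_derivative_within_alt by blast
    have "norm (f' w - f'' w) \<le> e * norm w" if w: "w \<in> E" "norm w < min b d" for w
    proof -
      have "x + w \<in> ball x b \<inter> E" using w SE S(2) subspace_add[OF E, of x w] by (auto simp: dist_norm)
      then have "x + w \<in> S" using b(2) by blast
      then show ?thesis using d(2)[of "x + w"] w by (simp add: norm_minus_commute)
    qed
    then show ?thesis
      using linear_bound_of_small[OF E lin _ _ v, of "min b d" e] b d by auto
  qed
  then have "norm (f' v - f'' v) \<le> 0 * norm v"
    by (intro le_limit_at_right_0[where f = "\<lambda>e. e * norm v"]) auto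
  then show ?thesis by simp
qed

text \<open>Projecting \<open>f\<close> to \<open>F\<close> does not change it on \<open>S\<close>,
  so \<open>f'\<close> followed by \<open>P\<close> is a derivative too, and uniqueness
  applies.\<close>

lemma has_derivative_maps_to_subspace:
  fixes f :: "'e::euclidean_space \<Rightarrow> 'f::euclidean_space"
  assumes E: "subspace E" and F: "subspace F" and S: "openin (top_of_set E) S" "x \<in> S"
    and f: "(f has_derivative f') (at x within S)" "\<And>y. y \<in> S \<Longrightarrow> f y \<in> F" and v: "v \<in> E"
  shows "f' v \<in> F"
proof -
  obtain P :: "'f \<Rightarrow> 'f" and B where P: "linear P" "\<And>x. P x \<in> F" "\<And>x. x \<in> F \<Longrightarrow> P x = x"
    "finite B" "B \<subseteq> F" "\<And>b. b \<in> B \<Longrightarrow> norm b = 1" "\<And>x. P x = (\<Sum>b\<in>B. (x \<bullet> b) *\<^sub>R b)"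
    using subspace_projection_ex[OF F] by blast
  have "((\<lambda>y. P (f y)) has_derivative (\<lambda>v. P (f' v))) (at x within S)"
    using bounded_linear.has_derivative[OF _ f(1)] P(1) linear_conv_bounded_linear by blast
  then have "(f has_derivative (\<lambda>v. P (f' v))) (at x within S)"
    by (rule has_derivative_transform[rotated 2]) (use S(2) P(3) f(2) in auto)
  then have "f' v = P (f' v)"
    by (rule has_derivative_unique_on_subspace[OF E S f(1) _ v])
  then show ?thesis using P(2) by metis
qed

lemma Ck_on_cong:
  assumes "Ck_on n E U f" "\<And>x. x \<in> U \<Longrightarrow> f x = g x"
  shows "Ck_on n E U g"
proof (cases n)
  case 0
  then show ?thesis using assms by (auto cong: continuous_on_cong)
next
  case (Suc k)
  then obtain f' where f': "\<forall>x\<in>U. (f has_derivative f' x) (at x within U)"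
    "\<forall>v\<in>E. Ck_on k E U (\<lambda>x. f' x v)" using assms(1) by auto
  have "\<forall>x\<in>U. (g has_derivative f' x) (at x within U)"
    using f'(1) assms(2) by (metis has_derivative_transform)
  then show ?thesis using f'(2) Suc by auto
qed

text \<open>Mean value inequality for the derivative precomposed with \<open>P\<close>: its operator
  norm is controlled by bounds on \<open>E\<close>, at the price of the factor
  \<open>K\<close>.\<close>

lemma lipschitz_on_convex_subspace:
  fixes f :: "'e::euclidean_space \<Rightarrow> 'f::euclidean_space"
  assumes E: "subspace E" and S: "convex S" "S \<subseteq> E"
    and f: "\<And>x. x \<in> S \<Longrightarrow> (f has_derivative f' x) (at x within S)"
    and P: "linear P" "\<And>x. P x \<in> E" "\<And>x. x \<in> E \<Longrightarrow> P x = x" "\<And>x. norm (P x) \<le> K * norm x"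
    and B: "0 \<le> B" "0 \<le> K" "\<And>x v. x \<in> S \<Longrightarrow> v \<in> E \<Longrightarrow> norm (f' x v) \<le> B * norm v"
    and xy: "x \<in> S" "y \<in> S"
  shows "norm (f x - f y) \<le> B * K * norm (x - y)"
proof (rule differentiable_bound[OF S(1) _ _ xy])
  fix z assume z: "z \<in> S"
  have bl: "bounded_linear P" using P(1) linear_conv_bounded_linear by blast
  show "(f has_derivative (\<lambda>v. f' z (P v))) (at z within S)"
    by (rule has_derivative_on_subspace[OF E S(2) z f[OF z] bl])
      (use P bounded_linear_compose[OF has_derivative_bounded_linear[OF f[OF z]] bl] in auto)
  show "onorm (\<lambda>v. f' z (P v)) \<le> B * K"
  proof (rule onorm_bound)
    fix v
    have "norm (f' z (P v)) \<le> B * norm (P v)" using B(3)[OF z P(2)] .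
    also have "\<dots> \<le> B * (K * norm v)" using P(4) B(1) by (intro mult_left_mono) auto
    finally show "norm (f' z (P v)) \<le> B * K * norm v" by simp
  qed (use B in auto)
qed

text \<open>Second derivatives are bounded on a compact ball, so the derivative \<open>D\<close> is
  Lipschitz there; the mean value inequality for \<open>f - D a\<close> on the ball of radius
  \<open>\<rho>\<close> then yields the factor \<open>\<rho>\<close>. Since \<open>Ck_on\<close>
  differentiates in one direction at a time, bounds are gathered over the basis \<open>B\<close>,
  which brings in powers of its cardinality \<open>N\<close>.\<close>

lemma C2_strict_estimate:
  fixes f :: "'e::euclidean_space \<Rightarrow> 'f::euclidean_space"
  assumes E: "subspace E" and U: "openin (top_of_set E) U" "a \<in> U" and f: "Ck_on (Suc (Suc 0)) E U f"
  obtains f' C r where "C > 0" "r > 0" "linear f'" "(f has_derivative f') (at a within U)"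
    "cball a r \<inter> E \<subseteq> U"
    "\<forall>x\<in>E. \<forall>y\<in>E. \<forall>\<rho>. norm (x - a) \<le> \<rho> \<longrightarrow> norm (y - a) \<le> \<rho> \<longrightarrow> \<rho> \<le> r \<longrightarrow>
      norm (f y - f x - f' (y - x)) \<le> C * \<rho> * norm (y - x)"
proof -
  obtain P :: "'e \<Rightarrow> 'e" and B where P: "linear P" "\<And>x. P x \<in> E" "\<And>x. x \<in> E \<Longrightarrow> P x = x"
    and B: "finite B" "B \<subseteq> E" "\<And>b. b \<in> B \<Longrightarrow> norm b = 1" "\<And>x. P x = (\<Sum>b\<in>B. (x \<bullet> b) *\<^sub>R b)"
    using subspace_projection_ex[OF E] by blast
  define N where "N = real (card B)"
  have N: "N \<ge> 0" by (simp add: N_def)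
  have expand: "norm (L v) \<le> N * K * norm v"
    if L: "linear L" and v: "v \<in> E" and K: "\<And>b. b \<in> B \<Longrightarrow> norm (L b) \<le> K" "0 \<le> K"
    for L :: "'e \<Rightarrow> 'f" and v K
  proof -
    have "L v = L (\<Sum>b\<in>B. (v \<bullet> b) *\<^sub>R b)" using P(3)[OF v] B(4) by metis
    also have "\<dots> = (\<Sum>b\<in>B. (v \<bullet> b) *\<^sub>R L b)" by (simp add: linear_sum[OF L] linear_scale[OF L])
    also have "norm \<dots> \<le> (\<Sum>b\<in>B. norm v * K)"
    proof (rule sum_norm_le)
      fix b assume b: "b \<in> B"
      have "\<bar>v \<bullet> b\<bar> \<le> norm v" using Cauchy_Schwarz_ineq2[of v b] B(3)[OF b] by simp
      then show "norm ((v \<bullet> b) *\<^sub>R L b) \<le> norm v * K" using K(1)[OF b] by (simp add: mult_mono)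
    qed
    finally show ?thesis by (simp add: N_def mult_ac)
  qed
  have PK: "norm (P x) \<le> N * norm x" for x
  proof -
    have "norm (P x) \<le> (\<Sum>b\<in>B. norm x)" unfolding B(4)
    proof (rule sum_norm_le)
      fix b assume b: "b \<in> B"
      show "norm ((x \<bullet> b) *\<^sub>R b) \<le> norm x" using Cauchy_Schwarz_ineq2[of x b] B(3)[OF b] by simp
    qed
    then show ?thesis by (simp add: N_def)
  qed
  obtain D where D: "\<And>x. x \<in> U \<Longrightarrow> (f has_derivative D x) (at x within U)"
    and D1: "\<And>v. v \<in> E \<Longrightarrow> Ck_on (Suc 0) E U (\<lambda>x. D x v)" using f by auto
  have "\<forall>v\<in>E. \<exists>D'. (\<forall>x\<in>U. ((\<lambda>x. D x v) has_derivative D' x) (at x within U)) \<and>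
      (\<forall>w\<in>E. continuous_on U (\<lambda>x. D' x w))" using D1 by simp
  then obtain D' where D': "\<And>v x. v \<in> E \<Longrightarrow> x \<in> U \<Longrightarrow> ((\<lambda>x. D x v) has_derivative D' v x) (at x within U)"
    and D'c: "\<And>v w. v \<in> E \<Longrightarrow> w \<in> E \<Longrightarrow> continuous_on U (\<lambda>x. D' v x w)" by metis
  obtain r where r: "r > 0" "cball a r \<inter> E \<subseteq> U" using U unfolding openin_contains_cball by blast
  define S where "S = cball a r \<inter> E"
  have S: "compact S" "convex S" "S \<subseteq> E" "S \<subseteq> U" "a \<in> S"
    using r U openin_imp_subset[OF U(1)] unfolding S_def
    by (auto intro!: compact_Int_closed closed_subspace[OF E] convex_Int subspace_imp_convex[OF E])
  have "\<exists>K\<ge>0. \<forall>x\<in>S. norm (D' v x w) \<le> K" if vw: "v \<in> B" "w \<in> B" for v w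
  proof -
    have "continuous_on S (\<lambda>x. D' v x w)" using D'c[of v w] vw B(2) S(4) continuous_on_subset by blast
    then have "bounded ((\<lambda>x. D' v x w) ` S)" by (intro compact_imp_bounded compact_continuous_image S)
    then show ?thesis unfolding bounded_pos by (auto intro: less_imp_le)
  qed
  then obtain Kf where Kf: "\<And>v w. v \<in> B \<Longrightarrow> w \<in> B \<Longrightarrow> Kf v w \<ge> 0"
    "\<And>v w x. v \<in> B \<Longrightarrow> w \<in> B \<Longrightarrow> x \<in> S \<Longrightarrow> norm (D' v x w) \<le> Kf v w" by metis
  define K where "K = (\<Sum>v\<in>B. \<Sum>w\<in>B. Kf v w)"
  have K: "K \<ge> 0" unfolding K_def using Kf by (intro sum_nonneg) auto
  have KfK: "Kf v w \<le> K" if "v \<in> B" "w \<in> B" for v w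
  proof -
    have "Kf v w \<le> (\<Sum>w\<in>B. Kf v w)" using that Kf(1) B(1) by (intro member_le_sum) auto
    also have "\<dots> \<le> K" unfolding K_def using that Kf(1) B(1)
      by (intro member_le_sum[of v B "\<lambda>v. \<Sum>w\<in>B. Kf v w"]) (auto intro: sum_nonneg)
    finally show ?thesis .
  qed
  have Dlip: "norm (D x v - D y v) \<le> N * K * N * norm (x - y)" if v: "v \<in> B" and xy: "x \<in> S" "y \<in> S" for v x y
  proof (rule lipschitz_on_convex_subspace[OF E S(2,3) _ P PK _ _ _ xy])
    have vE: "v \<in> E" using v B(2) by blast
    fix z assume z: "z \<in> S"
    then have zU: "z \<in> U" using S by blast
    show "((\<lambda>x. D x v) has_derivative D' v z) (at z within S)"
      by (rule has_derivative_subset[OF D'[OF vE zU] S(4)])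
    fix w assume w: "w \<in> E"
    show "norm (D' v z w) \<le> N * K * norm w"
      using Kf(2)[OF v _ z] KfK[OF v] by (intro expand[OF has_derivative_linear[OF D'[OF vE zU]] w _ K]) force
  qed (use N K in auto)
  have Dlin: "linear (D x)" if "x \<in> S" for x using D[of x] that S(4) has_derivative_linear by blast
  have Dlip': "norm (D x v - D a v) \<le> N * (N * K * N * norm (x - a)) * norm v" if v: "v \<in> E" and x: "x \<in> S" for v x
    using Dlip[OF _ x S(5)] N K
    by (intro expand[OF linear_compose_sub[OF Dlin[OF x] Dlin[OF S(5)]] v]) auto
  define C where "C = N * (N * K * N) * N + 1"
  have C: "C > 0" using N K by (simp add: C_def add_nonneg_pos)
  have est: "norm (f y - f x - D a (y - x)) \<le> C * \<rho> * norm (y - x)"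
    if xy: "x \<in> E" "y \<in> E" and \<rho>: "norm (x - a) \<le> \<rho>" "norm (y - a) \<le> \<rho>" "\<rho> \<le> r" for x y \<rho>
  proof -
    have \<rho>0: "\<rho> \<ge> 0" using \<rho>(1) norm_ge_zero[of "x - a"] by linarith
    define T where "T = cball a \<rho> \<inter> E"
    have T: "convex T" "T \<subseteq> S" "T \<subseteq> E" "x \<in> T" "y \<in> T"
      using \<rho> xy unfolding T_def S_def
      by (auto intro!: convex_Int subspace_imp_convex[OF E] simp: dist_norm norm_minus_commute)
    have "norm ((f y - D a y) - (f x - D a x)) \<le> N * (N * K * N * \<rho>) * N * norm (y - x)"
    proof (rule lipschitz_on_convex_subspace[OF E T(1,3) _ P PK _ N _ T(5,4)])
      fix z assume z: "z \<in> T"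
      have "(f has_derivative D z) (at z within T)"
        using D[of z] z T(2) S(4) by (intro has_derivative_subset[of f "D z" z U T]) auto
      moreover have "(D a has_derivative D a) (at z within T)"
        using Dlin[OF S(5)] linear_conv_bounded_linear bounded_linear_imp_has_derivative by blast
      ultimately show "((\<lambda>z. f z - D a z) has_derivative (\<lambda>v. D z v - D a v)) (at z within T)"
        by (rule has_derivative_diff)
      fix v assume v: "v \<in> E"
      have "norm (z - a) \<le> \<rho>" using z by (auto simp: T_def dist_norm norm_minus_commute)
      then have "N * (N * K * N * norm (z - a)) * norm v \<le> N * (N * K * N * \<rho>) * norm v"
        using N K by (intro mult_right_mono mult_left_mono) auto
      then show "norm (D z v - D a v) \<le> N * (N * K * N * \<rho>) * norm v"
        using Dlip'[OF v, of z] z T(2) by (meson order_trans subsetD)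
    qed (use N K \<rho>0 in auto)
    also have "\<dots> = (N * (N * K * N) * N) * (\<rho> * norm (y - x))" by (simp add: mult_ac)
    also have "\<dots> \<le> C * (\<rho> * norm (y - x))" using \<rho>0 by (intro mult_right_mono) (auto simp: C_def)
    finally show ?thesis by (simp add: linear_diff[OF Dlin[OF S(5)]] algebra_simps)
  qed
  show thesis
    by (rule that[OF C r(1) Dlin[OF S(5)] D[OF U(2)] r(2)]) (use est in blast)
qed

section \<open>Charts of a Lie group\<close>

definition chart_inv :: "('a, 'e) chart \<Rightarrow> 'e \<Rightarrow> 'a" where
  "chart_inv c = inv_into (fst c) (snd c)"

definition chart_rep :: "('a \<Rightarrow> 'b) \<Rightarrow> ('a, 'e) chart \<Rightarrow> ('b, 'f) chart \<Rightarrow> 'e \<Rightarrow> 'f" where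
  "chart_rep f c d = snd d \<circ> f \<circ> chart_inv c"

abbreviation chart_range :: "('a, 'e) chart \<Rightarrow> 'e set" where
  "chart_range c \<equiv> snd c ` fst c"

lemma chart_derivative_alt:
  "chart_derivative p f c d = frechet_derivative (chart_rep f c d) (at (snd c p) within chart_range c)"
  by (simp add: chart_derivative_def chart_rep_def chart_inv_def)

context smooth_manifold begin

lemma atlas_subset: "c \<in> atlas M \<Longrightarrow> fst c \<subseteq> topspace (mtop M)"
  using chart_domain[of "fst c" "snd c"] openin_subset by auto

lemma chart_homeo': "c \<in> atlas M \<Longrightarrow>
    homeomorphic_map (subtopology (mtop M) (fst c)) (top_of_set (chart_range c)) (snd c)"
  using chart_homeo[of "fst c" "snd c"] by simp

lemma chart_inj:
  assumes c: "c \<in> atlas M"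
  shows "inj_on (snd c) (fst c)"
proof -
  have "topspace (subtopology (mtop M) (fst c)) = fst c"
    using atlas_subset[OF c] by (rule topspace_subtopology_subset)
  then show ?thesis using homeomorphic_imp_injective_map[OF chart_homeo'[OF c]] by (simp only:)
qed

lemma chart_inv_left: "c \<in> atlas M \<Longrightarrow> p \<in> fst c \<Longrightarrow> chart_inv c (snd c p) = p"
  unfolding chart_inv_def by (rule inv_into_f_f[OF chart_inj])

lemma chart_inv_mem: "x \<in> chart_range c \<Longrightarrow> chart_inv c x \<in> fst c"
  unfolding chart_inv_def by (rule inv_into_into)

lemma chart_inv_right: "x \<in> chart_range c \<Longrightarrow> snd c (chart_inv c x) = x"
  unfolding chart_inv_def by (rule f_inv_into_f)

lemma chart_range_openin: "c \<in> atlas M \<Longrightarrow> openin (top_of_set (model M)) (chart_range c)"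
  using chart_image[of "fst c" "snd c"] by simp

lemma chart_range_subset: "c \<in> atlas M \<Longrightarrow> chart_range c \<subseteq> model M"
  using chart_range_openin openin_imp_subset by blast

lemma chart_image_openin:
  assumes c: "c \<in> atlas M" and W: "openin (mtop M) W"
  shows "openin (top_of_set (model M)) (snd c ` (fst c \<inter> W))"
proof -
  have "openin (subtopology (mtop M) (fst c)) (fst c \<inter> W)"
    using W by (simp add: openin_subtopology_Int2)
  then have "openin (top_of_set (chart_range c)) (snd c ` (fst c \<inter> W))"
    using homeomorphic_imp_open_map[OF chart_homeo'[OF c]] unfolding open_map_def by blast
  then show ?thesis using chart_range_openin[OF c] openin_trans by blast
qed

lemma chart_inv_preimage:
  assumes c: "c \<in> atlas M"
  shows "{x \<in> chart_range c. chart_inv c x \<in> W} = snd c ` (fst c \<inter> W)"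
  by (auto simp: chart_inv_left[OF c])

lemma continuous_map_chart_inv:
  assumes c: "c \<in> atlas M"
  shows "continuous_map (top_of_set (chart_range c)) (mtop M) (chart_inv c)"
  unfolding continuous_map_def
proof (intro conjI allI impI)
  show "chart_inv c \<in> topspace (top_of_set (chart_range c)) \<rightarrow> topspace (mtop M)"
    using chart_inv_mem[of _ c] atlas_subset[OF c] by auto
  fix W assume W: "openin (mtop M) W"
  have "openin (top_of_set (model M)) {x \<in> chart_range c. chart_inv c x \<in> W}"
    unfolding chart_inv_preimage[OF c] by (rule chart_image_openin[OF c W])
  then show "openin (top_of_set (chart_range c)) {x \<in> topspace (top_of_set (chart_range c)). chart_inv c x \<in> W}"
    using openin_subset_trans[of "model M" _ "chart_range c"] chart_range_subset[OF c] by auto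
qed

lemma chart_preimage_openin:
  assumes c: "c \<in> atlas M" and W: "openin (top_of_set (model M)) W"
  shows "openin (mtop M) {p \<in> fst c. snd c p \<in> W}"
proof -
  have "continuous_map (subtopology (mtop M) (fst c)) (top_of_set (chart_range c)) (snd c)"
    by (rule homeomorphic_imp_continuous_map[OF chart_homeo'[OF c]])
  moreover have "openin (top_of_set (chart_range c)) (chart_range c \<inter> W)"
  proof -
    obtain V where "open V" "W = model M \<inter> V" using W by (auto simp: openin_open)
    then have "chart_range c \<inter> W = chart_range c \<inter> V" using chart_range_subset[OF c] by blast
    then show ?thesis using \<open>open V\<close> by (auto simp: openin_open)
  qed
  ultimately have "openin (subtopology (mtop M) (fst c))
    {p \<in> topspace (subtopology (mtop M) (fst c)). snd c p \<in> chart_range c \<inter> W}"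
    by (rule openin_continuous_map_preimage)
  also have "{p \<in> topspace (subtopology (mtop M) (fst c)). snd c p \<in> chart_range c \<inter> W} = {p \<in> fst c. snd c p \<in> W}"
    using atlas_subset[OF c] by auto
  finally show ?thesis
    by (rule openin_trans_full) (use chart_domain[of "fst c" "snd c"] c in simp)
qed

lemma charts_at_ex:
  assumes "p \<in> topspace (mtop M)" shows "\<exists>c. c \<in> charts_at M p"
proof -
  have "p \<in> (\<Union>(U, \<phi>)\<in>atlas M. U)" unfolding atlas_covers by (rule assms)
  then obtain c where "c \<in> atlas M" "p \<in> (case c of (U, \<phi>) \<Rightarrow> U)" by (rule UN_E)
  then have "c \<in> charts_at M p" by (cases c) (simp add: charts_at_def)
  then show ?thesis by blast
qed

lemma charts_atD: "c \<in> charts_at M p \<Longrightarrow> c \<in> atlas M \<and> p \<in> fst c \<and> snd c p \<in> chart_range c"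
  by (auto simp: charts_at_def)

text \<open>The coordinate form of \<open>f\<close> is meaningful only where \<open>f\<close> stays
  in the domain of \<open>d\<close>; continuity supplies such a relatively open
  \<open>T\<close>.\<close>

lemma chart_rep_nbhd:
  assumes f: "continuous_map (mtop M) (mtop M) f" and c: "c \<in> charts_at M p" and d: "d \<in> charts_at M (f p)"
  obtains T where "openin (top_of_set (model M)) T" "T \<subseteq> chart_range c" "snd c p \<in> T"
    "\<And>x. x \<in> T \<Longrightarrow> f (chart_inv c x) \<in> fst d" "\<And>x. x \<in> T \<Longrightarrow> chart_rep f c d x \<in> model M"
proof -
  note cA = charts_atD[OF c] and dA = charts_atD[OF d]
  define W where "W = {q \<in> topspace (mtop M). f q \<in> fst d}"
  have W: "openin (mtop M) W" unfolding W_def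
    using openin_continuous_map_preimage[OF f] chart_domain[of "fst d" "snd d"] dA by simp
  define T where "T = {x \<in> chart_range c. chart_inv c x \<in> W}"
  have T: "openin (top_of_set (model M)) T"
    unfolding T_def chart_inv_preimage[OF conjunct1[OF cA]] using cA by (intro chart_image_openin W) auto
  have fT: "f (chart_inv c x) \<in> fst d" if "x \<in> T" for x using that by (auto simp: T_def W_def)
  show thesis
  proof (rule that[OF T])
    show "T \<subseteq> chart_range c" by (auto simp: T_def)
    show "snd c p \<in> T" using cA dA atlas_subset[of c] by (auto simp: T_def W_def chart_inv_left)
    show "chart_rep f c d x \<in> model M" if "x \<in> T" for x
      using fT[OF that] chart_range_subset[of d] dA by (auto simp: chart_rep_def)
  qed (rule fT)
qed

lemma chart_derivative_works:
  "(chart_rep f c d has_derivative D) (at (snd c p) within chart_range c) \<Longrightarrow>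
   (chart_rep f c d has_derivative chart_derivative p f c d) (at (snd c p) within chart_range c)"
  unfolding chart_derivative_alt by (subst frechet_derivative_works[symmetric]) (auto simp: differentiable_def)

text \<open>\<open>frechet_derivative\<close> picks some derivative. On the model space all choices
  agree, as the chart range is relatively open in it.\<close>

lemma chart_derivative_eq:
  assumes c: "c \<in> charts_at M p" and D: "(chart_rep f c d has_derivative D) (at (snd c p) within chart_range c)"
    and v: "v \<in> model M"
  shows "chart_derivative p f c d v = D v"
  using charts_atD[OF c] chart_range_openin[of c]
  by (intro has_derivative_unique_on_subspace[OF subspace_model _ _ chart_derivative_works[OF D] D v]) auto

text \<open>The chain rule applies on a smaller set \<open>T\<close> where \<open>f1\<close> stays
  in the chart \<open>d\<close>; as \<open>T\<close> is relatively open, derivatives within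
  \<open>T\<close> and within the chart range coincide.\<close>

lemma chart_rep_has_derivative_comp:
  assumes f1: "continuous_map (mtop M) (mtop M) f1" and c: "c \<in> charts_at M p" and d: "d \<in> charts_at M (f1 p)"
    and D1: "(chart_rep f1 c d has_derivative D1) (at (snd c p) within chart_range c)"
    and D2: "(chart_rep f2 d e has_derivative D2) (at (snd d (f1 p)) within chart_range d)"
  shows "(chart_rep (f2 \<circ> f1) c e has_derivative (\<lambda>v. D2 (D1 v))) (at (snd c p) within chart_range c)"
proof -
  note cA = charts_atD[OF c] and dA = charts_atD[OF d]
  obtain T where T: "openin (top_of_set (model M)) T" "T \<subseteq> chart_range c" "snd c p \<in> T"
    "\<And>x. x \<in> T \<Longrightarrow> f1 (chart_inv c x) \<in> fst d" "\<And>x. x \<in> T \<Longrightarrow> chart_rep f1 c d x \<in> model M"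
    using chart_rep_nbhd[OF f1 c d] by blast
  have val: "chart_rep f1 c d (snd c p) = snd d (f1 p)" using cA by (simp add: chart_rep_def chart_inv_left)
  have img: "chart_rep f1 c d ` T \<subseteq> chart_range d" using T(4) by (auto simp: chart_rep_def)
  have D1': "(chart_rep f1 c d has_derivative D1) (at (snd c p) within T)"
    by (rule has_derivative_subset[OF D1 T(2)])
  have "((\<lambda>x. chart_rep f2 d e (chart_rep f1 c d x)) has_derivative (\<lambda>v. D2 (D1 v))) (at (snd c p) within T)"
    by (rule has_derivative_in_compose[OF D1' has_derivative_subset[OF _ img]]) (use D2 val in simp)
  then have "(chart_rep (f2 \<circ> f1) c e has_derivative (\<lambda>v. D2 (D1 v))) (at (snd c p) within T)"
    by (rule has_derivative_transform[rotated 2]) (use T(3,4) dA in \<open>auto simp: chart_rep_def chart_inv_left\<close>)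
  moreover have "openin (top_of_set (chart_range c)) T"
    using openin_subset_trans[OF T(1,2)] chart_range_subset cA by blast
  ultimately show ?thesis using has_derivative_openin_cong[of "chart_range c" T "snd c p"] T(3) by simp
qed

lemma smooth_on_has_derivative:
  assumes "smooth_on E U f" "x \<in> U"
  shows "\<exists>D. (f has_derivative D) (at x within U)"
proof -
  have "Ck_on (Suc 0) E U f" using assms(1) by (simp add: smooth_on_def del: Ck_on.simps)
  then obtain f' where "\<forall>x\<in>U. (f has_derivative f' x) (at x within U)" by auto
  then show ?thesis using assms(2) by blast
qed

lemma chart_rep_id_has_derivative:
  assumes c: "c \<in> charts_at M p" and d: "d \<in> charts_at M p"
  shows "\<exists>D. (chart_rep id c d has_derivative D) (at (snd c p) within chart_range c)"
proof -
  note cA = charts_atD[OF c] and dA = charts_atD[OF d]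
  let ?T = "snd c ` (fst c \<inter> fst d)"
  have T: "openin (top_of_set (model M)) ?T"
    using chart_image_openin[of c "fst d"] chart_domain[of "fst d" "snd d"] cA dA by simp
  have "smooth_on (model M) ?T (chart_rep id c d)"
    using chart_compatible[of "fst c" "snd c" "fst d" "snd d"] cA dA by (simp add: chart_rep_def chart_inv_def)
  then obtain D where "(chart_rep id c d has_derivative D) (at (snd c p) within ?T)"
    using smooth_on_has_derivative[of "model M" ?T] cA dA by blast
  moreover have "openin (top_of_set (chart_range c)) ?T"
    using openin_subset_trans[OF T, of "chart_range c"] chart_range_subset cA by blast
  ultimately show ?thesis
    using has_derivative_openin_cong[of "chart_range c" ?T "snd c p"] cA dA by auto
qed

lemma chart_derivative_closed:
  assumes f: "continuous_map (mtop M) (mtop M) f" and c: "c \<in> charts_at M p" and d: "d \<in> charts_at M (f p)"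
    and D: "(chart_rep f c d has_derivative D) (at (snd c p) within chart_range c)" and v: "v \<in> model M"
  shows "D v \<in> model M"
proof -
  obtain T where T: "openin (top_of_set (model M)) T" "T \<subseteq> chart_range c" "snd c p \<in> T"
    "\<And>x. x \<in> T \<Longrightarrow> f (chart_inv c x) \<in> fst d" "\<And>x. x \<in> T \<Longrightarrow> chart_rep f c d x \<in> model M"
    using chart_rep_nbhd[OF f c d] by blast
  show ?thesis
    by (rule has_derivative_maps_to_subspace[OF subspace_model subspace_model T(1,3)
          has_derivative_subset[OF D T(2)] T(5) v])
qed

end

section \<open>Multiplication and conjugation in charts\<close>

context lie_group begin

lemma continuous_mult: "continuous_map (prod_topology (mtop M) (mtop M)) (mtop M) (\<lambda>(x, y). x \<otimes> y)"
  using smooth_mult by (simp add: smooth_map_def prod_manifold_def)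

lemma continuous_map_mult:
  "continuous_map X (mtop M) f \<Longrightarrow> continuous_map X (mtop M) g \<Longrightarrow> continuous_map X (mtop M) (\<lambda>x. f x \<otimes> g x)"
  using continuous_map_compose[OF continuous_map_pairedI continuous_mult, of X f g] by (simp add: o_def)

lemma continuous_const: "g \<in> carrier G \<Longrightarrow> continuous_map X (mtop M) (\<lambda>_. g)"
  by (simp add: topspace_carrier)

lemma continuous_conj:
  "g \<in> carrier G \<Longrightarrow> continuous_map (mtop M) (mtop M) (\<lambda>x. g \<otimes> x \<otimes> inv g)"
  by (intro continuous_map_mult continuous_const) auto

lemma mult_chart_smooth:
  assumes c: "c \<in> charts_at M p" and d: "d \<in> charts_at M q" and e: "e \<in> charts_at M (p \<otimes> q)"
  obtains W where "openin (top_of_set (model M \<times> model M)) W" "(snd c p, snd d q) \<in> W"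
    "W \<subseteq> chart_range c \<times> chart_range d"
    "\<forall>z\<in>W. chart_inv c (fst z) \<otimes> chart_inv d (snd z) \<in> fst e"
    "\<forall>n. Ck_on n (model M \<times> model M) W (\<lambda>z. snd e (chart_inv c (fst z) \<otimes> chart_inv d (snd z)))"
proof -
  note cA = charts_atD[OF c] and dA = charts_atD[OF d] and eA = charts_atD[OF e]
  let ?mu = "\<lambda>z. chart_inv c (fst z) \<otimes> chart_inv d (snd z)"
  \<comment> \<open>\<open>W\<close> is the set on which \<open>smooth_map\<close> gives smoothness
    for the product chart; the inverse of that chart is then split into the two chart
    inverses.\<close>
  define W where "W = map_prod (snd c) (snd d) ` ((fst c \<times> fst d) \<inter> (\<lambda>(x, y). x \<otimes> y) -` fst e)"
  have inv: "inv_into (fst c \<times> fst d) (map_prod (snd c) (snd d)) z = (chart_inv c (fst z), chart_inv d (snd z))"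
    if "z \<in> chart_range c \<times> chart_range d" for z
  proof -
    have inj: "inj_on (map_prod (snd c) (snd d)) (fst c \<times> fst d)"
      using chart_inj cA dA by (intro map_prod_inj_on) auto
    have "fst z \<in> chart_range c" "snd z \<in> chart_range d" using that by (auto simp: mem_Times_iff)
    then obtain x y where x: "x \<in> fst c" "fst z = snd c x" and y: "y \<in> fst d" "snd z = snd d y"
      by (elim imageE)
    have xy: "x \<in> fst c" "y \<in> fst d" "z = map_prod (snd c) (snd d) (x, y)"
      using x y by (simp_all add: prod_eq_iff)
    show ?thesis using xy inv_into_f_f[OF inj, of "(x, y)"] cA dA by (simp add: chart_inv_left)
  qed
  have W: "W = {z \<in> chart_range c \<times> chart_range d. ?mu z \<in> fst e}"
  proof (rule Set.set_eqI, rule iffI)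
    fix z assume "z \<in> W"
    then obtain x y where "x \<in> fst c" "y \<in> fst d" "x \<otimes> y \<in> fst e" "z = (snd c x, snd d y)" by (auto simp: W_def)
    then show "z \<in> {z \<in> chart_range c \<times> chart_range d. ?mu z \<in> fst e}"
      using cA dA by (simp add: chart_inv_left)
  next
    fix z assume z: "z \<in> {z \<in> chart_range c \<times> chart_range d. ?mu z \<in> fst e}"
    then show "z \<in> W" unfolding W_def
      by (intro image_eqI[of _ _ "(chart_inv c (fst z), chart_inv d (snd z))"])
        (auto simp: chart_inv_right chart_inv_mem)
  qed
  have cont: "continuous_map (top_of_set (chart_range c \<times> chart_range d)) (mtop M) ?mu"
  proof (rule continuous_map_mult)
    have 1: "continuous_map (top_of_set (chart_range c \<times> chart_range d)) (top_of_set (chart_range c)) fst"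
      "continuous_map (top_of_set (chart_range c \<times> chart_range d)) (top_of_set (chart_range d)) snd"
      by (auto simp: continuous_map_in_subtopology intro!: continuous_intros)
    show "continuous_map (top_of_set (chart_range c \<times> chart_range d)) (mtop M) (\<lambda>z. chart_inv c (fst z))"
      using continuous_map_compose[OF 1(1) continuous_map_chart_inv] cA by (simp add: o_def)
    show "continuous_map (top_of_set (chart_range c \<times> chart_range d)) (mtop M) (\<lambda>z. chart_inv d (snd z))"
      using continuous_map_compose[OF 1(2) continuous_map_chart_inv] dA by (simp add: o_def)
  qed
  have "openin (top_of_set (chart_range c \<times> chart_range d)) W"
    using openin_continuous_map_preimage[OF cont, of "fst e"] chart_domain[of "fst e" "snd e"] eA
    unfolding W by simp
  moreover have "openin (top_of_set (model M \<times> model M)) (chart_range c \<times> chart_range d)"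
    using chart_range_openin cA dA by (intro openin_Times) auto
  ultimately have Wo: "openin (top_of_set (model M \<times> model M)) W" by (rule openin_trans)
  let ?f = "snd e \<circ> (\<lambda>(x, y). x \<otimes> y) \<circ> inv_into (fst c \<times> fst d) (map_prod (snd c) (snd d))"
  have at: "(fst c, snd c) \<in> atlas M" "(fst d, snd d) \<in> atlas M" "(fst e, snd e) \<in> atlas M"
    using cA dA eA by simp_all
  then have "(fst c \<times> fst d, map_prod (snd c) (snd d)) \<in> atlas (prod_manifold M M)"
    unfolding prod_manifold_def by (simp, blast)
  moreover have "\<forall>(U, \<phi>)\<in>atlas (prod_manifold M M). \<forall>(V, \<psi>)\<in>atlas M.
      smooth_on (model (prod_manifold M M)) (\<phi> ` (U \<inter> (\<lambda>(x, y). x \<otimes> y) -` V)) (\<psi> \<circ> (\<lambda>(x, y). x \<otimes> y) \<circ> inv_into U \<phi>)"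
    using smooth_mult unfolding smooth_map_def by (rule conjunct2)
  ultimately have "smooth_on (model (prod_manifold M M)) W ?f"
    unfolding W_def using at(3) by (elim ballE[of _ _ "(fst c \<times> fst d, map_prod (snd c) (snd d))"]) (auto elim!: ballE)
  then have "smooth_on (model M \<times> model M) W ?f" by (simp add: prod_manifold_def)
  then have "Ck_on n (model M \<times> model M) W ?f" for n by (simp add: smooth_on_def)
  then have "Ck_on n (model M \<times> model M) W (\<lambda>z. snd e (?mu z))" for n
    by (rule Ck_on_cong) (use inv W in auto)
  then have Ck: "\<forall>n. Ck_on n (model M \<times> model M) W (\<lambda>z. snd e (?mu z))" by blast
  show thesis
    by (rule that[OF Wo _ _ _ Ck]) (use cA dA eA in \<open>auto simp: W chart_inv_left\<close>)
qed

lemma mult_chart_has_derivative: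
  assumes c: "c \<in> charts_at M p" and d: "d \<in> charts_at M q" and e: "e \<in> charts_at M (p \<otimes> q)"
  shows "\<exists>D. ((\<lambda>z. snd e (chart_inv c (fst z) \<otimes> chart_inv d (snd z))) has_derivative D)
    (at (snd c p, snd d q) within chart_range c \<times> chart_range d)"
proof -
  note cA = charts_atD[OF c] and dA = charts_atD[OF d]
  obtain W where W: "openin (top_of_set (model M \<times> model M)) W" "(snd c p, snd d q) \<in> W"
    "W \<subseteq> chart_range c \<times> chart_range d"
    "\<forall>z\<in>W. chart_inv c (fst z) \<otimes> chart_inv d (snd z) \<in> fst e"
    "\<forall>n. Ck_on n (model M \<times> model M) W (\<lambda>z. snd e (chart_inv c (fst z) \<otimes> chart_inv d (snd z)))"
    by (rule mult_chart_smooth[OF c d e])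
  obtain D where "((\<lambda>z. snd e (chart_inv c (fst z) \<otimes> chart_inv d (snd z))) has_derivative D)
    (at (snd c p, snd d q) within W)"
    using W(2) W(5)[rule_format, of "Suc 0"] by auto
  moreover have "openin (top_of_set (chart_range c \<times> chart_range d)) W"
    using chart_range_subset cA dA by (intro openin_subset_trans[OF W(1,3)] Sigma_mono) auto
  ultimately show ?thesis using has_derivative_openin_cong[of "chart_range c \<times> chart_range d" W "(snd c p, snd d q)"] W(2)
    by auto
qed

text \<open>Left translation is multiplication restricted to the slice with first coordinate
  \<open>snd b a\<close>, for a chart \<open>b\<close> at \<open>a\<close>.\<close>

lemma left_mult_has_derivative:
  assumes a: "a \<in> carrier G" and c: "c \<in> charts_at M p" and e: "e \<in> charts_at M (a \<otimes> p)"
  shows "\<exists>D. (chart_rep (\<lambda>x. a \<otimes> x) c e has_derivative D) (at (snd c p) within chart_range c)"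
proof -
  obtain b where b: "b \<in> charts_at M a" using charts_at_ex[of a] a topspace_carrier by blast
  note bA = charts_atD[OF b]
  obtain D where D: "((\<lambda>z. snd e (chart_inv b (fst z) \<otimes> chart_inv c (snd z))) has_derivative D)
    (at (snd b a, snd c p) within chart_range b \<times> chart_range c)"
    using mult_chart_has_derivative[OF b c e] by blast
  let ?j = "\<lambda>x. (snd b a, x)" and ?g = "\<lambda>z. snd e (chart_inv b (fst z) \<otimes> chart_inv c (snd z))"
  have j: "(?j has_derivative (\<lambda>v. (0, v))) (at (snd c p) within chart_range c)"
    by (auto intro!: derivative_eq_intros)
  have "?j ` chart_range c \<subseteq> chart_range b \<times> chart_range c" using bA by auto
  then have "(?g has_derivative D) (at (?j (snd c p)) within ?j ` chart_range c)"
    by (rule has_derivative_subset[OF D])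
  from has_derivative_in_compose[where f = ?j and g = ?g, OF j this]
  have "((\<lambda>x. ?g (?j x)) has_derivative (\<lambda>v. D (0, v))) (at (snd c p) within chart_range c)" .
  then show ?thesis using bA by (auto simp: chart_rep_def chart_inv_left o_def)
qed

lemma right_mult_has_derivative:
  assumes a: "a \<in> carrier G" and c: "c \<in> charts_at M p" and e: "e \<in> charts_at M (p \<otimes> a)"
  shows "\<exists>D. (chart_rep (\<lambda>x. x \<otimes> a) c e has_derivative D) (at (snd c p) within chart_range c)"
proof -
  obtain b where b: "b \<in> charts_at M a" using charts_at_ex[of a] a topspace_carrier by blast
  note bA = charts_atD[OF b]
  obtain D where D: "((\<lambda>z. snd e (chart_inv c (fst z) \<otimes> chart_inv b (snd z))) has_derivative D)
    (at (snd c p, snd b a) within chart_range c \<times> chart_range b)"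
    using mult_chart_has_derivative[OF c b e] by blast
  let ?j = "\<lambda>x. (x, snd b a)" and ?g = "\<lambda>z. snd e (chart_inv c (fst z) \<otimes> chart_inv b (snd z))"
  have j: "(?j has_derivative (\<lambda>v. (v, 0))) (at (snd c p) within chart_range c)"
    by (auto intro!: derivative_eq_intros)
  have "?j ` chart_range c \<subseteq> chart_range c \<times> chart_range b" using bA by auto
  then have "(?g has_derivative D) (at (?j (snd c p)) within ?j ` chart_range c)"
    by (rule has_derivative_subset[OF D])
  from has_derivative_in_compose[where f = ?j and g = ?g, OF j this]
  have "((\<lambda>x. ?g (?j x)) has_derivative (\<lambda>v. D (v, 0))) (at (snd c p) within chart_range c)" .
  then show ?thesis using bA by (auto simp: chart_rep_def chart_inv_left o_def)
qed

abbreviation conj_by :: "'a \<Rightarrow> 'a \<Rightarrow> 'a" where "conj_by g \<equiv> (\<lambda>x. g \<otimes> x \<otimes> inv g)"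

text \<open>Conjugation is a left translation followed by a right one; the chain rule passes through
  a chart at \<open>g\<close>.\<close>

lemma conj_has_derivative:
  assumes g: "g \<in> carrier G" and c: "c \<in> charts_at M \<one>" and e: "e \<in> charts_at M \<one>"
  shows "\<exists>D. (chart_rep (conj_by g) c e has_derivative D) (at (snd c \<one>) within chart_range c)"
proof -
  obtain b where b: "b \<in> charts_at M g" using charts_at_ex[of g] g topspace_carrier by blast
  obtain D1 where D1: "(chart_rep (\<lambda>x. g \<otimes> x) c b has_derivative D1) (at (snd c \<one>) within chart_range c)"
    using left_mult_has_derivative[OF g c, of b] b g by auto
  obtain D2 where D2: "(chart_rep (\<lambda>x. x \<otimes> inv g) b e has_derivative D2) (at (snd b g) within chart_range b)"
    using right_mult_has_derivative[OF inv_closed[OF g] b, of e] e g by auto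
  have "continuous_map (mtop M) (mtop M) (\<lambda>x. g \<otimes> x)"
    by (intro continuous_map_mult continuous_const g) simp
  from chart_rep_has_derivative_comp[OF this c _ D1, of "\<lambda>x. x \<otimes> inv g" e D2] b g D2
  show ?thesis by (auto simp: o_def)
qed

end

section \<open>The adjoint representation in a chart\<close>

lemma vector_space_tangent: "vector_space (\<lambda>r X c. r *\<^sub>R (X c :: 'e::real_vector))"
  by unfold_locales (auto simp: fun_eq_iff scaleR_add_right scaleR_add_left)

text \<open>\<open>f\<close> is a linear injection between the two vector space structures, so
  dimensions of families of coordinates can be computed in the model space.\<close>

lemma tangent_dim_image:
  fixes f :: "'e::euclidean_space \<Rightarrow> (('a, 'e) chart \<Rightarrow> 'e)"
  assumes add: "\<And>x y. f (x + y) = f x + f y" and scale: "\<And>r x. f (r *\<^sub>R x) = (\<lambda>c. r *\<^sub>R f x c)"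
    and inj: "inj_on f S" and S: "subspace S"
  shows "tangent_dim (f ` S) = dim S"
proof -
  interpret V: vector_space "\<lambda>r X c. r *\<^sub>R (X c :: 'e)" by (rule vector_space_tangent)
  interpret P: finite_dimensional_vector_space_pair_1 "scaleR :: real \<Rightarrow> 'e \<Rightarrow> 'e" Basis "\<lambda>r (X :: ('a, 'e) chart \<Rightarrow> 'e) c. r *\<^sub>R (X c)"
    by unfold_locales
  have "Vector_Spaces.linear scaleR (\<lambda>r (X :: ('a, 'e) chart \<Rightarrow> 'e) c. r *\<^sub>R (X c)) f"
    by unfold_locales (auto simp: add scale)
  then have "V.dim (f ` S) = dim S"
    using P.dim_image_eq[of f S] inj S
    by (simp add: span_eq_iff[THEN iffD2] flip: span_raw_def dim_raw_def)
  then show ?thesis by (simp add: tangent_dim_def)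
qed

context lie_group begin

text \<open>Inverse to reading off the coordinate in \<open>c\<close>: the coordinate changes extend
  \<open>v\<close> to a family over all charts around \<open>\<one>\<close>.\<close>

definition tan_of :: "('a, 'e) chart \<Rightarrow> 'e \<Rightarrow> (('a, 'e) chart \<Rightarrow> 'e)" where
  "tan_of c v = (\<lambda>d. if d \<in> charts_at M \<one> then chart_derivative \<one> id c d v else 0)"

definition Ad_rep :: "('a, 'e) chart \<Rightarrow> 'a \<Rightarrow> 'e \<Rightarrow> 'e" where
  "Ad_rep c g = chart_derivative \<one> (conj_by g) c c"

lemma chart_rep_id_derivative:
  assumes "c \<in> charts_at M \<one>" "d \<in> charts_at M \<one>"
  shows "(chart_rep id c d has_derivative chart_derivative \<one> id c d) (at (snd c \<one>) within chart_range c)"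
proof -
  obtain D where "(chart_rep id c d has_derivative D) (at (snd c \<one>) within chart_range c)"
    using chart_rep_id_has_derivative[OF assms] by (elim exE)
  then show ?thesis by (rule chart_derivative_works)
qed

lemma chart_rep_conj_derivative:
  assumes "g \<in> carrier G" "c \<in> charts_at M \<one>" "d \<in> charts_at M \<one>"
  shows "(chart_rep (conj_by g) c d has_derivative chart_derivative \<one> (conj_by g) c d)
    (at (snd c \<one>) within chart_range c)"
proof -
  obtain D where "(chart_rep (conj_by g) c d has_derivative D) (at (snd c \<one>) within chart_range c)"
    using conj_has_derivative[OF assms] by (elim exE)
  then show ?thesis by (rule chart_derivative_works)
qed

lemma chart_derivative_comp:
  assumes f1: "continuous_map (mtop M) (mtop M) f1" "f1 \<one> = \<one>" and c: "c \<in> charts_at M \<one>" and d: "d \<in> charts_at M \<one>"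
    and D1: "(chart_rep f1 c d has_derivative D1) (at (snd c \<one>) within chart_range c)"
    and D2: "(chart_rep f2 d e has_derivative D2) (at (snd d \<one>) within chart_range d)"
    and v: "v \<in> model M"
  shows "chart_derivative \<one> (f2 \<circ> f1) c e v = D2 (D1 v)"
  by (rule chart_derivative_eq[OF c chart_rep_has_derivative_comp[OF f1(1) c _ D1] v])
    (use d f1(2) D2 in simp_all)

lemma conj_one: "g \<in> carrier G \<Longrightarrow> conj_by g \<one> = \<one>"
  by simp

lemma chart_derivative_id_closed:
  assumes c: "c \<in> charts_at M \<one>" and d: "d \<in> charts_at M \<one>" and v: "v \<in> model M"
  shows "chart_derivative \<one> id c d v \<in> model M"
  using chart_derivative_closed[OF continuous_map_id c _ chart_rep_id_derivative[OF c d] v] d by simp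

lemma chart_derivative_conj_closed:
  assumes g: "g \<in> carrier G" and c: "c \<in> charts_at M \<one>" and d: "d \<in> charts_at M \<one>" and v: "v \<in> model M"
  shows "chart_derivative \<one> (conj_by g) c d v \<in> model M"
  using chart_derivative_closed[OF continuous_conj[OF g] c _ chart_rep_conj_derivative[OF g c d] v] d g by simp

lemma chart_derivative_id_id:
  assumes c: "c \<in> charts_at M \<one>" "d \<in> charts_at M \<one>" "e \<in> charts_at M \<one>" and v: "v \<in> model M"
  shows "chart_derivative \<one> id d e (chart_derivative \<one> id c d v) = chart_derivative \<one> id c e v"
  using chart_derivative_comp[OF continuous_map_id _ c(1,2) chart_rep_id_derivative[OF c(1,2)] chart_rep_id_derivative[OF c(2,3)] v]
  by simp

lemma chart_derivative_conj_id:
  assumes g: "g \<in> carrier G" and c: "c \<in> charts_at M \<one>" "d \<in> charts_at M \<one>" "e \<in> charts_at M \<one>" and v: "v \<in> model M"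
  shows "chart_derivative \<one> (conj_by g) d e (chart_derivative \<one> id c d v) = chart_derivative \<one> (conj_by g) c e v"
  using chart_derivative_comp[OF continuous_map_id _ c(1,2) chart_rep_id_derivative[OF c(1,2)] chart_rep_conj_derivative[OF g c(2,3)] v]
  by simp

lemma chart_derivative_id_conj:
  assumes g: "g \<in> carrier G" and c: "c \<in> charts_at M \<one>" "d \<in> charts_at M \<one>" "e \<in> charts_at M \<one>" and v: "v \<in> model M"
  shows "chart_derivative \<one> id d e (chart_derivative \<one> (conj_by g) c d v) = chart_derivative \<one> (conj_by g) c e v"
  using chart_derivative_comp[OF continuous_conj[OF g] conj_one[OF g] c(1,2) chart_rep_conj_derivative[OF g c(1,2)] chart_rep_id_derivative[OF c(2,3)] v]
  by simp

lemma chart_derivative_id_same: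
  assumes c: "c \<in> charts_at M \<one>" and v: "v \<in> model M"
  shows "chart_derivative \<one> id c c v = v"
proof (rule chart_derivative_eq[OF c _ v])
  have "((\<lambda>x. x) has_derivative (\<lambda>x. x)) (at (snd c \<one>) within chart_range c)" by (rule has_derivative_ident)
  then show "(chart_rep id c c has_derivative (\<lambda>x. x)) (at (snd c \<one>) within chart_range c)"
    by (rule has_derivative_transform[rotated 2])
      (use charts_atD[OF c] in \<open>auto simp: chart_rep_def chart_inv_left\<close>)
qed

lemma tan_of_linear:
  assumes c: "c \<in> charts_at M \<one>"
  shows "tan_of c (v + w) = tan_of c v + tan_of c w" "tan_of c (r *\<^sub>R v) = (\<lambda>d. r *\<^sub>R tan_of c v d)"
    "tan_of c (v - w) = tan_of c v - tan_of c w"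
proof -
  have lin: "linear (chart_derivative \<one> id c d)" if "d \<in> charts_at M \<one>" for d
    using chart_rep_id_derivative[OF c that] has_derivative_linear by blast
  show "tan_of c (v + w) = tan_of c v + tan_of c w" "tan_of c (r *\<^sub>R v) = (\<lambda>d. r *\<^sub>R tan_of c v d)"
    "tan_of c (v - w) = tan_of c v - tan_of c w"
    by (auto simp: tan_of_def fun_eq_iff linear_add[OF lin] linear_scale[OF lin] linear_diff[OF lin])
qed

lemma tan_of_same: "c \<in> charts_at M \<one> \<Longrightarrow> v \<in> model M \<Longrightarrow> tan_of c v c = v"
  by (simp add: tan_of_def chart_derivative_id_same)

text \<open>A tangent vector is determined by its coordinate in the single chart \<open>c\<close>;
  conversely, the chain rule makes the extended family compatible.\<close>

lemma lie_algebra_eq: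
  assumes c: "c \<in> charts_at M \<one>"
  shows "lie_algebra G M = tan_of c ` model M"
proof (intro subset_antisym subsetI)
  fix X assume "X \<in> lie_algebra G M"
  then have "(\<forall>d. d \<notin> charts_at M \<one> \<longrightarrow> X d = 0) \<and> (\<forall>d\<in>charts_at M \<one>. X d \<in> model M) \<and>
      (\<forall>b\<in>charts_at M \<one>. \<forall>d\<in>charts_at M \<one>. X d = chart_derivative \<one> id b d (X b))"
    unfolding lie_algebra_def tangent_space_def by (rule CollectD)
  then have X: "\<And>d. d \<notin> charts_at M \<one> \<Longrightarrow> X d = 0" "\<And>d. d \<in> charts_at M \<one> \<Longrightarrow> X d \<in> model M"
    "\<And>d. d \<in> charts_at M \<one> \<Longrightarrow> X d = chart_derivative \<one> id c d (X c)"
    using c by blast+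
  have "X = tan_of c (X c)"
  proof
    fix d show "X d = tan_of c (X c) d" by (cases "d \<in> charts_at M \<one>") (simp_all add: tan_of_def X(1) flip: X(3))
  qed
  then show "X \<in> tan_of c ` model M" using X(2)[OF c] by blast
next
  fix X assume "X \<in> tan_of c ` model M"
  then obtain v where v: "v \<in> model M" "X = tan_of c v" by blast
  show "X \<in> lie_algebra G M"
    unfolding lie_algebra_def tangent_space_def v(2) using v(1) c
    by (auto simp: tan_of_def chart_derivative_id_closed chart_derivative_id_id)
qed

text \<open>By the chain rule every chart yields the same value, so the definite description in
  \<open>differential\<close> denotes it.\<close>

lemma Ad_tan_of:
  assumes g: "g \<in> carrier G" and c: "c \<in> charts_at M \<one>" and v: "v \<in> model M"
  shows "Ad G M g (tan_of c v) = tan_of c (Ad_rep c g v)"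
proof
  fix d
  show "Ad G M g (tan_of c v) d = tan_of c (Ad_rep c g v) d"
  proof (cases "d \<in> charts_at M \<one>")
    case True
    have val: "chart_derivative \<one> (conj_by g) b d (tan_of c v b) = chart_derivative \<one> (conj_by g) c d v"
      if "b \<in> charts_at M \<one>" for b
      using chart_derivative_conj_id[OF g c that True v] that by (simp add: tan_of_def)
    have "Ad G M g (tan_of c v) d = (THE w. \<forall>b\<in>charts_at M \<one>. w = chart_derivative \<one> (conj_by g) b d (tan_of c v b))"
      unfolding Ad_def differential_def using True g by simp
    also have "\<dots> = chart_derivative \<one> (conj_by g) c d v"
    proof (rule the_equality)
      show "\<forall>b\<in>charts_at M \<one>. chart_derivative \<one> (conj_by g) c d v = chart_derivative \<one> (conj_by g) b d (tan_of c v b)"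
        by (intro ballI val[symmetric])
      fix w assume "\<forall>b\<in>charts_at M \<one>. w = chart_derivative \<one> (conj_by g) b d (tan_of c v b)"
      then have "w = chart_derivative \<one> (conj_by g) c d (tan_of c v c)" using c by (rule bspec)
      then show "w = chart_derivative \<one> (conj_by g) c d v" by (simp only: val[OF c])
    qed
    also have "\<dots> = tan_of c (Ad_rep c g v) d"
      using chart_derivative_id_conj[OF g c c True v] True by (simp add: tan_of_def Ad_rep_def)
    finally show ?thesis .
  next
    case False
    then show ?thesis using g by (simp add: Ad_def differential_def tan_of_def)
  qed
qed

lemma Ad_rep_closed: "g \<in> carrier G \<Longrightarrow> c \<in> charts_at M \<one> \<Longrightarrow> v \<in> model M \<Longrightarrow> Ad_rep c g v \<in> model M"
  unfolding Ad_rep_def by (rule chart_derivative_conj_closed)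

lemma nilspace_Ad:
  assumes g: "g \<in> carrier G" and c: "c \<in> charts_at M \<one>"
  shows "nilspace (lie_algebra G M) (\<lambda>X. Ad G M g X - X) = tan_of c ` nilspace (model M) (\<lambda>v. Ad_rep c g v - v)"
proof -
  let ?L = "\<lambda>X. Ad G M g X - X" and ?l = "\<lambda>v. Ad_rep c g v - v"
  have cl: "?l v \<in> model M" if "v \<in> model M" for v
    using Ad_rep_closed[OF g c that] that subspace_diff[OF subspace_model] by blast
  have pow: "(?L ^^ n) (tan_of c v) = tan_of c ((?l ^^ n) v)" if v: "v \<in> model M" for n v
  proof (induction n)
    case (Suc n)
    have "(?l ^^ n) v \<in> model M" by (rule funpow_closed[of "model M" ?l, OF cl v])
    then show ?case using Suc Ad_tan_of[OF g c] by (simp add: tan_of_linear[OF c])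
  qed simp
  have "tan_of c 0 = 0" using tan_of_linear(3)[OF c, of 0 0] by simp
  then have zero: "tan_of c v = 0 \<longleftrightarrow> v = 0" if "v \<in> model M" for v
    using tan_of_same[OF c that] by (metis zero_fun_apply)
  have "(?L ^^ n) (tan_of c v) = 0 \<longleftrightarrow> (?l ^^ n) v = 0" if v: "v \<in> model M" for n v
    unfolding pow[OF v] by (rule zero[OF funpow_closed[of "model M" ?l, OF cl v]])
  then show ?thesis unfolding nilspace_def lie_algebra_eq[OF c] by auto
qed

lemma tangent_dim_nilspace_Ad:
  assumes g: "g \<in> carrier G" and c: "c \<in> charts_at M \<one>"
  shows "tangent_dim (nilspace (lie_algebra G M) (\<lambda>X. Ad G M g X - X)) = dim (nilspace (model M) (\<lambda>v. Ad_rep c g v - v))"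
proof -
  let ?l = "\<lambda>v. Ad_rep c g v - v"
  have lin: "linear ?l"
    unfolding Ad_rep_def using has_derivative_linear[OF chart_rep_conj_derivative[OF g c c]]
    by (rule linear_compose_sub[OF _ linear_ident])
  have cl: "?l v \<in> model M" if "v \<in> model M" for v
    using Ad_rep_closed[OF g c that] that subspace_diff[OF subspace_model] by blast
  have eq: "nilspace (model M) ?l = {x \<in> model M. (?l ^^ DIM('e)) x = 0}"
    by (rule nilspace_eq_kernel[OF subspace_model lin cl])
  have sub: "subspace (nilspace (model M) ?l)"
    unfolding eq by (rule subspace_kernel_on[OF subspace_model linear_funpow[OF lin]])
  have "inj_on (tan_of c) (model M)"
    by (rule inj_onI) (metis tan_of_same[OF c])
  then have "inj_on (tan_of c) (nilspace (model M) ?l)"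
    by (rule inj_on_subset) (auto simp: nilspace_def)
  then show ?thesis unfolding nilspace_Ad[OF g c]
    by (intro tangent_dim_image tan_of_linear[OF c] sub)
qed

end

section \<open>Regular powers\<close>

text \<open>A linear map that is o(u) on a subspace vanishes there. It serves to identify the
  derivative of the multiplication at the unit.\<close>

lemma linear_zero_of_quadratic_bound:
  fixes L :: "'v::real_normed_vector \<Rightarrow> 'w::real_normed_vector"
  assumes E: "subspace E" and L: "linear L" and d: "d > 0" and C: "C > 0"
    and small: "\<And>u. u \<in> E \<Longrightarrow> norm u < d \<Longrightarrow> norm (L u) \<le> C * norm u * norm u" and v: "v \<in> E"
  shows "L v = 0"
proof -
  have "norm (L v) \<le> e * norm v" if e: "e > 0" for e
  proof (rule linear_bound_of_small[OF E L _ _ v])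
    show "min d (e / C) > 0" using d C e by simp
    fix u assume u: "u \<in> E" "norm u < min d (e / C)"
    have "C * norm u \<le> e" using u(2) C by (simp add: field_simps)
    then have "C * norm u * norm u \<le> e * norm u" by (rule mult_right_mono) simp
    then show "norm (L u) \<le> e * norm u" using small[OF u(1)] u(2) by simp
  qed
  then have "norm (L v) \<le> 0 * norm v"
    by (intro le_limit_at_right_0[where f = "\<lambda>e. e * norm v"]) auto
  then show ?thesis by simp
qed

context lie_group begin

text \<open>The chart is translated so that \<open>\<one>\<close> has coordinate 0. The uniform
  estimate on \<open>m\<close> is then \<open>C2_strict_estimate\<close> for the multiplication,
  once its derivative at \<open>(a, a)\<close> is known to be addition.\<close>

lemma local_lie_coords_at_one:
  assumes c: "c \<in> charts_at M \<one>"
  shows "\<exists>R r C m cj. local_lie_coords G (model M) (\<lambda>v. chart_inv c (snd c \<one> + v)) R r C m cj (Ad_rep c)"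
proof -
  define E where "E = model M"
  define a where "a = snd c \<one>"
  define \<psi> where "\<psi> v = chart_inv c (a + v)" for v
  note cA = charts_atD[OF c]
  have cM: "c \<in> atlas M" using cA by simp
  have E: "subspace E" unfolding E_def by (rule subspace_model)
  have range_E: "x \<in> E" if "x \<in> chart_range c" for x
    using that chart_range_subset[OF cM] unfolding E_def by blast
  have aE: "a \<in> E" using range_E cA by (simp add: a_def)
  have shift: "a + v \<in> E \<longleftrightarrow> v \<in> E" for v
    using subspace_add[OF E aE, of v] subspace_diff[OF E _ aE, of "a + v"] by auto
  have carr: "x \<in> fst c \<Longrightarrow> x \<in> carrier G" for x using atlas_subset[OF cM] topspace_carrier by blast
  have inv_a: "chart_inv c a = \<one>" unfolding a_def using cA by (intro chart_inv_left) auto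
  obtain R where R: "R > 0" "ball a R \<inter> E \<subseteq> chart_range c"
    using chart_range_openin[OF cM] cA unfolding E_def a_def openin_contains_ball by blast
  have inr: "a + v \<in> chart_range c" if "v \<in> E" "norm v < R" for v
    using R(2) that shift[of v] by (auto simp: subset_iff dist_norm)
  have cc: "c \<in> charts_at M (\<one> \<otimes> \<one>)" using c by simp
  define f where "f z = snd c (chart_inv c (fst z) \<otimes> chart_inv c (snd z))" for z
  obtain W where W: "openin (top_of_set (E \<times> E)) W" "(a, a) \<in> W"
    "W \<subseteq> chart_range c \<times> chart_range c"
    "\<forall>z\<in>W. chart_inv c (fst z) \<otimes> chart_inv c (snd z) \<in> fst c"
    "\<forall>n. Ck_on n (E \<times> E) W f"
    unfolding E_def a_def f_def by (rule mult_chart_smooth[OF c c cc])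
  have EE: "subspace (E \<times> E)" by (intro subspace_Times E)
  obtain f' C1 r1 where C1: "C1 > 0" and r1: "r1 > 0" and f'0: "linear f'" "(f has_derivative f') (at (a, a) within W)"
    and rW: "cball (a, a) r1 \<inter> (E \<times> E) \<subseteq> W"
    and est0: "\<forall>x\<in>E\<times>E. \<forall>y\<in>E\<times>E. \<forall>\<rho>. norm (x - (a, a)) \<le> \<rho> \<longrightarrow> norm (y - (a, a)) \<le> \<rho> \<longrightarrow> \<rho> \<le> r1 \<longrightarrow>
      norm (f y - f x - f' (y - x)) \<le> C1 * \<rho> * norm (y - x)"
    by (rule C2_strict_estimate[OF EE W(1,2) W(5)[rule_format]])
  have f_unit: "f (a + u, a) = a + u" "f (a, a + u) = a + u" if "u \<in> E" "norm u < R" for u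
    using carr[OF chart_inv_mem[OF inr[OF that]]] chart_inv_right[OF inr[OF that]] by (auto simp: f_def inv_a)
  have f_aa: "f (a, a) = a" using f_unit(1)[of 0] subspace_0[OF E] R(1) by simp
  \<comment> \<open>Multiplication by \<open>\<one>\<close> is exact,
    \<open>f (a + u, a) = a + u\<close>, so the linear expression \<open>u - f' (u, 0)\<close> is of
    second order in \<open>u\<close>.\<close>
  have f'1: "u - f' (u, 0) = 0" if u: "u \<in> E" for u
  proof (rule linear_zero_of_quadratic_bound[OF E _ _ C1 _ u])
    show "linear (\<lambda>u. u - f' (u, 0))"
      by (rule linearI) (simp_all add: algebra_simps flip: linear_add[OF f'0(1)] linear_scale[OF f'0(1)])
    show "min R r1 > 0" using R r1 by simp
    fix u assume u: "u \<in> E" "norm u < min R r1"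
    have "norm (f (a + u, a) - f (a, a) - f' ((a + u, a) - (a, a))) \<le> C1 * norm u * norm ((a + u, a) - (a, a))"
      using u aE shift[of u] r1
      by (intro est0[rule_format]) (auto simp: norm_Pair)
    then show "norm (u - f' (u, 0)) \<le> C1 * norm u * norm u"
      using u by (simp add: f_unit f_aa norm_Pair)
  qed
  have f'2: "u - f' (0, u) = 0" if u: "u \<in> E" for u
  proof (rule linear_zero_of_quadratic_bound[OF E _ _ C1 _ u])
    show "linear (\<lambda>u. u - f' (0, u))"
      by (rule linearI) (simp_all add: algebra_simps flip: linear_add[OF f'0(1)] linear_scale[OF f'0(1)])
    show "min R r1 > 0" using R r1 by simp
    fix u assume u: "u \<in> E" "norm u < min R r1"
    have "norm (f (a, a + u) - f (a, a) - f' ((a, a + u) - (a, a))) \<le> C1 * norm u * norm ((a, a + u) - (a, a))"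
      using u aE shift[of u] r1
      by (intro est0[rule_format]) (auto simp: norm_Pair)
    then show "norm (u - f' (0, u)) \<le> C1 * norm u * norm u"
      using u by (simp add: f_unit f_aa norm_Pair)
  qed
  have f'eq: "f' (u, v) = u + v" if "u \<in> E" "v \<in> E" for u v
    using f'1[OF that(1)] f'2[OF that(2)] linear_add[OF f'0(1), of "(u, 0)" "(0, v)"] by simp
  \<comment> \<open>A pair of vectors of norm at most \<open>\<rho>\<close> has norm at most
    \<open>2 * \<rho>\<close>; this explains the 2 here and \<open>r1 / 2\<close> in
    \<open>r\<close>. The entry \<open>R / (8 * (1 + C))\<close> keeps products below
    \<open>R\<close>.\<close>
  define C where "C = 2 * C1"
  have C: "C > 0" using C1 by (simp add: C_def)
  define r where "r = Min {1, r1 / 2, R / (8 * (1 + C)), R / 2}"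
  have r: "0 < r" "2 * r \<le> r1" "r \<le> 1" "r < R" "8 * (1 + C) * r \<le> R"
  proof -
    show "0 < r" using r1 R(1) C by (auto simp: r_def)
    have "r \<le> R / 2" "r \<le> r1 / 2" "r \<le> 1" "r \<le> R / (8 * (1 + C))" unfolding r_def by (rule Min_le; simp)+
    then show "2 * r \<le> r1" "r \<le> 1" "r < R" "8 * (1 + C) * r \<le> R" using R(1) C by (simp_all add: field_simps)
  qed
  define m where "m x y = f (a + x, a + y) - a" for x y
  have pair_le: "norm ((x::'e), (y::'e)) \<le> norm x + norm y" for x y by (rule norm_Pair_le)
  have m_app: "norm (m x' y' - m x y - ((x' - x) + (y' - y))) \<le> C * \<rho> * (norm (x' - x) + norm (y' - y))"
    if mem: "x \<in> E" "y \<in> E" "x' \<in> E" "y' \<in> E" and b: "norm x \<le> \<rho>" "norm y \<le> \<rho>" "norm x' \<le> \<rho>" "norm y' \<le> \<rho>" "\<rho> \<le> r"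
    for x y x' y' \<rho>
  proof -
    have \<rho>0: "0 \<le> \<rho>" using b(1) norm_ge_zero[of x] by linarith
    let ?p = "(a + x, a + y)" and ?q = "(a + x', a + y')"
    have "norm (f ?q - f ?p - f' (?q - ?p)) \<le> C1 * (2 * \<rho>) * norm (?q - ?p)"
      using mem b r(2) shift order_trans[OF pair_le[of x y]] order_trans[OF pair_le[of x' y']]
      by (intro est0[rule_format]) auto
    also have "\<dots> \<le> C1 * (2 * \<rho>) * (norm (x' - x) + norm (y' - y))"
      using pair_le[of "x' - x" "y' - y"] C1 \<rho>0 by (intro mult_left_mono) auto
    finally show ?thesis
      using f'eq[of "x' - x" "y' - y"] mem subspace_diff[OF E] by (simp add: m_def C_def mult_ac)
  qed
  have inW: "(a + x, a + y) \<in> W" if "x \<in> E" "y \<in> E" "norm x \<le> r" "norm y \<le> r" for x y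
  proof -
    have "norm (x, y) \<le> r1" using pair_le[of x y] that r(2) by linarith
    then have "(a + x, a + y) \<in> cball (a, a) r1" by (simp add: dist_norm norm_minus_commute norm_Pair)
    then show ?thesis using rW that shift by blast
  qed
  have m_prop: "m x y \<in> E \<and> norm (m x y) < R \<and> \<psi> (m x y) = \<psi> x \<otimes> \<psi> y"
    if xy: "x \<in> E" "y \<in> E" "norm x \<le> r" "norm y \<le> r" for x y
  proof -
    let ?p = "chart_inv c (a + x) \<otimes> chart_inv c (a + y)"
    have p: "?p \<in> fst c" using W(4) inW[OF xy] by fastforce
    have f: "f (a + x, a + y) = snd c ?p" by (simp add: f_def)
    have "m x y \<in> E" using subspace_diff[OF E range_E aE] p by (simp add: m_def f)
    moreover have "\<psi> (m x y) = \<psi> x \<otimes> \<psi> y" using chart_inv_left[OF cM p] by (simp add: \<psi>_def m_def f)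
    moreover have "norm (m x y) < R"
    proof -
      have "norm (m x y - m 0 0 - ((x - 0) + (y - 0))) \<le> C * r * (norm (x - 0) + norm (y - 0))"
        using xy subspace_0[OF E] r by (intro m_app) auto
      moreover have "m 0 0 = 0" by (simp add: m_def f_aa)
      moreover have "norm (m x y) \<le> norm (m x y - (x + y)) + (norm x + norm y)" by norm
      moreover have "C * r * (norm x + norm y) \<le> C * 1 * (2 * r)"
        using C r xy by (intro mult_mono) auto
      ultimately have "norm (m x y) \<le> 2 * (1 + C) * r" using xy by (simp add: algebra_simps)
      also have "\<dots> < 8 * (1 + C) * r" using C r(1) by simp
      finally show ?thesis using r(5) by linarith
    qed
    ultimately show ?thesis by blast
  qed
  define cj where "cj g x = chart_rep (conj_by g) c c (a + x) - a" for g x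
  have rep_a: "chart_rep (conj_by g) c c a = a" if "g \<in> carrier G" for g
    using that by (simp add: chart_rep_def inv_a) (simp add: a_def)
  have cj_prop: "\<exists>d>0. d \<le> r \<and> continuous_on {x \<in> E. norm x < d} (cj h) \<and>
      (\<forall>x\<in>E. norm x < d \<longrightarrow> cj h x \<in> E \<and> norm (cj h x) < R \<and> \<psi> (cj h x) = h \<otimes> \<psi> x \<otimes> inv h)"
    if h: "h \<in> carrier G" for h
  proof -
    let ?k = "chart_rep (conj_by h) c c"
    have c1: "c \<in> charts_at M (conj_by h \<one>)" using c h by simp
    obtain T where T: "openin (top_of_set E) T" "T \<subseteq> chart_range c" "a \<in> T"
      "\<And>x. x \<in> T \<Longrightarrow> conj_by h (chart_inv c x) \<in> fst c" "\<And>x. x \<in> T \<Longrightarrow> ?k x \<in> E"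
      using chart_rep_nbhd[OF continuous_conj[OF h] c c1] unfolding E_def a_def by blast
    have "continuous_map (top_of_set T) (mtop M) (\<lambda>x. conj_by h (chart_inv c x))"
      using continuous_map_compose[OF continuous_map_from_subtopology_mono[OF continuous_map_chart_inv[OF cM] T(2)] continuous_conj[OF h]]
      by (simp add: o_def)
    then have "continuous_map (top_of_set T) (subtopology (mtop M) (fst c)) (\<lambda>x. conj_by h (chart_inv c x))"
      using T(4) by (auto simp: continuous_map_in_subtopology)
    from continuous_map_compose[OF this homeomorphic_imp_continuous_map[OF chart_homeo'[OF cM]]]
    have cont: "continuous_on T ?k"
      by (simp add: continuous_map_in_subtopology chart_rep_def o_def)
    obtain d1 where d1: "d1 > 0" "ball a d1 \<inter> E \<subseteq> T" using T(1,3) unfolding openin_contains_ball by blast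
    obtain d2 where d2: "d2 > 0" "\<And>x. x \<in> T \<Longrightarrow> dist x a < d2 \<Longrightarrow> dist (?k x) (?k a) < R"
      using cont T(3) R(1) unfolding continuous_on_iff by blast
    define d where "d = Min {r, d1, d2}"
    have d: "d > 0" "d \<le> r" "d \<le> d1" "d \<le> d2" using r d1 d2 by (auto simp: d_def)
    have inT: "a + x \<in> T" if "x \<in> E" "norm x < d" for x
      using d1(2) that d shift[of x] by (auto simp: subset_iff dist_norm)
    have "continuous_on {x \<in> E. norm x < d} (cj h)" unfolding cj_def
      by (intro continuous_intros continuous_on_compose2[OF cont]) (use inT in auto)
    moreover have "cj h x \<in> E \<and> norm (cj h x) < R \<and> \<psi> (cj h x) = h \<otimes> \<psi> x \<otimes> inv h" if x: "x \<in> E" "norm x < d" for x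
    proof (intro conjI)
      note xT = inT[OF x]
      show "cj h x \<in> E" unfolding cj_def by (rule subspace_diff[OF E T(5)[OF xT] aE])
      show "norm (cj h x) < R"
        using d2(2)[OF xT] x d rep_a[OF h] by (simp add: cj_def dist_norm)
      show "\<psi> (cj h x) = h \<otimes> \<psi> x \<otimes> inv h"
        using chart_inv_left[OF cM T(4)[OF xT]] by (simp add: \<psi>_def cj_def chart_rep_def)
    qed
    ultimately show ?thesis using d by blast
  qed
  have "local_lie_coords G E \<psi> R r C m cj (Ad_rep c)"
  proof (intro local_lie_coords.intro is_group local_lie_coords_axioms.intro)
    show "subspace E" "0 < r" "r < R" "0 < C" using E r C by auto
    show "\<psi> x \<in> carrier G" if "x \<in> E" "norm x < R" for x
      unfolding \<psi>_def by (rule carr[OF chart_inv_mem[OF inr[OF that]]])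
    show "x = y" if "x \<in> E" "y \<in> E" "norm x < R" "norm y < R" "\<psi> x = \<psi> y" for x y
    proof -
      have "a + x = snd c (\<psi> x)" unfolding \<psi>_def by (rule chart_inv_right[OF inr[OF that(1,3)], symmetric])
      also have "\<dots> = snd c (\<psi> y)" by (simp only: that(5))
      also have "\<dots> = a + y" unfolding \<psi>_def by (rule chart_inv_right[OF inr[OF that(2,4)]])
      finally show ?thesis by simp
    qed
    show "\<psi> 0 = \<one>" by (simp add: \<psi>_def inv_a)
    show "m x y \<in> E \<and> norm (m x y) < R \<and> \<psi> (m x y) = \<psi> x \<otimes> \<psi> y"
      if "x \<in> E" "y \<in> E" "norm x \<le> r" "norm y \<le> r" for x y by (rule m_prop[OF that])
    show "norm (m x' y' - m x y - ((x' - x) + (y' - y))) \<le> C * \<rho> * (norm (x' - x) + norm (y' - y))"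
      if "x \<in> E" "y \<in> E" "x' \<in> E" "y' \<in> E" "norm x \<le> \<rho>" "norm y \<le> \<rho>" "norm x' \<le> \<rho>" "norm y' \<le> \<rho>" "\<rho> \<le> r"
      for x y x' y' \<rho> by (rule m_app[OF that])
    show "\<exists>d>0. d \<le> r \<and> continuous_on {x \<in> E. norm x < d} (cj h) \<and>
      (\<forall>x\<in>E. norm x < d \<longrightarrow> cj h x \<in> E \<and> norm (cj h x) < R \<and> \<psi> (cj h x) = h \<otimes> \<psi> x \<otimes> inv h)"
      if "h \<in> carrier G" for h by (rule cj_prop[OF that])
    show "\<exists>d>0. \<forall>x\<in>E. norm x < d \<longrightarrow> norm (cj h x - Ad_rep c h x) \<le> e * norm x"
      if h: "h \<in> carrier G" and e: "e > 0" for h e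
    proof -
      have "(chart_rep (conj_by h) c c has_derivative Ad_rep c h) (at a within chart_range c)"
        unfolding a_def Ad_rep_def by (rule chart_rep_conj_derivative[OF h c c])
      from this[unfolded has_derivative_within_alt, THEN conjunct2, rule_format, OF e]
      obtain d where d: "d > 0" "\<forall>y\<in>chart_range c. norm (y - a) < d \<longrightarrow>
         norm (chart_rep (conj_by h) c c y - chart_rep (conj_by h) c c a - Ad_rep c h (y - a)) \<le> e * norm (y - a)"
        by (elim exE conjE)
      have "norm (cj h x - Ad_rep c h x) \<le> e * norm x" if "x \<in> E" "norm x < min d R" for x
        using d(2)[rule_format, of "a + x"] inr[of x] that rep_a[OF h] by (simp add: cj_def algebra_simps)
      then show ?thesis using d(1) R(1) by (intro exI[of _ "min d R"]) auto
    qed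
    show "linear (Ad_rep c h)" if "h \<in> carrier G" for h
      unfolding Ad_rep_def using chart_rep_conj_derivative[OF that c c] by (rule has_derivative_linear)
    show "Ad_rep c h x \<in> E" if "h \<in> carrier G" "x \<in> E" for h x
      using Ad_rep_closed[OF that(1) c] that(2) by (simp add: E_def)
  qed
  then show ?thesis unfolding E_def \<psi>_def a_def by blast
qed

lemma power_regular_closedin:
  assumes k: "k > 0"
  shows "closedin (subtopology (mtop M) (regular_elements G M)) (power_map G k ` carrier G \<inter> regular_elements G M)"
proof -
  obtain c where c: "c \<in> charts_at M \<one>" using charts_at_ex[of \<one>] topspace_carrier by auto
  note cA = charts_atD[OF c]
  define a where "a = snd c \<one>"
  define \<psi> where "\<psi> = (\<lambda>v. chart_inv c (a + v))"
  obtain R r C m cj where "local_lie_coords G (model M) \<psi> R r C m cj (Ad_rep c)"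
    using local_lie_coords_at_one[OF c] unfolding \<psi>_def a_def by blast
  then interpret L: local_lie_coords G "model M" \<psi> R r C m cj "Ad_rep c" .
  have reg: "regular_elements G M = {g \<in> carrier G. L.regular g}"
    unfolding regular_elements_def L.regular_def L.ad_nil_def
    by (auto simp: tangent_dim_nilspace_Ad[OF _ c])
  let ?Reg = "regular_elements G M" and ?P = "power_map G k ` carrier G"
  have Reg_sub: "?Reg \<subseteq> topspace (mtop M)" by (auto simp: reg topspace_carrier)
  have nbhd: "\<exists>W. openin (mtop M) W \<and> g \<in> W \<and> W \<inter> ?Reg \<inter> ?P = {}" if g: "g \<in> ?Reg" "g \<notin> ?P" for g
  proof -
    have gG: "g \<in> carrier G" and gr: "L.regular g" using g(1) by (auto simp: reg)
    obtain d where d: "d > 0" and pers: "\<forall>w\<in>model M. norm w < d \<longrightarrow> (\<forall>h\<in>carrier G. h [^] k = \<psi> w \<otimes> g \<longrightarrow>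
      L.regular (\<psi> w \<otimes> g) \<longrightarrow> (\<exists>x\<in>carrier G. x [^] k = g))"
      using L.root_persists[OF gG gr k] by (elim exE conjE)
    define V where "V = {p \<in> fst c. snd c p \<in> ball a d \<inter> model M}"
    have V: "openin (mtop M) V" unfolding V_def
      using cA by (intro chart_preimage_openin) (auto simp: openin_open)
    have cont: "continuous_map (mtop M) (mtop M) (\<lambda>p. p \<otimes> inv g)"
      by (intro continuous_map_mult continuous_const inv_closed gG) simp
    \<comment> \<open>\<open>W\<close> is the right translate of \<open>V\<close> by
      \<open>g\<close>; its points are \<open>\<psi> w \<otimes> g\<close> with
      \<open>norm w < d\<close>, the form handled by \<open>root_persists\<close>.\<close>
    define W where "W = {p \<in> carrier G. p \<otimes> inv g \<in> V}"
    have W: "openin (mtop M) W"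
      using openin_continuous_map_preimage[OF cont V] unfolding W_def topspace_carrier .
    have "\<one> \<in> V" using cA d chart_range_subset[of c] by (auto simp: V_def a_def)
    then have "g \<in> W" using gG by (simp add: W_def)
    moreover have "p \<notin> ?P" if p: "p \<in> W" "p \<in> ?Reg" for p
    proof
      assume "p \<in> ?P"
      then obtain h where h: "h \<in> carrier G" "h [^] k = p" by (auto simp: power_map_def)
      have pG: "p \<in> carrier G" using p by (simp add: W_def)
      have q: "p \<otimes> inv g \<in> V" using p by (simp add: W_def)
      define w where "w = snd c (p \<otimes> inv g) - a"
      have wE: "w \<in> model M" "norm w < d"
        using q subspace_diff[OF subspace_model] chart_range_subset[of c] cA
        by (auto simp: w_def V_def a_def dist_norm norm_minus_commute)
      have "\<psi> w = p \<otimes> inv g"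
        using q cA by (simp add: \<psi>_def w_def V_def chart_inv_left)
      then have pw: "\<psi> w \<otimes> g = p" using pG gG by (simp add: m_assoc)
      have "\<exists>x\<in>carrier G. x [^] k = g"
        using pers[rule_format, OF wE h(1)] h(2) p(2) by (simp add: pw reg)
      then show False using g(2) by (auto simp: power_map_def image_iff)
    qed
    ultimately show ?thesis using W by blast
  qed
  have "openin (subtopology (mtop M) ?Reg) (?Reg - ?P)"
  proof (subst openin_subopen, intro ballI)
    fix g assume "g \<in> ?Reg - ?P"
    then obtain W where W: "openin (mtop M) W" "g \<in> W" "W \<inter> ?Reg \<inter> ?P = {}" using nbhd by blast
    have "openin (subtopology (mtop M) ?Reg) (W \<inter> ?Reg)"
      using W(1) by (auto simp: openin_subtopology)
    then show "\<exists>T. openin (subtopology (mtop M) ?Reg) T \<and> g \<in> T \<and> T \<subseteq> ?Reg - ?P"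
      using W \<open>g \<in> ?Reg - ?P\<close> by (intro exI[of _ "W \<inter> ?Reg"]) blast
  qed
  moreover have "topspace (subtopology (mtop M) ?Reg) = ?Reg" using Reg_sub by (rule topspace_subtopology_subset)
  moreover have "?Reg - (?P \<inter> ?Reg) = ?Reg - ?P" by blast
  ultimately show ?thesis unfolding closedin_def by simp
qed

end

theorem theorem1p2:
  fixes G :: "('a, 'm) monoid_scheme"
    and M :: "('a, 'e::euclidean_space) manifold"
    and k :: nat
  assumes "lie_group G M"
    and "connected_space (mtop M)"
    and "k > 1"
  shows "closedin (subtopology (mtop M) (regular_elements G M))
           (power_map G k ` carrier G \<inter> regular_elements G M)"
proof -
  interpret lie_group G M by fact
  show ?thesis using assms(3) by (intro power_regular_closedin) simp
qed

end
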